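(* Assume (FR), (NR) and (NS). Then: (i) there exists an isomorphism of algebraic varieties $\theta:\mathcal F\to\mathcal Y'$ between $\mathcal F$ and an affine Segre surface $\mathcal Y'\subset\mathbf C^4$; (ii) the algebraic surface $\mathcal Y'$ is smooth; (iii) the algebraic surface $\mathcal F$ is rational; (iv) the algebraic surface $\mathcal F$ is affine.
   Context: An affine Segre surface is a surface in $\mathbf C^4$ which is the intersection of two (affine) quadrics of $\mathbf C^4$. Fix $q\in\mathbf C^*$, $|q|<1$; for $c,d\in\mathbf C^*$ write $c\equiv d$ iff $c/d\in q^{\mathbf Z}$. Parameters: $\rho_1,\rho_2,\sigma_1,\sigma_2,x_1,\dots,x_4\in\mathbf C^*$, with conditions: (NR) $\rho_1\not\equiv\rho_2$, $\sigma_1\not\equiv\sigma_2$, and $x_k\not\equiv x_l$ for $k\ne l$; (FR) $x_1x_2x_3x_4=\rho_1\rho_2/(\sigma_1\sigma_2)$; (NS) $\rho_i/\sigma_j\not\equiv x_kx_l$ for all $i,j\in\{1,2\}$, $k\neq l$. $V_{i,j}:=\{m\in\mathcal O(\mathbf C^* )\mid m(qx)=(\rho_i/\sigma_j)x^{-2}m(x)\}$ (complex vector space of dimension 2), $V:=\prod_{i,j\in\{1,2\}}V_{i,j}$ (elements are $2\times 2$ matrices $M=(m_{i,j})$), $V^{( * )}:=\prod(V_{i,j}\setminus\{0\})$. With $D_2(\mathbf C)$ the group of invertible diagonal $2\times2$ matrices, the torus $H:=(D_2(\mathbf C)\times D_2(\mathbf C))/\mathbf C^*(I_2,I_2)$ acts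 by $(\Gamma,\Delta).M=\Gamma M\Delta^{-1}$, and $V^{( * )}$ has a geometric quotient $V^{( * )}\to V^{( * )}/H$ (a good quotient whose fibers are the orbits). $F:=\{M\in V\mid\det M\not\equiv0,\ \det M(x_k)=0,\ k=1,\dots,4\}$ is contained in $V^{( * )}$, and $\mathcal F\subset V^{( * )}/H$ is its image, with its structure of subvariety. *)

theory Defs
  imports "HOL-Analysis.Analysis"
begin

section \<open>Complex varieties as spaces with functions\<close>

text \<open>
  A classical complex variety is a set of points with its Zariski topology and, for every open
  \<open>U\<close>, the set of regular functions \<open>U \<rightarrow> \<complex>\<close>. HOL functions are total, so a regular function on
  \<open>U\<close> is represented by any of its total extensions: in all constructions below, membership in
  \<open>regular X U\<close> depends only on the values on \<open>U\<close>.
\<close>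

record 'a fspace =
  zar :: "'a topology"
  regular :: "'a set \<Rightarrow> ('a \<Rightarrow> complex) set"

definition points :: "'a fspace \<Rightarrow> 'a set" where
  "points X = topspace (zar X)"

definition morphism :: "'a fspace \<Rightarrow> 'b fspace \<Rightarrow> ('a \<Rightarrow> 'b) \<Rightarrow> bool" where
  "morphism X Y \<phi> \<longleftrightarrow>
     continuous_map (zar X) (zar Y) \<phi> \<and>
     (\<forall>U f. openin (zar Y) U \<longrightarrow> f \<in> regular Y U \<longrightarrow>
        f \<circ> \<phi> \<in> regular X {p \<in> points X. \<phi> p \<in> U})"

definition isomorphism :: "'a fspace \<Rightarrow> 'b fspace \<Rightarrow> ('a \<Rightarrow> 'b) \<Rightarrow> bool" where
  "isomorphism X Y \<phi> \<longleftrightarrow>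
     morphism X Y \<phi> \<and>
     (\<exists>\<psi>. morphism Y X \<psi> \<and> (\<forall>p\<in>points X. \<psi> (\<phi> p) = p) \<and> (\<forall>y\<in>points Y. \<phi> (\<psi> y) = y))"

text \<open>The reduced structure induced on a subset (used for locally closed subsets): regular
  functions are the functions that locally extend to regular functions of the ambient space.\<close>

definition subvariety :: "'a fspace \<Rightarrow> 'a set \<Rightarrow> 'a fspace" where
  "subvariety X S =
     \<lparr> zar = subtopology (zar X) S,
       regular = (\<lambda>U. {f. \<forall>p\<in>U. \<exists>W g. openin (zar X) W \<and> p \<in> W \<and> g \<in> regular X W \<and>
                                  (\<forall>y \<in> W \<inter> U. f y = g y)}) \<rparr>"

subsection \<open>Affine spaces\<close>

text \<open>The algebra of functions generated by a set of functions \<open>L\<close>; it consists of the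
  polynomial functions when \<open>L\<close> is a set of linear coordinates.\<close>

inductive_set poly_funs :: "('a \<Rightarrow> complex) set \<Rightarrow> ('a \<Rightarrow> complex) set"
  for L :: "('a \<Rightarrow> complex) set" where
  const: "(\<lambda>_. c) \<in> poly_funs L"
| gen: "l \<in> L \<Longrightarrow> l \<in> poly_funs L"
| add: "f \<in> poly_funs L \<Longrightarrow> g \<in> poly_funs L \<Longrightarrow> (\<lambda>p. f p + g p) \<in> poly_funs L"
| mult: "f \<in> poly_funs L \<Longrightarrow> g \<in> poly_funs L \<Longrightarrow> (\<lambda>p. f p * g p) \<in> poly_funs L"

definition zariski_open :: "'a set \<Rightarrow> ('a \<Rightarrow> complex) set \<Rightarrow> 'a set \<Rightarrow> bool" where
  "zariski_open C L U \<longleftrightarrow> (\<exists>S \<subseteq> poly_funs L. U = C - {p \<in> C. \<forall>f\<in>S. f p = 0})"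

lemma istopology_zariski_open: "istopology (zariski_open C L)"
  unfolding istopology_def
proof (intro conjI allI impI)
  fix U W assume "zariski_open C L U" "zariski_open C L W"
  then obtain S T where S: "S \<subseteq> poly_funs L" "U = C - {p \<in> C. \<forall>f\<in>S. f p = 0}"
    and T: "T \<subseteq> poly_funs L" "W = C - {p \<in> C. \<forall>f\<in>T. f p = 0}"
    unfolding zariski_open_def by blast
  let ?R = "(\<lambda>(f, g) p. f p * g p) ` (S \<times> T)"
  have "?R \<subseteq> poly_funs L" using S(1) T(1) by (auto intro: poly_funs.mult)
  moreover have "U \<inter> W = C - {p \<in> C. \<forall>f\<in>?R. f p = 0}"
  proof (rule set_eqI)
    fix p
    have "(\<exists>h\<in>?R. h p \<noteq> 0) \<longleftrightarrow> (\<exists>f\<in>S. f p \<noteq> 0) \<and> (\<exists>g\<in>T. g p \<noteq> 0)"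
      by force
    then show "p \<in> U \<inter> W \<longleftrightarrow> p \<in> C - {p \<in> C. \<forall>f\<in>?R. f p = 0}"
      unfolding S(2) T(2) by blast
  qed
  ultimately show "zariski_open C L (U \<inter> W)" unfolding zariski_open_def by blast
next
  fix K assume "\<forall>U\<in>K. zariski_open C L U"
  then have "\<exists>S. \<forall>U\<in>K. S U \<subseteq> poly_funs L \<and> U = C - {p \<in> C. \<forall>f\<in>S U. f p = 0}"
    unfolding zariski_open_def by (intro bchoice) blast
  then obtain S where
    S: "\<forall>U\<in>K. S U \<subseteq> poly_funs L \<and> U = C - {p \<in> C. \<forall>f\<in>S U. f p = 0}" ..
  have "\<Union>K = C - {p \<in> C. \<forall>f \<in> (\<Union>U\<in>K. S U). f p = 0}"
  proof (rule set_eqI)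
    fix p
    have "p \<in> U \<longleftrightarrow> p \<in> C \<and> (\<exists>f\<in>S U. f p \<noteq> 0)" if "U \<in> K" for U
    proof -
      have "p \<in> U \<longleftrightarrow> p \<in> C - {p \<in> C. \<forall>f\<in>S U. f p = 0}"
        using conjunct2[OF bspec[OF S that]] by (rule arg_cong)
      then show ?thesis by blast
    qed
    then show "p \<in> \<Union>K \<longleftrightarrow> p \<in> C - {p \<in> C. \<forall>f \<in> (\<Union>U\<in>K. S U). f p = 0}"
      by auto
  qed
  moreover have "(\<Union>U\<in>K. S U) \<subseteq> poly_funs L"
    by (rule UN_least) (rule conjunct1[OF bspec[OF S]])
  ultimately show "zariski_open C L (\<Union>K)" unfolding zariski_open_def by blast
qed

definition linear_space :: "'a set \<Rightarrow> ('a \<Rightarrow> complex) set \<Rightarrow> 'a fspace" where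
  "linear_space C L =
     \<lparr> zar = topology (zariski_open C L),
       regular = (\<lambda>U. {f. \<forall>p\<in>U. \<exists>W. zariski_open C L W \<and> p \<in> W \<and> W \<subseteq> U \<and>
                       (\<exists>g \<in> poly_funs L. \<exists>h \<in> poly_funs L.
                          \<forall>y\<in>W. h y \<noteq> 0 \<and> f y = g y / h y)}) \<rparr>"

lemma openin_linear_space: "openin (zar (linear_space C L)) = zariski_open C L"
  by (simp add: linear_space_def istopology_zariski_open)

lemma points_linear_space: "points (linear_space C L) = C"
proof -
  have "C = C - {p \<in> C. \<forall>f\<in>{\<lambda>_. 1 :: complex}. f p = 0}" by simp
  then have "zariski_open C L C"
    unfolding zariski_open_def using poly_funs.const[of 1 L] by blast
  moreover have "U \<subseteq> C" if "zariski_open C L U" for U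
    using that unfolding zariski_open_def by blast
  ultimately show ?thesis
    unfolding points_def topspace_def openin_linear_space by blast
qed

definition coords :: "(complex^'n \<Rightarrow> complex) set" where
  "coords = range (\<lambda>i v. v $ i)"

definition cart_space :: "(complex^'n) fspace" where
  "cart_space = linear_space UNIV coords"

text \<open>A second model of \<open>\<complex>\<^sup>n\<close>, in which \<open>n\<close> can be quantified.\<close>

definition affine_space :: "nat \<Rightarrow> (nat \<Rightarrow> complex) fspace" where
  "affine_space n = linear_space {v. \<forall>i\<ge>n. v i = 0} {\<lambda>v. v i | i. i < n}"

definition affine_variety :: "'a fspace \<Rightarrow> bool" where
  "affine_variety X \<longleftrightarrow>
     (\<exists>n Z \<phi>. closedin (zar (affine_space n)) Z \<and>
              isomorphism X (subvariety (affine_space n) Z) \<phi>)"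

subsection \<open>Irreducibility, dimension, rationality\<close>

definition irreducible_in :: "'a topology \<Rightarrow> 'a set \<Rightarrow> bool" where
  "irreducible_in T Z \<longleftrightarrow>
     Z \<noteq> {} \<and> Z \<subseteq> topspace T \<and>
     (\<forall>A B. closedin T A \<longrightarrow> closedin T B \<longrightarrow> Z \<subseteq> A \<union> B \<longrightarrow> Z \<subseteq> A \<or> Z \<subseteq> B)"

definition irreducible_component :: "'a topology \<Rightarrow> 'a set \<Rightarrow> bool" where
  "irreducible_component T Z \<longleftrightarrow>
     irreducible_in T Z \<and> (\<forall>Z'. irreducible_in T Z' \<longrightarrow> Z \<subseteq> Z' \<longrightarrow> Z' = Z)"

text \<open>Krull dimension of a (nonempty) topological space.\<close>

definition krull_dim :: "'a topology \<Rightarrow> enat" where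
  "krull_dim T = Sup {enat n | n. \<exists>C :: nat \<Rightarrow> 'a set.
     (\<forall>i\<le>n. closedin T (C i) \<and> irreducible_in T (C i)) \<and> (\<forall>i<n. C i \<subset> C (Suc i))}"

definition local_dim :: "'a topology \<Rightarrow> 'a \<Rightarrow> enat" where
  "local_dim T p =
     Sup {krull_dim (subtopology T Z) | Z. irreducible_component T Z \<and> p \<in> Z}"

definition birational :: "'a fspace \<Rightarrow> 'b fspace \<Rightarrow> bool" where
  "birational X Y \<longleftrightarrow>
     irreducible_in (zar X) (points X) \<and> irreducible_in (zar Y) (points Y) \<and>
     (\<exists>U W \<phi>. openin (zar X) U \<and> U \<noteq> {} \<and> openin (zar Y) W \<and> W \<noteq> {} \<and>
              isomorphism (subvariety X U) (subvariety Y W) \<phi>)"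

definition rational_surface :: "'a fspace \<Rightarrow> bool" where
  "rational_surface X \<longleftrightarrow> birational X (cart_space :: (complex^2) fspace)"

subsection \<open>Smoothness and affine Segre surfaces\<close>

definition vanishing_ideal :: "(complex^'n) set \<Rightarrow> (complex^'n \<Rightarrow> complex) set" where
  "vanishing_ideal Y = {f \<in> poly_funs coords. \<forall>y\<in>Y. f y = 0}"

text \<open>The Zariski tangent space; \<open>deriv (\<lambda>t. f (p + t *s v)) 0\<close> is the differential of \<open>f\<close> at
  \<open>p\<close>, applied to \<open>v\<close>.\<close>

definition tangent_space :: "(complex^'n) set \<Rightarrow> complex^'n \<Rightarrow> (complex^'n) set" where
  "tangent_space Y p = {v. \<forall>f \<in> vanishing_ideal Y. deriv (\<lambda>t. f (p + t *s v)) 0 = 0}"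

definition smooth :: "(complex^'n) set \<Rightarrow> bool" where
  "smooth Y \<longleftrightarrow>
     (\<forall>p\<in>Y. enat (vec.dim (tangent_space Y p)) = local_dim (zar (subvariety cart_space Y)) p)"

definition affine_quadric :: "(complex^'n) set \<Rightarrow> bool" where
  "affine_quadric Q \<longleftrightarrow>
     (\<exists>(A :: complex^'n^'n) b c. transpose A = A \<and> A \<noteq> 0 \<and>
        Q = {v. (\<Sum>i\<in>UNIV. \<Sum>j\<in>UNIV. A $ i $ j * v $ i * v $ j)
                + (\<Sum>i\<in>UNIV. b $ i * v $ i) + c = 0})"

definition affine_segre_surface :: "(complex^4) set \<Rightarrow> bool" where
  "affine_segre_surface Y \<longleftrightarrow>
     (\<exists>Q1 Q2. affine_quadric Q1 \<and> affine_quadric Q2 \<and> Y = Q1 \<inter> Q2) \<and>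
     krull_dim (zar (subvariety cart_space Y)) = 2"

subsection \<open>Geometric quotients\<close>

text \<open>The geometric quotient, on the set of orbits, by a group whose orbit map is \<open>orb\<close>: it
  carries the quotient topology, and its regular functions are the invariant regular functions
  upstairs.\<close>

definition quotient_open :: "'a fspace \<Rightarrow> ('a \<Rightarrow> 'b) \<Rightarrow> 'b set \<Rightarrow> bool" where
  "quotient_open X orb U \<longleftrightarrow>
     U \<subseteq> orb ` points X \<and> openin (zar X) {p \<in> points X. orb p \<in> U}"

lemma istopology_quotient_open: "istopology (quotient_open X orb)"
  unfolding istopology_def
proof (intro conjI allI impI)
  fix S T assume "quotient_open X orb S" "quotient_open X orb T"
  moreover have "{p \<in> points X. orb p \<in> S \<inter> T} =
      {p \<in> points X. orb p \<in> S} \<inter> {p \<in> points X. orb p \<in> T}" by blast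
  ultimately show "quotient_open X orb (S \<inter> T)"
    unfolding quotient_open_def by auto
next
  fix K assume K: "\<forall>S\<in>K. quotient_open X orb S"
  have "{p \<in> points X. orb p \<in> \<Union>K} = (\<Union>S\<in>K. {p \<in> points X. orb p \<in> S})" by blast
  moreover have "openin (zar X) (\<Union>S\<in>K. {p \<in> points X. orb p \<in> S})"
    using K unfolding quotient_open_def by (intro openin_Union) blast
  ultimately show "quotient_open X orb (\<Union>K)"
    using K unfolding quotient_open_def by auto
qed

definition quotient :: "'a fspace \<Rightarrow> ('a \<Rightarrow> 'b) \<Rightarrow> 'b fspace" where
  "quotient X orb =
     \<lparr> zar = topology (quotient_open X orb),
       regular = (\<lambda>U. {f. f \<circ> orb \<in> regular X {p \<in> points X. orb p \<in> U}}) \<rparr>"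

lemma openin_quotient: "openin (zar (quotient X orb)) = quotient_open X orb"
  by (simp add: quotient_def istopology_quotient_open)


section \<open>The space of monodromy data\<close>

definition qequiv :: "complex \<Rightarrow> complex \<Rightarrow> complex \<Rightarrow> bool" where
  "qequiv q c d \<longleftrightarrow> (\<exists>n::int. c / d = q powi n)"

type_synonym fun_matrix = "(complex \<Rightarrow> complex)^2^2"

definition mat_at :: "fun_matrix \<Rightarrow> complex \<Rightarrow> complex^2^2" where
  "mat_at M z = (\<chi> i j. (M $ i $ j) z)"

text \<open>Functions on \<open>\<complex>\<^sup>*\<close> are represented as functions on \<open>\<complex>\<close> with the conventional value 0 at 0,
  which makes the representation unique.\<close>

definition theta_space :: "complex \<Rightarrow> complex \<Rightarrow> (complex \<Rightarrow> complex) set" where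
  "theta_space q c =
     {m. m holomorphic_on (- {0}) \<and> m 0 = 0 \<and> (\<forall>z. z \<noteq> 0 \<longrightarrow> m (q * z) = c / z\<^sup>2 * m z)}"

definition V :: "complex \<Rightarrow> complex^2 \<Rightarrow> complex^2 \<Rightarrow> fun_matrix set" where
  "V q \<rho> \<sigma> = {M. \<forall>i j. M $ i $ j \<in> theta_space q (\<rho> $ i / \<sigma> $ j)}"

definition V_star :: "complex \<Rightarrow> complex^2 \<Rightarrow> complex^2 \<Rightarrow> fun_matrix set" where
  "V_star q \<rho> \<sigma> = {M \<in> V q \<rho> \<sigma>. \<forall>i j. M $ i $ j \<noteq> (\<lambda>_. 0)}"

definition V_dual :: "complex \<Rightarrow> complex^2 \<Rightarrow> complex^2 \<Rightarrow> (fun_matrix \<Rightarrow> complex) set" where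
  "V_dual q \<rho> \<sigma> = {l. \<forall>M \<in> V q \<rho> \<sigma>. \<forall>N \<in> V q \<rho> \<sigma>. \<forall>a b.
     l (\<chi> i j. (\<lambda>z. a * (M $ i $ j) z + b * (N $ i $ j) z)) = a * l M + b * l N}"

text \<open>The algebraic structure of the finite-dimensional vector space \<open>V\<close> uses all linear forms
  on \<open>V\<close> as coordinates, so that no basis has to be chosen.\<close>

definition V_space :: "complex \<Rightarrow> complex^2 \<Rightarrow> complex^2 \<Rightarrow> fun_matrix fspace" where
  "V_space q \<rho> \<sigma> = linear_space (V q \<rho> \<sigma>) (V_dual q \<rho> \<sigma>)"

definition D2 :: "(complex^2^2) set" where
  "D2 = {\<Gamma>. invertible \<Gamma> \<and> (\<forall>i j. i \<noteq> j \<longrightarrow> \<Gamma> $ i $ j = 0)}"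

definition act :: "complex^2^2 \<Rightarrow> complex^2^2 \<Rightarrow> fun_matrix \<Rightarrow> fun_matrix" where
  "act \<Gamma> \<Delta> M = (\<chi> i j. (\<lambda>z. (\<Gamma> ** mat_at M z ** matrix_inv \<Delta>) $ i $ j))"

text \<open>Since the pairs \<open>(c I\<^sub>2, c I\<^sub>2)\<close> act trivially, the orbits of
  \<open>H = (D\<^sub>2 \<times> D\<^sub>2) / \<complex>\<^sup>* (I\<^sub>2, I\<^sub>2)\<close> are those of \<open>D\<^sub>2 \<times> D\<^sub>2\<close>.\<close>

definition orbit :: "fun_matrix \<Rightarrow> fun_matrix set" where
  "orbit M = {act \<Gamma> \<Delta> M | \<Gamma> \<Delta>. \<Gamma> \<in> D2 \<and> \<Delta> \<in> D2}"

definition V_star_mod_H :: "complex \<Rightarrow> complex^2 \<Rightarrow> complex^2 \<Rightarrow> fun_matrix set fspace" where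
  "V_star_mod_H q \<rho> \<sigma> = quotient (subvariety (V_space q \<rho> \<sigma>) (V_star q \<rho> \<sigma>)) orbit"

definition F :: "complex \<Rightarrow> complex^2 \<Rightarrow> complex^2 \<Rightarrow> complex^4 \<Rightarrow> fun_matrix set" where
  "F q \<rho> \<sigma> x = {M \<in> V q \<rho> \<sigma>.
     (\<exists>z. z \<noteq> 0 \<and> det (mat_at M z) \<noteq> 0) \<and> (\<forall>k. det (mat_at M (x $ k)) = 0)}"

definition F_variety ::
    "complex \<Rightarrow> complex^2 \<Rightarrow> complex^2 \<Rightarrow> complex^4 \<Rightarrow> fun_matrix set fspace" where
  "F_variety q \<rho> \<sigma> x = subvariety (V_star_mod_H q \<rho> \<sigma>) (orbit ` F q \<rho> \<sigma> x)"

definition NR :: "complex \<Rightarrow> complex^2 \<Rightarrow> complex^2 \<Rightarrow> complex^4 \<Rightarrow> bool" where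
  "NR q \<rho> \<sigma> x \<longleftrightarrow>
     \<not> qequiv q (\<rho> $ 1) (\<rho> $ 2) \<and> \<not> qequiv q (\<sigma> $ 1) (\<sigma> $ 2) \<and>
     (\<forall>k l. k \<noteq> l \<longrightarrow> \<not> qequiv q (x $ k) (x $ l))"

definition FR :: "complex^2 \<Rightarrow> complex^2 \<Rightarrow> complex^4 \<Rightarrow> bool" where
  "FR \<rho> \<sigma> x \<longleftrightarrow> x $ 1 * x $ 2 * x $ 3 * x $ 4 = \<rho> $ 1 * \<rho> $ 2 / (\<sigma> $ 1 * \<sigma> $ 2)"

definition NS :: "complex \<Rightarrow> complex^2 \<Rightarrow> complex^2 \<Rightarrow> complex^4 \<Rightarrow> bool" where
  "NS q \<rho> \<sigma> x \<longleftrightarrow>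
     (\<forall>i j k l. k \<noteq> l \<longrightarrow> \<not> qequiv q (\<rho> $ i / \<sigma> $ j) (x $ k * x $ l))"

end

theory Submission
  imports Defs "HOL-Complex_Analysis.Conformal_Mappings" "HOL-Library.Function_Algebras"
begin

text \<open>
  By (NS), evaluation at any two of the points \<open>x\<^sub>k\<close> identifies each \<open>V\<^sub>i\<^sub>j\<close> with \<open>\<complex>\<^sup>2\<close>. Up to \<open>H\<close>, a matrix
  \<open>M \<in> F\<close> is the pair of rank one tensors \<open>m\<^sub>1\<^sub>1 \<otimes> m\<^sub>2\<^sub>2\<close>, \<open>m\<^sub>1\<^sub>2 \<otimes> m\<^sub>2\<^sub>1\<close>, up to a common factor that is
  removed by \<open>det M(x0) = 1\<close> at an auxiliary point \<open>x0\<close>. The conditions \<open>det M(x\<^sub>k) = 0\<close> are linear in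
  this pair, and by (FR) the fourth one follows from the others; what remains is a four-dimensional
  affine space in which the two rank conditions are quadrics. With entries \<open>(p, u; v, r)\<close> and
  \<open>(s1 p, w; z, s2 r)\<close> of the two tensors, the cone over the surface is
  \<open>u v = p r\<close>, \<open>z w = s1 s2 p r\<close>, \<open>w + z = u + v + (1 - s1) p + (1 - s2) r\<close>,
  and (NR), (NS) give \<open>s1, s2 \<notin> {0, 1}\<close> and \<open>s1 \<noteq> s2\<close>. This is all that is used about the cone.

  The coordinate ring of the cone is free of rank 4 over \<open>\<complex>[p, r, u + v]\<close>, so a polynomial vanishing on
  the open chart parametrized by \<open>(p/v, z/v) \<in> \<complex>\<^sup>2\<close> belongs to the ideal of the two quadrics. Hence
  the surface is irreducible and rational, and its tangent spaces are the common kernels of the two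
  differentials, which are independent because \<open>s1 \<noteq> s2\<close>. A chain of four irreducible closed subsets
  would give three algebraically independent functions of two variables.
\<close>

section \<open>Theta functions\<close>

text \<open>The point \<open>x0\<close> comes from the existence of a single element of
  \<open>F\<close>, so the linear form \<open>D\<close>, which is \<open>det M(x0)\<close> written
  in the five coordinates of the cone, is known only to be nonzero. Statements about the surface
  \<open>D = 1\<close> must therefore hold for an arbitrary such hyperplane section. This shapes the
  argument: ideals are computed on the homogeneous cone, and a polynomial on \<open>D = 1\<close> is
  homogenized and multiplied by \<open>D\<close>, so that it also vanishes at the points with
  \<open>D = 0\<close>. (FR) enters through degrees: \<open>det M\<close> is a theta function of
  degree 4 with multiplier \<open>x1 x2 x3 x4\<close>, which three zeros determine up to a constant
  factor. Each of \<open>s1 = 1\<close>, \<open>s2 = 1\<close>, \<open>s1 = s2\<close> would make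
  two products of theta functions with a common zero agree at two more points. The quotient by
  \<open>H\<close> has no coordinates of its own. Morphisms out of it are invariant rational maps on
  an open set upstairs; morphisms into it are given by local sections, which divide by one nonzero
  entry of each rank one tensor.\<close>

lemma field_differentiable_cong_ev:
  assumes "\<forall>\<^sub>F y in nhds z. f y = g y"
  shows "f field_differentiable at z \<longleftrightarrow> g field_differentiable at z"
  unfolding field_differentiable_def using DERIV_cong_ev[OF refl assms refl] by simp

lemma holomorphic_ev_nonzero:
  fixes f :: "complex \<Rightarrow> complex"
  assumes "f holomorphic_on S" "open S" "z \<in> S" "f z \<noteq> 0"
  shows "\<forall>\<^sub>F y in nhds z. y \<in> S \<and> f y \<noteq> 0"
proof -
  have "isCont f z"
    using assms by (metis continuous_on_eq_continuous_at holomorphic_on_imp_continuous_on)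
  then have "(f \<longlongrightarrow> f z) (nhds z)"
    by (simp add: isCont_def tendsto_at_iff_tendsto_nhds)
  then have "\<forall>\<^sub>F y in nhds z. f y \<in> - {0}"
    by (rule topological_tendstoD) (use assms in auto)
  then show ?thesis
    using eventually_nhds_in_open[OF assms(2,3)] by eventually_elim auto
qed

section \<open>The q-Pochhammer symbol and the Jacobi theta function\<close>

locale nome =
  fixes q :: complex
  assumes q_nz: "q \<noteq> 0" and q_lt1: "norm q < 1"
begin

text \<open>The infinite q-Pochhammer symbol (x; q), an entire function whose zeros are the powers
  of \<open>q\<close> with exponent at most 0.\<close>

definition qpoch :: "complex \<Rightarrow> complex" where
  "qpoch x = (\<Prod>n. 1 - q ^ n * x)"

lemma convergent_qpoch: "convergent_prod (\<lambda>n. 1 - q ^ n * x)"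
proof -
  have "summable (\<lambda>n. norm (q ^ n * x))"
    using q_lt1 by (simp add: norm_mult norm_power summable_mult2 summable_geometric)
  then show ?thesis
    by (intro abs_convergent_prod_imp_convergent_prod summable_imp_abs_convergent_prod) simp
qed

lemma qpoch_rec: "qpoch x = (1 - x) * qpoch (q * x)"
proof -
  have 1: "(\<lambda>n. \<Prod>i\<le>Suc n. 1 - q ^ i * x) \<longlonglongrightarrow> qpoch x"
    unfolding qpoch_def using convergent_prod_LIMSEQ[OF convergent_qpoch] by (rule LIMSEQ_Suc)
  have "(\<lambda>n. (1 - x) * (\<Prod>i\<le>n. 1 - q ^ i * (q * x))) \<longlonglongrightarrow> (1 - x) * qpoch (q * x)"
    unfolding qpoch_def using convergent_prod_LIMSEQ[OF convergent_qpoch] by (rule tendsto_mult_left)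
  also have "(\<lambda>n. (1 - x) * (\<Prod>i\<le>n. 1 - q ^ i * (q * x))) = (\<lambda>n. \<Prod>i\<le>Suc n. 1 - q ^ i * x)"
    by (simp only: prod.atMost_Suc_shift) (simp add: mult.assoc mult.left_commute)
  finally show ?thesis using 1 LIMSEQ_unique by blast
qed

lemma qpoch_nz: "(\<And>n. q ^ n * x \<noteq> 1) \<Longrightarrow> qpoch x \<noteq> 0"
  unfolding qpoch_def by (intro prodinf_nonzero convergent_qpoch) auto

lemma qpoch_zero: "q ^ n * x = 1 \<Longrightarrow> qpoch x = 0"
proof (induction n arbitrary: x)
  case 0
  then show ?case using qpoch_rec[of x] by simp
next
  case (Suc n)
  then have "q ^ n * (q * x) = 1" by (simp add: mult.assoc mult.left_commute)
  then show ?case using Suc.IH qpoch_rec[of x] by simp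
qed

text \<open>On a closed unit disc the factors differ from 1 by at most
  \<open>norm q ^ n * R\<close>, so the partial products converge uniformly.\<close>

lemma holomorphic_qpoch: "qpoch holomorphic_on UNIV"
proof (rule holomorphic_uniform_sequence)
  show "(\<lambda>x. \<Prod>n<N. 1 + - (q ^ n * x)) holomorphic_on UNIV" for N
    by (intro holomorphic_intros)
  fix x :: complex
  define R where "R = norm x + 1"
  have "uniformly_convergent_on (cball x 1) (\<lambda>N x. \<Sum>n<N. norm (- (q ^ n * x)))"
  proof (rule Weierstrass_m_test')
    show "summable (\<lambda>n. norm q ^ n * R)"
      using q_lt1 by (simp add: summable_mult2 summable_geometric)
    fix n :: nat and y assume "y \<in> cball x 1"
    then have "norm y \<le> R"
      unfolding R_def by (metis add.commute dist_commute dist_norm mem_cball norm_triangle_sub add_left_mono order_trans)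
    then show "norm (norm (- (q ^ n * y))) \<le> norm q ^ n * R"
      by (simp add: norm_mult norm_power mult_left_mono)
  qed
  then have "uniformly_convergent_on (cball x 1) (\<lambda>N x. \<Prod>n<N. 1 + - (q ^ n * x))"
    by (intro uniformly_convergent_on_prod) (auto intro!: continuous_intros)
  then obtain l where l: "uniform_limit (cball x 1) (\<lambda>N x. \<Prod>n<N. 1 + - (q ^ n * x)) l sequentially"
    by (auto simp: uniformly_convergent_on_def)
  have "l y = qpoch y" if "y \<in> cball x 1" for y
  proof -
    have "(\<lambda>N. \<Prod>n<N. 1 - q ^ n * y) \<longlonglongrightarrow> l y"
      using tendsto_uniform_limitI[OF l that] by simp
    then have "(\<lambda>N. \<Prod>n\<le>N. 1 - q ^ n * y) \<longlonglongrightarrow> l y"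
      using LIMSEQ_Suc by (force simp: lessThan_Suc_atMost)
    then show ?thesis
      using convergent_prod_LIMSEQ[OF convergent_qpoch] LIMSEQ_unique unfolding qpoch_def by blast
  qed
  then have "uniform_limit (cball x 1) (\<lambda>N x. \<Prod>n<N. 1 + - (q ^ n * x)) qpoch sequentially"
    using l by (subst uniform_limit_cong') auto
  then show "\<exists>d>0. cball x d \<subseteq> UNIV \<and>
      uniform_limit (cball x d) (\<lambda>N x. \<Prod>n<N. 1 + - (q ^ n * x)) qpoch sequentially"
    by (intro exI[of _ 1]) auto
qed auto

text \<open>The Jacobi theta function as a product, up to a constant factor. The first factor
  vanishes at the powers of \<open>q\<close> with exponent at most 0, the second one at those with
  positive exponent.\<close>

definition theta :: "complex \<Rightarrow> complex" where
  "theta x = qpoch x * qpoch (q / x)"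

lemma theta_q: "x \<noteq> 0 \<Longrightarrow> theta (q * x) = - theta x / x"
proof -
  assume x: "x \<noteq> 0"
  have "theta (q * x) = qpoch (q * x) * qpoch (1 / x)" using q_nz by (simp add: theta_def)
  also have "qpoch (1 / x) = (1 - 1 / x) * qpoch (q / x)" using qpoch_rec[of "1 / x"] by simp
  also have "qpoch (q * x) * ((1 - 1 / x) * qpoch (q / x)) = - ((1 - x) * qpoch (q * x) * qpoch (q / x)) / x"
    using x by (simp add: field_simps)
  also have "(1 - x) * qpoch (q * x) = qpoch x" by (rule qpoch_rec[symmetric])
  finally show ?thesis by (simp add: theta_def)
qed

definition in_qZ :: "complex \<Rightarrow> bool" where
  "in_qZ x \<longleftrightarrow> (\<exists>n::int. x = q powi n)"

lemma in_qZ_mult: "in_qZ x \<Longrightarrow> in_qZ y \<Longrightarrow> in_qZ (x * y)"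
  unfolding in_qZ_def using q_nz by (metis power_int_add)

lemma in_qZ_inverse: "in_qZ x \<Longrightarrow> in_qZ (inverse x)"
  unfolding in_qZ_def by (metis power_int_minus)

lemma in_qZ_divide: "in_qZ x \<Longrightarrow> in_qZ y \<Longrightarrow> in_qZ (x / y)"
  using in_qZ_mult in_qZ_inverse by (simp add: divide_inverse)

lemma in_qZ_one [simp]: "in_qZ 1"
  unfolding in_qZ_def by (metis power_int_0_right)

lemma theta_zero_iff:
  assumes "x \<noteq> 0" shows "theta x = 0 \<longleftrightarrow> in_qZ x"
proof
  assume "theta x = 0"
  then consider "qpoch x = 0" | "qpoch (q / x) = 0" by (auto simp: theta_def)
  then show "in_qZ x"
  proof cases
    case 1
    then obtain n where "q ^ n * x = 1" using qpoch_nz by blast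
    then have "x = q powi (- int n)" using q_nz by (simp add: power_int_minus field_simps)
    then show ?thesis by (auto simp: in_qZ_def)
  next
    case 2
    then obtain n where "q ^ n * (q / x) = 1" using qpoch_nz by blast
    then have "x = q powi (int (Suc n))" unfolding power_int_of_nat using q_nz assms by (simp add: field_simps)
    then show ?thesis unfolding in_qZ_def by blast
  qed
next
  assume "in_qZ x"
  then obtain n where n: "x = q powi n" by (auto simp: in_qZ_def)
  show "theta x = 0"
  proof (cases "n \<le> 0")
    case True
    then have "n = - int (nat (- n))" by simp
    then have "x = inverse (q ^ nat (- n))" unfolding n by (metis power_int_minus power_int_of_nat)
    then have "q ^ nat (- n) * x = 1" using q_nz by simp
    then show ?thesis using qpoch_zero by (simp add: theta_def)
  next
    case False
    then have "n = int (Suc (nat n - 1))" by simp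
    then have "x = q ^ Suc (nat n - 1)" unfolding n by (metis power_int_of_nat)
    then have "q ^ (nat n - 1) * (q / x) = 1" using q_nz by simp
    from qpoch_zero[OF this] show ?thesis by (simp add: theta_def)
  qed
qed

lemma holomorphic_theta: "theta holomorphic_on - {0}"
  unfolding theta_def
  by (intro holomorphic_intros holomorphic_on_compose_gen[OF _ holomorphic_qpoch, unfolded o_def] 
      holomorphic_on_subset[OF holomorphic_qpoch]) auto

text \<open>Splitting off the first factor gives \<open>theta x = (1 - x) * g x\<close>, where
  \<open>g 1\<close> is the square of \<open>qpoch q\<close> and nonzero because no positive power
  of \<open>q\<close> is 1. The zero at 1 is thus simple.\<close>

lemma deriv_theta_1: "deriv theta 1 \<noteq> 0"
proof -
  define g where "g = (\<lambda>x. qpoch (q * x) * qpoch (q / x))"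
  have g1: "g 1 \<noteq> 0"
  proof -
    have "q ^ n * q \<noteq> 1" for n
    proof
      assume "q ^ n * q = 1"
      then have "norm (q ^ n * q) = 1" by simp
      then have "norm q ^ Suc n = 1" by (simp add: norm_mult norm_power mult.commute)
      moreover have "norm q ^ Suc n < 1" using q_lt1 by (intro power_Suc_less_one) (auto simp: q_nz)
      ultimately show False by simp
    qed
    then show ?thesis unfolding g_def using qpoch_nz by simp
  qed
  have "g holomorphic_on - {0}"
    unfolding g_def
    by (intro holomorphic_intros holomorphic_on_compose_gen[OF _ holomorphic_qpoch, unfolded o_def]) auto
  then have "g field_differentiable at 1"
    by (intro holomorphic_on_imp_differentiable_at[of _ "- {0}"]) auto
  then have "((\<lambda>x. (1 - x) * g x) has_field_derivative (1 - 1) * deriv g 1 + (0 - 1) * g 1) (at 1)"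
    by (intro DERIV_mult' DERIV_diff DERIV_const DERIV_ident) (simp add: DERIV_deriv_iff_field_differentiable)
  moreover have "(1 - x) * g x = theta x" for x
    unfolding g_def theta_def by (subst (3) qpoch_rec) (rule mult.assoc[symmetric])
  ultimately show ?thesis using g1 by (simp add: DERIV_imp_deriv ext)
qed

text \<open>Differentiate the functional equation at a zero: the term with the derivative of
  \<open>1 / x\<close> drops out because \<open>theta x = 0\<close>.\<close>

lemma deriv_theta_q:
  assumes "x \<noteq> 0" "theta x = 0"
  shows "deriv theta (q * x) = - deriv theta x / (q * x)"
proof -
  have d: "(theta has_field_derivative deriv theta y) (at y)" if "y \<noteq> 0" for y
    using holomorphic_derivI[OF holomorphic_theta, of y] that by auto
  have "((\<lambda>y. theta (q * y)) has_field_derivative deriv theta (q * x) * q) (at x)"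
    by (rule DERIV_chain'[where f = "\<lambda>y. q * y" and g = theta])
       (use assms q_nz in \<open>auto intro!: d derivative_eq_intros\<close>)
  moreover have "((\<lambda>y. - theta y / y) has_field_derivative - deriv theta x / x) (at x)"
    by (rule derivative_eq_intros d refl | use assms in \<open>simp add: field_simps\<close>)+
  moreover have ev: "\<forall>\<^sub>F y in nhds x. theta (q * y) = - theta y / y"
    by (rule eventually_mono[OF eventually_nhds_in_open[of "- {0}"]]) (use assms theta_q in auto)
  ultimately have "((\<lambda>y. - theta y / y) has_field_derivative deriv theta (q * x) * q) (at x)"
      "((\<lambda>y. - theta y / y) has_field_derivative - deriv theta x / x) (at x)"
    using DERIV_cong_ev[OF refl ev refl] by simp_all
  then have "deriv theta (q * x) * q = - deriv theta x / x" by (rule DERIV_unique)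
  then show ?thesis using q_nz assms by (simp add: field_simps)
qed

text \<open>Simplicity of the zero at 1 is carried along the powers of \<open>q\<close>, in both
  directions, by \<open>deriv_theta_q\<close>.\<close>

lemma deriv_theta_nz:
  assumes "in_qZ x" shows "deriv theta x \<noteq> 0"
proof -
  have z: "q powi n \<noteq> 0" "theta (q powi n) = 0" for n
    using q_nz theta_zero_iff[of "q powi n"] by (auto simp: in_qZ_def)
  have step: "deriv theta (q powi (n + 1)) \<noteq> 0 \<longleftrightarrow> deriv theta (q powi n) \<noteq> 0" for n
  proof -
    have "q powi (n + 1) = q * q powi n" using q_nz by (simp add: power_int_add)
    then show ?thesis using deriv_theta_q[OF z, of n] q_nz by simp
  qed
  have "deriv theta (q powi n) \<noteq> 0" for n
  proof (induction n rule: int_induct[of _ 0])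
    case base
    then show ?case using deriv_theta_1 by simp
  next
    case (step1 i)
    then show ?case using step by simp
  next
    case (step2 i)
    then show ?case using step[of "i - 1"] by simp
  qed
  then show ?thesis using assms by (auto simp: in_qZ_def)
qed

section \<open>Theta functions of degree d: sections of line bundles on the elliptic curve
  C^*/q^Z\<close>

definition theta_deg :: "nat \<Rightarrow> complex \<Rightarrow> (complex \<Rightarrow> complex) set" where
  "theta_deg d c =
     {m. m holomorphic_on (- {0}) \<and> m 0 = 0 \<and> (\<forall>z. z \<noteq> 0 \<longrightarrow> m (q * z) = c / z ^ d * m z)}"

lemma theta_space_eq: "theta_space q c = theta_deg 2 c"
  by (simp add: theta_space_def theta_deg_def)

lemma theta_deg_mult:
  assumes "f \<in> theta_deg d c" "g \<in> theta_deg e c'"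
  shows "(\<lambda>z. f z * g z) \<in> theta_deg (d + e) (c * c')"
  using assms by (auto simp: theta_deg_def power_add intro!: holomorphic_intros)

lemma theta_deg_lincomb:
  assumes "f \<in> theta_deg d c" "g \<in> theta_deg d c"
  shows "(\<lambda>z. a * f z + b * g z) \<in> theta_deg d c"
  using assms by (auto simp: theta_deg_def algebra_simps add_divide_distrib intro!: holomorphic_intros)

lemma theta_deg_diff:
  assumes "f \<in> theta_deg d c" "g \<in> theta_deg d c"
  shows "(\<lambda>z. f z - g z) \<in> theta_deg d c"
  using theta_deg_lincomb[OF assms, of 1 "-1"] by simp

text \<open>The function of degree 1 whose zeros in C^* form the orbit of \<open>a\<close> under
  powers of \<open>q\<close>; the value 0 at 0 is the convention of
  \<open>theta_deg\<close>.\<close>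

definition th :: "complex \<Rightarrow> complex \<Rightarrow> complex" where
  "th a z = (if z = 0 then 0 else theta (z / a))"

lemma th_theta_deg:
  assumes "a \<noteq> 0" shows "th a \<in> theta_deg 1 (- a)"
proof -
  have "(\<lambda>z. theta (z / a)) holomorphic_on - {0}"
    by (intro holomorphic_on_compose_gen[OF _ holomorphic_theta, unfolded o_def] holomorphic_intros)
       (use assms in auto)
  then have "th a holomorphic_on - {0}"
    by (rule holomorphic_transform) (auto simp: th_def)
  moreover have "th a (q * z) = - a / z ^ 1 * th a z" if "z \<noteq> 0" for z
    using theta_q[of "z / a"] that assms q_nz by (simp add: th_def)
  ultimately show ?thesis by (simp add: theta_deg_def th_def)
qed

lemma th_zero_iff: "a \<noteq> 0 \<Longrightarrow> z \<noteq> 0 \<Longrightarrow> th a z = 0 \<longleftrightarrow> in_qZ (z / a)"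
  by (simp add: th_def theta_zero_iff)

lemma deriv_th_nz:
  assumes "a \<noteq> 0" "z \<noteq> 0" "th a z = 0" shows "deriv (th a) z \<noteq> 0"
proof -
  have "((\<lambda>z. theta (z / a)) has_field_derivative deriv theta (z / a) * (1 / a)) (at z)"
  proof (rule DERIV_chain'[where f = "\<lambda>z. z / a" and g = theta])
    show "((\<lambda>z. z / a) has_field_derivative 1 / a) (at z)" by (rule DERIV_cdivide[OF DERIV_ident])
    show "(theta has_field_derivative deriv theta (z / a)) (at (z / a))"
      using holomorphic_derivI[OF holomorphic_theta, of "z / a"] assms by auto
  qed
  moreover have ev: "\<forall>\<^sub>F y in nhds z. theta (y / a) = th a y"
    by (rule eventually_mono[OF eventually_nhds_in_open[of "- {0}"]]) (use assms in \<open>auto simp: th_def\<close>)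
  ultimately have "(th a has_field_derivative deriv theta (z / a) * (1 / a)) (at z)"
    using DERIV_cong_ev[OF refl ev refl] by simp
  then show ?thesis using deriv_theta_nz th_zero_iff[OF assms(1,2)] assms by (simp add: DERIV_imp_deriv)
qed

text \<open>Zeros are isolated because they are simple: the difference quotient at a zero extends to
  a function with nonzero value there.\<close>

lemma th_ev_nonzero:
  assumes a: "a \<noteq> 0" and z: "z \<noteq> 0" shows "\<forall>\<^sub>F y in at z. y \<noteq> 0 \<and> th a y \<noteq> 0"
proof -
  have hol: "th a holomorphic_on - {0}" using th_theta_deg[OF a] by (simp add: theta_deg_def)
  show ?thesis
  proof (cases "th a z = 0")
    case False
    from holomorphic_ev_nonzero[OF hol _ _ this] z show ?thesis
      by (auto simp: open_Compl eventually_at_filter elim: eventually_mono)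
  next
    case True
    define T where "T = (\<lambda>y. if y = z then deriv (th a) z else (th a y - th a z) / (y - z))"
    have "T holomorphic_on - {0}"
      unfolding T_def using z by (auto intro!: pole_lemma hol simp: interior_open open_Compl)
    moreover have "T z \<noteq> 0" using deriv_th_nz[OF a z True] by (simp add: T_def)
    ultimately have "\<forall>\<^sub>F y in nhds z. y \<in> - {0} \<and> T y \<noteq> 0"
      using z by (intro holomorphic_ev_nonzero) (auto simp: open_Compl)
    then show ?thesis unfolding eventually_at_filter
      by (rule eventually_mono) (use True in \<open>auto simp: T_def\<close>)
  qed
qed

text \<open>The multiplier \<open>c / z ^ d\<close> has no zeros, so the zeros of \<open>f\<close>
  travel along orbits of \<open>q\<close> in both directions.\<close>

lemma theta_deg_zero_shift:
  assumes "f \<in> theta_deg d c" "f a = 0" "a \<noteq> 0" "in_qZ (b / a)" "c \<noteq> 0"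
  shows "f b = 0"
proof -
  obtain n where "b / a = q powi n" using assms by (auto simp: in_qZ_def)
  then have n: "b = q powi n * a" using \<open>a \<noteq> 0\<close> by (simp add: divide_eq_eq)
  have step: "f (q * z) = 0 \<longleftrightarrow> f z = 0" if "z \<noteq> 0" for z
    using assms that by (simp add: theta_deg_def)
  have "f (q powi n * a) = 0"
  proof (induction n rule: int_induct[of _ 0])
    case base
    then show ?case using assms by simp
  next
    case (step1 i)
    then show ?case using step[of "q powi i * a"] q_nz assms by (simp add: power_int_add mult_ac)
  next
    case (step2 i)
    have "q powi i * a = q * (q powi (i - 1) * a)" using q_nz by (simp add: power_int_diff)
    then show ?case using step2 step[of "q powi (i - 1) * a"] q_nz assms by (simp add: mult.assoc)
  qed
  then show ?thesis by (simp add: n)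
qed

text \<open>\<open>f\<close> vanishes on the whole orbit of \<open>a\<close>, where
  \<open>th a\<close> has only simple zeros, so the quotient is holomorphic on C^*. Division by a
  function with multiplier \<open>- a / z\<close> turns \<open>c / z ^ Suc d\<close> into
  \<open>- c / a / z ^ d\<close>.\<close>

lemma theta_deg_divide:
  assumes f: "f \<in> theta_deg (Suc d) c" and fa: "f a = 0" and a: "a \<noteq> 0" and c: "c \<noteq> 0"
  shows "\<exists>g\<in>theta_deg d (- c / a). \<forall>z. f z = th a z * g z"
proof -
  \<comment> \<open>At the zeros of \<open>th a\<close> the quotient is filled in with its limit,
    the ratio of the derivatives.\<close>
  define g where "g = (\<lambda>z. if th a z = 0 then deriv f z / deriv (th a) z else f z / th a z)"
  have holf: "f holomorphic_on - {0}" and holt: "th a holomorphic_on - {0}"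
    using f th_theta_deg[OF a] by (auto simp: theta_deg_def)
  have f_zero: "f z = 0" if "th a z = 0" for z
    using that theta_deg_zero_shift[OF f fa a _ c] f a th_zero_iff[OF a, of z]
    by (cases "z = 0") (auto simp: theta_deg_def)
  have fg: "f z = th a z * g z" for z
    using f_zero[of z] by (simp add: g_def)
  have "g field_differentiable at z" if z: "z \<noteq> 0" for z
  proof (cases "th a z = 0")
    case False
    from holomorphic_ev_nonzero[OF holt _ _ False]
    have "\<forall>\<^sub>F y in nhds z. y \<in> - {0} \<and> th a y \<noteq> 0" using z by auto
    then have ev: "\<forall>\<^sub>F y in nhds z. f y / th a y = g y"
      by (rule eventually_mono) (auto simp: g_def)
    have "(\<lambda>y. f y / th a y) field_differentiable at z"
      using False z by (intro field_differentiable_divide holomorphic_on_imp_differentiable_at[OF holf]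
          holomorphic_on_imp_differentiable_at[OF holt]) auto
    then show ?thesis using field_differentiable_cong_ev[OF ev] by simp
  next
    case True
    \<comment> \<open>Both functions vanish at \<open>z\<close>, so their quotient nearby is that of
      the difference quotients, whose denominator is nonzero at \<open>z\<close>.\<close>
    define F1 where "F1 = (\<lambda>y. if y = z then deriv f z else (f y - f z) / (y - z))"
    define T1 where "T1 = (\<lambda>y. if y = z then deriv (th a) z else (th a y - th a z) / (y - z))"
    have F1: "F1 holomorphic_on - {0}" and T1: "T1 holomorphic_on - {0}"
      unfolding F1_def T1_def using z by (auto intro!: pole_lemma holf holt simp: interior_open open_Compl)
    have T1z: "T1 z \<noteq> 0" using deriv_th_nz[OF a z True] by (simp add: T1_def)
    from holomorphic_ev_nonzero[OF T1 _ _ T1z]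
    have "\<forall>\<^sub>F y in nhds z. y \<in> - {0} \<and> T1 y \<noteq> 0" using z by auto
    then have ev: "\<forall>\<^sub>F y in nhds z. F1 y / T1 y = g y"
    proof (rule eventually_mono)
      fix y assume y: "y \<in> - {0} \<and> T1 y \<noteq> 0"
      show "F1 y / T1 y = g y"
        using y True f_zero[OF True] by (cases "y = z") (auto simp: g_def F1_def T1_def)
    qed
    have "(\<lambda>y. F1 y / T1 y) field_differentiable at z"
      using T1z z by (intro field_differentiable_divide holomorphic_on_imp_differentiable_at[OF F1]
          holomorphic_on_imp_differentiable_at[OF T1]) auto
    then show ?thesis using field_differentiable_cong_ev[OF ev] by simp
  qed
  then have holg: "g holomorphic_on - {0}"
    by (auto simp: holomorphic_on_def intro: field_differentiable_at_within)
  have fe: "g (q * z) = - c / a / z ^ d * g z" if z: "z \<noteq> 0" and nz: "th a z \<noteq> 0" for z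
  proof -
    have t: "th a (q * z) = - a / z * th a z" using th_theta_deg[OF a] z by (simp add: theta_deg_def)
    have "th a (q * z) * g (q * z) = c / z ^ Suc d * (th a z * g z)"
      using f z by (simp add: theta_deg_def flip: fg)
    then have "th a z * (- a / z * g (q * z)) = th a z * (c / z ^ Suc d * g z)"
      unfolding t by (simp add: mult_ac)
    then have "- a / z * g (q * z) = c / z ^ Suc d * g z" using nz by (simp only: mult_cancel_left) simp
    note eq = this
    have "g (q * z) = - z / a * (- a / z * g (q * z))" using z a by simp
    also have "\<dots> = - z / a * (c / z ^ Suc d * g z)" by (simp only: eq)
    also have "\<dots> = - c / a / z ^ d * g z" using z a by simp
    finally show ?thesis .
  qed
  \<comment> \<open>At a zero of \<open>th a\<close> the functional equation is obtained by
    continuity from a punctured neighbourhood.\<close>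
  have fe': "g (q * z) = - c / a / z ^ d * g z" if z: "z \<noteq> 0" for z
  proof (cases "th a z = 0")
    case True
    have "(\<lambda>y. g (q * y)) holomorphic_on - {0}"
      by (rule holomorphic_on_compose_gen[OF _ holg, unfolded o_def])
         (use q_nz in \<open>auto intro!: holomorphic_intros\<close>)
    then have "(\<lambda>y. g (q * y) - - c / a / y ^ d * g y) holomorphic_on - {0}"
      by (intro holomorphic_on_diff holomorphic_on_mult holomorphic_on_divide holomorphic_on_power holomorphic_on_const holomorphic_on_ident holg) auto
    from holomorphic_on_imp_continuous_on[OF this]
    have "isCont (\<lambda>y. g (q * y) - - c / a / y ^ d * g y) z"
      using z by (simp only: continuous_on_eq_continuous_at[OF open_Compl[OF closed_singleton]]) auto
    then have lim: "((\<lambda>y. g (q * y) - - c / a / y ^ d * g y) \<longlongrightarrow> g (q * z) - - c / a / z ^ d * g z) (at z)"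
      by (simp add: isCont_def)
    from th_ev_nonzero[OF a z] have "\<forall>\<^sub>F y in at z. g (q * y) - - c / a / y ^ d * g y = 0"
      by (rule eventually_mono) (use fe in \<open>auto simp: right_minus_eq\<close>)
    then have "((\<lambda>y. g (q * y) - - c / a / y ^ d * g y) \<longlongrightarrow> 0) (at z)"
      by (rule tendsto_eventually)
    then have "g (q * z) - - c / a / z ^ d * g z = 0" by (rule tendsto_unique[OF at_neq_bot lim])
    then show ?thesis by (simp only: right_minus_eq)
  qed (use fe z in blast)
  \<comment> \<open>Since \<open>th a 0 = 0\<close>, the value \<open>g 0\<close> is a meaningless
    ratio of derivatives; \<open>theta_deg\<close> asks for 0 there.\<close>
  define g0 where "g0 = (\<lambda>z. if z = 0 then 0 else g z)"
  have "g0 \<in> theta_deg d (- c / a)"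
    unfolding theta_deg_def using fe' q_nz holomorphic_transform[OF holg, of g0]
    by (auto simp: g0_def)
  moreover have "f z = th a z * g0 z" for z
    using fg[of z] by (simp add: g0_def th_def)
  ultimately show ?thesis by blast
qed


text \<open>A line bundle of degree 0 with nontrivial multiplier has no sections. After
  multiplication by a power of \<open>z\<close>, the values on one closed annulus bound the function
  near 0 and bound it polynomially at infinity. It is therefore a polynomial \<open>H\<close> with
  \<open>H (q * z) = c' * H z\<close>, and a nonzero coefficient would need
  \<open>c' = q ^ k\<close> for some \<open>k\<close>.\<close>

lemma theta_deg_0:
  assumes g: "g \<in> theta_deg 0 c" and c: "c \<noteq> 0" "\<not> in_qZ c"
  shows "g z = 0"
proof -
  have nq: "0 < norm q" using q_nz by simp
  \<comment> \<open>This exponent makes \<open>norm (c * q ^ k)\<close> at most 1, which keeps the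
    iterates towards 0 bounded.\<close>
  obtain k where k: "norm q ^ k < 1 / norm c"
    using real_arch_pow_inv[of "1 / norm c" "norm q"] q_lt1 c by auto
  define c' where "c' = c * q ^ k"
  have c'1: "norm c' \<le> 1" and c'0: "c' \<noteq> 0"
    using k c q_nz by (auto simp: c'_def norm_mult norm_power field_simps)
  have c'q: "c' \<noteq> q ^ j" for j
  proof
    assume "c' = q ^ j"
    then have "c = q powi int j / q powi int k" using q_nz by (simp add: c'_def field_simps)
    then show False using c(2) in_qZ_divide unfolding in_qZ_def by metis
  qed
  \<comment> \<open>One step outwards divides the values by \<open>c'\<close>; by the choice of
    \<open>N\<close> this grows more slowly than \<open>z ^ N\<close> does under \<open>z\<close> to
    \<open>z / q\<close>.\<close>
  obtain N where N: "norm q ^ N < norm c'"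
    using real_arch_pow_inv[of "norm c'" "norm q"] q_lt1 c'0 by auto
  define G where "G = (\<lambda>z. g z * z ^ k)"
  have holg: "g holomorphic_on - {0}" and gq: "\<And>z. z \<noteq> 0 \<Longrightarrow> g (q * z) = c * g z" and g0: "g 0 = 0"
    using g by (auto simp: theta_deg_def)
  have holG: "G holomorphic_on - {0}" unfolding G_def by (intro holomorphic_intros holg)
  have Gq: "G (q * z) = c' * G z" if "z \<noteq> 0" for z
    using gq[OF that] by (simp add: G_def c'_def power_mult_distrib)
  have Gqn: "G (q ^ n * z) = c' ^ n * G z" if "z \<noteq> 0" for n z
  proof (induction n)
    case (Suc n)
    then show ?case using Gq[of "q ^ n * z"] q_nz that by (simp add: mult_ac)
  qed simp
  define K where "K = cball 0 1 - ball (0::complex) (norm q)"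
  have "compact K" unfolding K_def by (intro compact_diff) auto
  moreover have "continuous_on K G"
    using holomorphic_on_imp_continuous_on[OF holG]
    by (rule continuous_on_subset) (use nq in \<open>auto simp: K_def\<close>)
  ultimately have "bounded (G ` K)" using compact_continuous_image compact_imp_bounded by blast
  then obtain M where M: "\<And>w. w \<in> K \<Longrightarrow> norm (G w) \<le> M" "M > 0"
    unfolding bounded_pos by auto
  have small: "norm (G z) \<le> M" if z: "z \<noteq> 0" "norm z \<le> 1" for z
  proof -
    obtain n0 where "norm q ^ n0 < norm z"
      using real_arch_pow_inv[of "norm z" "norm q"] q_lt1 z by auto
    then have ex: "\<exists>n. norm q ^ n * norm q \<le> norm z"
      using q_lt1 by (intro exI[of _ n0]) (smt (verit) mult_left_le norm_ge_zero zero_le_power)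
    define n where "n = (LEAST n. norm q ^ n * norm q \<le> norm z)"
    have n1: "norm q ^ n * norm q \<le> norm z" unfolding n_def using ex by (rule LeastI_ex)
    have n2: "norm z \<le> norm q ^ n"
    proof (cases n)
      case 0
      then show ?thesis using z by simp
    next
      case (Suc m)
      then have "\<not> norm q ^ m * norm q \<le> norm z" using not_less_Least[of m "\<lambda>n. norm q ^ n * norm q \<le> norm z"] by (simp add: n_def)
      then show ?thesis using Suc by (simp add: mult.commute)
    qed
    define w where "w = z / q ^ n"
    have "norm q ^ n > 0" using nq by simp
    then have "w \<in> K" using n1 n2 by (simp add: w_def K_def norm_divide norm_power field_simps)
    have "z = q ^ n * w" "w \<noteq> 0" using q_nz z by (auto simp: w_def)
    then have "norm (G z) = norm c' ^ n * norm (G w)" using Gqn by (simp add: norm_mult norm_power)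
    also have "\<dots> \<le> 1 * M" using c'1 M(1)[OF \<open>w \<in> K\<close>] by (intro mult_mono power_le_one) auto
    finally show ?thesis by simp
  qed
  have large: "norm (G z) \<le> M / norm q ^ N * norm z ^ N" if z: "norm z \<ge> 1" for z
  proof -
    have z0: "z \<noteq> 0" using z by auto
    have ex: "\<exists>n. norm q ^ n * norm z \<le> 1"
    proof -
      obtain n where "norm q ^ n < 1 / norm z"
        using real_arch_pow_inv[of "1 / norm z" "norm q"] q_lt1 z0 by auto
      then show ?thesis using z0 by (intro exI[of _ n]) (simp add: field_simps)
    qed
    define n where "n = (LEAST n. norm q ^ n * norm z \<le> 1)"
    have n1: "norm q ^ n * norm z \<le> 1" unfolding n_def using ex by (rule LeastI_ex)
    have n2: "norm q \<le> norm q ^ n * norm z"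
    proof (cases n)
      case 0
      then show ?thesis using z q_lt1 by simp
    next
      case (Suc m)
      then have "\<not> norm q ^ m * norm z \<le> 1"
        using not_less_Least[of m "\<lambda>n. norm q ^ n * norm z \<le> 1"] by (simp add: n_def)
      then have "norm q * 1 \<le> norm q * (norm q ^ m * norm z)" by (intro mult_left_mono) auto
      then show ?thesis using Suc by (simp add: mult.assoc)
    qed
    define w where "w = q ^ n * z"
    have "w \<in> K" using n1 n2 by (simp add: w_def K_def norm_mult norm_power)
    have "G w = c' ^ n * G z" unfolding w_def by (rule Gqn[OF z0])
    then have "norm c' ^ n * norm (G z) \<le> M" using M(1)[OF \<open>w \<in> K\<close>] by (simp add: norm_mult norm_power)
    moreover have "(norm q ^ n) ^ N \<le> norm c' ^ n"
      using power_mono[OF less_imp_le[OF N], of n] by (simp add: mult.commute flip: power_mult)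
    ultimately have "(norm q ^ n) ^ N * norm (G z) \<le> M"
      by (meson mult_right_mono norm_ge_zero order_trans)
    then have "(norm q ^ n) ^ N * norm (G z) * norm z ^ N \<le> M * norm z ^ N"
      by (rule mult_right_mono) simp
    then have "(norm q ^ n * norm z) ^ N * norm (G z) \<le> M * norm z ^ N"
      by (simp add: power_mult_distrib mult_ac)
    moreover have "norm q ^ N * norm (G z) \<le> (norm q ^ n * norm z) ^ N * norm (G z)"
      using n2 by (intro mult_right_mono power_mono) auto
    ultimately have "norm q ^ N * norm (G z) \<le> M * norm z ^ N" by linarith
    then show ?thesis using nq by (simp add: field_simps)
  qed
  have "\<exists>B. \<forall>\<^sub>F z in at 0. norm (G z) \<le> B"
    unfolding eventually_at using small by (intro exI[of _ M] exI[of _ 1]) auto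
  then obtain H where H: "H holomorphic_on UNIV" "\<And>z. z \<noteq> 0 \<Longrightarrow> H z = G z"
    using holomorphic_on_extend_bounded[of G UNIV 0] holG by (auto simp: Compl_eq_Diff_UNIV)
  define a where "a = (\<lambda>k. (deriv ^^ k) H 0 / fact k)"
  have pol: "H z = (\<Sum>k\<le>N. a k * z ^ k)" for z
    unfolding a_def
  proof (rule Liouville_polynomial[OF H(1)])
    fix z :: complex assume z: "1 \<le> norm z"
    then have "z \<noteq> 0" by auto
    then show "norm (H z) \<le> M / norm q ^ N * norm z ^ N" using large[OF z] H(2) by simp
  qed
  have "(\<Sum>k\<le>N. a k * (q ^ k - c') * z ^ k) = 0" for z
  proof -
    have *: "H (q * z) = c' * H z" if "z \<noteq> 0" for z using H(2) Gq that q_nz by simp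
    have ev: "\<forall>\<^sub>F z in at 0. H (q * z) - c' * H z = 0"
      unfolding eventually_at by (intro exI[of _ 1]) (auto simp: *)
    have cH: "isCont H w" for w
      using H(1) by (metis UNIV_I continuous_on_eq_continuous_at holomorphic_on_imp_continuous_on open_UNIV)
    have "((\<lambda>z. H (q * z) - c' * H z) \<longlongrightarrow> H (q * 0) - c' * H 0) (at 0)"
      by (intro tendsto_intros isCont_tendsto_compose[OF cH])

    moreover have "((\<lambda>z. H (q * z) - c' * H z) \<longlongrightarrow> 0) (at 0)"
      using ev by (rule tendsto_eventually)
    ultimately have "H (q * 0) - c' * H 0 = 0" by (rule tendsto_unique[rotated]) simp
    then have "H (q * z) = c' * H z" using * by (cases "z = 0") auto
    then show ?thesis unfolding pol
      by (simp add: sum_distrib_left algebra_simps power_mult_distrib sum_subtractf)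
  qed
  then have "\<forall>k\<le>N. a k * (q ^ k - c') = 0" using polyfun_eq_0[of "\<lambda>k. a k * (q ^ k - c')" N] by blast
  then have "\<forall>k\<le>N. a k = 0" using c'q by (metis mult_eq_0_iff right_minus_eq)
  then have "H z = 0" for z unfolding pol by simp
  then show ?thesis using H(2)[of z] g0 by (cases "z = 0") (auto simp: G_def)
qed

text \<open>A real number strictly between \<open>norm q\<close> and 1 is not the absolute value of
  any power of \<open>q\<close>.\<close>

lemma not_in_qZ_ex: "\<exists>x. x \<noteq> 0 \<and> \<not> in_qZ x"
proof -
  define r where "r = (1 + norm q) / 2"
  have r: "norm q < r" "r < 1" "0 < r" using q_lt1 q_nz by (auto simp: r_def field_simps add_pos_pos)
  have "of_real r \<noteq> q powi n" for n
  proof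
    assume "of_real r = q powi n"
    then have e: "r = norm q powi n" using r by (metis abs_of_pos norm_of_real norm_power_int)
    show False
    proof (cases "n \<le> 0")
      case True
      then have "n = - int (nat (- n))" by simp
      then have "r = inverse (norm q ^ nat (- n))" using e by (metis power_int_minus power_int_of_nat)
      moreover have "norm q ^ nat (- n) \<le> 1" "norm q ^ nat (- n) > 0" using q_lt1 q_nz by (auto intro: power_le_one)
      ultimately show False using r by (simp add: field_simps)
    next
      case False
      then have "n = int (Suc (nat n - 1))" by simp
      then have "r = norm q ^ Suc (nat n - 1)" using e by (metis power_int_of_nat)
      also have "\<dots> \<le> norm q ^ 1" using q_lt1 by (intro power_decreasing) auto
      finally show False using r by simp
    qed
  qed
  then show ?thesis using r by (intro exI[of _ "of_real r"]) (auto simp: in_qZ_def)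
qed

text \<open>Subtract the multiple of \<open>th a\<close> that agrees with \<open>g\<close> at an
  auxiliary point \<open>b\<close>. Division by \<open>th b\<close> leaves degree 0 with multiplier
  \<open>a / b\<close>, which by the choice of \<open>b\<close> is not a power of
  \<open>q\<close>.\<close>

lemma theta_deg_1:
  assumes g: "g \<in> theta_deg 1 (- a)" and a: "a \<noteq> 0"
  shows "\<exists>k. \<forall>z. g z = k * th a z"
proof -
  obtain e where e: "e \<noteq> 0" "\<not> in_qZ e" using not_in_qZ_ex by blast
  define b where "b = e * a"
  have b: "b \<noteq> 0" "th a b \<noteq> 0" using e a th_zero_iff[of a b] by (auto simp: b_def)
  define k where "k = g b / th a b"
  have "(\<lambda>z. 1 * g z + (- k) * th a z) \<in> theta_deg (Suc 0) (- a)"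
    using theta_deg_lincomb[OF g th_theta_deg[OF a], of 1 "- k"] unfolding One_nat_def .
  from theta_deg_divide[OF this, of b] obtain h where
    h: "h \<in> theta_deg 0 (a / b)" "\<And>z. g z - k * th a z = th b z * h z"
    using b a by (auto simp: k_def)
  have "a / b = inverse e" using a by (simp add: b_def field_simps)
  then have "\<not> in_qZ (a / b)" using e in_qZ_inverse by fastforce
  then have "h z = 0" for z using theta_deg_0[OF h(1)] a b by simp
  then show ?thesis using h(2) by (intro exI[of _ k]) simp
qed

text \<open>Division by \<open>th a\<close> and \<open>th b\<close> leaves degree 0 with multiplier
  \<open>c / (a * b)\<close>. In other words, the two zeros of a nonzero function of degree 2 have
  product \<open>c\<close> up to powers of \<open>q\<close>.\<close>

lemma theta_deg_2_zeros:
  assumes f: "f \<in> theta_deg 2 c" and "c \<noteq> 0" "a \<noteq> 0" "b \<noteq> 0" "f a = 0" "f b = 0"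
    and "\<not> in_qZ (b / a)" "\<not> in_qZ (c / (a * b))"
  shows "f z = 0"
proof -
  have "f \<in> theta_deg (Suc 1) c" using f by (simp add: numeral_2_eq_2)
  from theta_deg_divide[OF this, of a] obtain g where
    g: "g \<in> theta_deg 1 (- c / a)" "\<And>z. f z = th a z * g z" using assms by auto
  have "g b = 0" using g(2)[of b] th_zero_iff[of a b] assms by simp
  from theta_deg_divide[OF g(1)[unfolded One_nat_def] this] obtain h where
    h: "h \<in> theta_deg 0 (- (- c / a) / b)" "\<And>z. g z = th b z * h z" using assms by auto
  have "h z = 0" using theta_deg_0[OF h(1)] assms by simp
  then show ?thesis using g(2) h(2) by simp
qed

text \<open>This is how (FR) acts: with multiplier \<open>a * b * c * d\<close>, division by three
  theta factors leaves degree 1 with multiplier \<open>- d\<close>, hence a multiple of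
  \<open>th d\<close>.\<close>

lemma theta_deg_4_zeros:
  assumes f: "f \<in> theta_deg 4 (a * b * c * d)" and nz: "a \<noteq> 0" "b \<noteq> 0" "c \<noteq> 0" "d \<noteq> 0"
    and z: "f a = 0" "f b = 0" "f c = 0"
    and ne: "\<not> in_qZ (b / a)" "\<not> in_qZ (c / a)" "\<not> in_qZ (c / b)"
  shows "\<exists>k. \<forall>z. f z = k * (th a z * th b z * th c z * th d z)"
proof -
  have "f \<in> theta_deg (Suc 3) (a * b * c * d)" using f by simp
  from theta_deg_divide[OF this z(1)] obtain g where
    g': "g \<in> theta_deg 3 (- (a * b * c * d) / a)" and g2: "\<forall>z. f z = th a z * g z" using nz by auto
  have "- (a * b * c * d) / a = - (b * c * d)" using nz by simp
  with g' have g: "g \<in> theta_deg 3 (- (b * c * d))" by simp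
  have g0: "g b = 0" "g c = 0" using spec[OF g2, of b] spec[OF g2, of c] z th_zero_iff[of a b] th_zero_iff[of a c] ne nz by auto
  have "g \<in> theta_deg (Suc 2) (- (b * c * d))" using g by (simp add: numeral_3_eq_3 numeral_2_eq_2)
  from theta_deg_divide[OF this g0(1)] obtain h where
    h': "h \<in> theta_deg 2 (- (- (b * c * d)) / b)" and h2: "\<forall>z. g z = th b z * h z" using nz by auto
  have "- (- (b * c * d)) / b = c * d" using nz by simp
  with h' have h: "h \<in> theta_deg 2 (c * d)" by simp
  have h0: "h c = 0" using spec[OF h2, of c] g0 th_zero_iff[of b c] ne nz by auto
  have "h \<in> theta_deg (Suc 1) (c * d)" using h by (simp add: numeral_2_eq_2)
  from theta_deg_divide[OF this h0] obtain k where
    k': "k \<in> theta_deg 1 (- (c * d) / c)" and k2: "\<forall>z. h z = th c z * k z" using nz by auto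
  have "- (c * d) / c = - d" using nz by simp
  with k' have "k \<in> theta_deg 1 (- d)" by simp
  from theta_deg_1[OF this] nz obtain l where "\<forall>z. k z = l * th d z" by auto
  then show ?thesis using g2 h2 k2 by (intro exI[of _ l]) (simp add: mult_ac)
qed

lemma theta_deg_th_mult:
  assumes "u \<noteq> 0" "v \<noteq> 0"
  shows "(\<lambda>z. k * (th u z * th v z)) \<in> theta_deg 2 (u * v)"
proof -
  have "(\<lambda>z. th u z * th v z) \<in> theta_deg (1 + 1) (- u * - v)"
    by (rule theta_deg_mult[OF th_theta_deg[OF assms(1)] th_theta_deg[OF assms(2)]])
  then have "(\<lambda>z. th u z * th v z) \<in> theta_deg 2 (u * v)" by (simp add: numeral_2_eq_2)
  from theta_deg_lincomb[OF this this, of k 0] show ?thesis by simp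
qed

text \<open>A function of degree 2 that vanishes at \<open>u\<close> has its second zero at
  \<open>c / u\<close>; the leading factor normalizes the value at \<open>v\<close> to 1.\<close>

definition bas :: "complex \<Rightarrow> complex \<Rightarrow> complex \<Rightarrow> complex \<Rightarrow> complex" where
  "bas c u v z = 1 / (th u v * th (c / u) v) * (th u z * th (c / u) z)"

lemma bas_in: "c \<noteq> 0 \<Longrightarrow> u \<noteq> 0 \<Longrightarrow> bas c u v \<in> theta_deg 2 c"
  unfolding bas_def[abs_def] using theta_deg_th_mult[of u "c / u" "1 / (th u v * th (c / u) v)"] by simp

lemma bas_root: "u \<noteq> 0 \<Longrightarrow> bas c u v u = 0"
  by (simp add: bas_def th_zero_iff)

lemma bas_at:
  assumes "c \<noteq> 0" "u \<noteq> 0" "v \<noteq> 0" "\<not> in_qZ (v / u)" "\<not> in_qZ (u * v / c)"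
  shows "bas c u v v = 1"
  using assms th_zero_iff[of u v] th_zero_iff[of "c / u" v] by (simp add: bas_def mult.commute)

lemma bas_nz_iff:
  assumes "c \<noteq> 0" "u \<noteq> 0" "v \<noteq> 0" "\<not> in_qZ (v / u)" "\<not> in_qZ (u * v / c)" "z \<noteq> 0"
  shows "bas c u v z = 0 \<longleftrightarrow> in_qZ (z / u) \<or> in_qZ (u * z / c)"
  using assms th_zero_iff[of u v] th_zero_iff[of "c / u" v] th_zero_iff[of u z] th_zero_iff[of "c / u" z]
  by (simp add: bas_def mult.commute)

text \<open>Two products of functions with a common zero \<open>y\<close> cannot agree at two further points:
  after division by \<open>th y\<^sup>2\<close> their difference has degree 2 and too many zeros, so the
  products would be equal, and unique factorization forces \<open>c11 \<equiv> c12\<close> or \<open>c11 \<equiv> c21\<close>.\<close>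

lemma common_zero_impossible:
  assumes m: "m11 \<in> theta_deg 2 c11" "m12 \<in> theta_deg 2 c12" "m21 \<in> theta_deg 2 c21" "m22 \<in> theta_deg 2 c22"
    and c: "c11 \<noteq> 0" "c12 \<noteq> 0" "c21 \<noteq> 0" "c22 \<noteq> 0"
    and C: "c11 * c22 = y * u * v * w" "c12 * c21 = y * u * v * w"
    and nz: "y \<noteq> 0" "u \<noteq> 0" "v \<noteq> 0" "w \<noteq> 0"
    and ne: "\<not> in_qZ (u / y)" "\<not> in_qZ (v / y)" "\<not> in_qZ (w / y)" "\<not> in_qZ (v / u)"
    and cne: "\<not> in_qZ (c11 / c12)" "\<not> in_qZ (c11 / c21)"
    and y: "m11 y = 0" "m12 y = 0" "m21 y = 0" "m22 y = 0"
    and m0: "\<exists>z. m12 z \<noteq> 0" "\<exists>z. m21 z \<noteq> 0"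
    and d: "m11 u * m22 u = m12 u * m21 u" "m11 v * m22 v = m12 v * m21 v"
  shows False
proof -
  have div: "\<exists>n\<in>theta_deg 1 (- (c / y)). \<forall>z. m z = th y z * n z"
    if "m \<in> theta_deg 2 c" "c \<noteq> 0" "m y = 0" for m c
    using theta_deg_divide[of m 1 c y] that nz by (simp add: numeral_2_eq_2)
  obtain n11 where n11: "n11 \<in> theta_deg 1 (- (c11 / y))" "\<forall>z. m11 z = th y z * n11 z" using div m c y by meson
  obtain n12 where n12: "n12 \<in> theta_deg 1 (- (c12 / y))" "\<forall>z. m12 z = th y z * n12 z" using div m c y by meson
  obtain n21 where n21: "n21 \<in> theta_deg 1 (- (c21 / y))" "\<forall>z. m21 z = th y z * n21 z" using div m c y by meson
  obtain n22 where n22: "n22 \<in> theta_deg 1 (- (c22 / y))" "\<forall>z. m22 z = th y z * n22 z" using div m c y by meson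
  define N where "N = (\<lambda>z. n11 z * n22 z - n12 z * n21 z)"
  define C where "C = u * v * w / y"
  have "- (c11 / y) * - (c22 / y) = c11 * c22 / (y * y)" "- (c12 / y) * - (c21 / y) = c12 * c21 / (y * y)" by simp_all
  then have CC: "- (c11 / y) * - (c22 / y) = C" "- (c12 / y) * - (c21 / y) = C"
    unfolding assms(9,10) C_def using nz by simp_all
  have "N \<in> theta_deg (1 + 1) C"
    unfolding N_def
    by (rule theta_deg_diff) (use theta_deg_mult[OF n11(1) n22(1)] theta_deg_mult[OF n12(1) n21(1)] in \<open>simp_all only: CC\<close>)
  then have N: "N \<in> theta_deg 2 C" by (simp add: numeral_2_eq_2)
  have Nz: "N z = 0" if "m11 z * m22 z = m12 z * m21 z" "z \<noteq> 0" "\<not> in_qZ (z / y)" for z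
  proof -
    have "th y z \<noteq> 0" using th_zero_iff that nz by simp
    moreover have "th y z * th y z * (n11 z * n22 z) = th y z * th y z * (n12 z * n21 z)"
      using that(1) n11(2) n12(2) n21(2) n22(2) by (simp add: mult_ac)
    ultimately show ?thesis by (simp add: N_def)
  qed
  \<comment> \<open>The zeros \<open>u\<close> and \<open>v\<close> do not have the product
    prescribed by the multiplier \<open>C\<close>, since \<open>w\<close> and \<open>y\<close> are
    inequivalent.\<close>
  have "C / (u * v) = w / y" using nz by (simp add: C_def)
  then have N0: "N z = 0" for z
    using theta_deg_2_zeros[OF N _ nz(2,3) Nz[OF d(1)] Nz[OF d(2)]] ne nz by (simp add: C_def)
  obtain k11 where k11: "\<forall>z. n11 z = k11 * th (c11 / y) z" using theta_deg_1[OF n11(1)] c nz by auto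
  obtain k12 where k12: "\<forall>z. n12 z = k12 * th (c12 / y) z" using theta_deg_1[OF n12(1)] c nz by auto
  obtain k21 where k21: "\<forall>z. n21 z = k21 * th (c21 / y) z" using theta_deg_1[OF n21(1)] c nz by auto
  have k0: "k12 \<noteq> 0" "k21 \<noteq> 0" using m0 n12(2) n21(2) k12 k21 by auto
  have "n11 (c11 / y) = 0" using k11 th_zero_iff[of "c11 / y" "c11 / y"] c nz by simp
  then have "n12 (c11 / y) * n21 (c11 / y) = 0" using N0[of "c11 / y"] by (simp add: N_def)
  then have "th (c12 / y) (c11 / y) = 0 \<or> th (c21 / y) (c11 / y) = 0" using k12 k21 k0 by simp
  then show False using cne th_zero_iff[of "c12 / y" "c11 / y"] th_zero_iff[of "c21 / y" "c11 / y"] c nz by simp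
qed

text \<open>The zeros of \<open>th a\<close> are isolated, so \<open>h\<close> vanishes at points
  arbitrarily close to \<open>y\<close>, and at \<open>y\<close> by continuity.\<close>

lemma th_cancel:
  assumes h: "h holomorphic_on - {0}" and a: "a \<noteq> 0" and y: "y \<noteq> 0"
    and 0: "\<And>z. z \<noteq> 0 \<Longrightarrow> th a z * h z = 0"
  shows "h y = 0"
proof (rule ccontr)
  assume "h y \<noteq> 0"
  with holomorphic_ev_nonzero[OF h] y have "\<forall>\<^sub>F z in nhds y. z \<in> - {0} \<and> h z \<noteq> 0"
    by (auto simp: open_Compl)
  then have "\<forall>\<^sub>F z in at y. th a z = 0"
    unfolding eventually_at_filter by (rule eventually_mono) (use 0 in auto)
  with th_ev_nonzero[OF a y] have "\<forall>\<^sub>F z in at y. False" by eventually_elim auto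
  then show False by simp
qed

end

section \<open>Bases of the theta spaces and a point of F\<close>

lemma det_mat_at: "det (mat_at M z) = (M $ 1 $ 1) z * (M $ 2 $ 2) z - (M $ 1 $ 2) z * (M $ 2 $ 1) z"
  by (simp add: mat_at_def det_2)

text \<open>Each space \<open>V\<^sub>i\<^sub>j\<close> has a basis \<open>f\<^sub>i\<^sub>j, g\<^sub>i\<^sub>j\<close> of functions vanishing at \<open>x\<^sub>2\<close> and \<open>x\<^sub>1\<close>
  and normalized at \<open>x\<^sub>3\<close>. The inequalities \<open>ne1\<close>, \<open>ne2\<close>, \<open>ne12\<close> are what remains of (NR) and (NS); the
  point \<open>x0\<close> is any point at which no determinant of an element of \<open>F\<close> vanishes.\<close>

locale theta_bases =
  fixes q :: complex and \<rho> \<sigma> :: "complex^2" and x :: "complex^4"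
    and f g :: "2 \<Rightarrow> 2 \<Rightarrow> complex \<Rightarrow> complex" and x0 :: complex
  assumes f_in: "f i j \<in> theta_space q (\<rho> $ i / \<sigma> $ j)"
    and g_in: "g i j \<in> theta_space q (\<rho> $ i / \<sigma> $ j)"
    and span: "m \<in> theta_space q (\<rho> $ i / \<sigma> $ j) \<Longrightarrow> \<exists>a b. m = (\<lambda>z. a * f i j z + b * g i j z)"
    and f1: "f i j (x $ 1) \<noteq> 0" and f2: "f i j (x $ 2) = 0" and f3: "f i j (x $ 3) = 1"
    and g1: "g i j (x $ 1) = 0" and g2: "g i j (x $ 2) \<noteq> 0" and g3: "g i j (x $ 3) = 1"
    and ne1: "f 1 1 (x $ 1) * f 2 2 (x $ 1) \<noteq> f 1 2 (x $ 1) * f 2 1 (x $ 1)"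
    and ne2: "g 1 1 (x $ 2) * g 2 2 (x $ 2) \<noteq> g 1 2 (x $ 2) * g 2 1 (x $ 2)"
    and ne12: "f 1 1 (x $ 1) * f 2 2 (x $ 1) * (g 1 2 (x $ 2) * g 2 1 (x $ 2)) \<noteq>
               f 1 2 (x $ 1) * f 2 1 (x $ 1) * (g 1 1 (x $ 2) * g 2 2 (x $ 2))"
    and F_eq: "F q \<rho> \<sigma> x = {M \<in> V q \<rho> \<sigma>. det (mat_at M (x $ 1)) = 0 \<and> det (mat_at M (x $ 2)) = 0 \<and>
                det (mat_at M (x $ 3)) = 0 \<and> det (mat_at M x0) \<noteq> 0}"
    and F_nonempty: "F q \<rho> \<sigma> x \<noteq> {}"

text \<open>This closes the analysis of theta functions: the conditions on the parameters are turned
  into the algebraic data of \<open>theta_bases\<close>, from which the rest proceeds.\<close>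

lemma (in nome) theta_bases_exist:
  fixes \<rho> \<sigma> :: "complex^2" and x :: "complex^4"
  assumes \<rho>: "\<forall>i. \<rho> $ i \<noteq> 0" and \<sigma>: "\<forall>j. \<sigma> $ j \<noteq> 0" and x: "\<forall>k. x $ k \<noteq> 0"
    and FR: "FR \<rho> \<sigma> x" and NR: "NR q \<rho> \<sigma> x" and NS: "NS q \<rho> \<sigma> x"
  shows "\<exists>f g x0. theta_bases q \<rho> \<sigma> x f g x0"
proof -
  define c where "c = (\<lambda>i j. \<rho> $ i / \<sigma> $ j)"
  have c0: "c i j \<noteq> 0" for i j using \<rho> \<sigma> by (simp add: c_def)
  have qe: "qequiv q a b \<longleftrightarrow> in_qZ (a / b)" for a b by (simp add: qequiv_def in_qZ_def)
  have inv: "in_qZ (a / b) \<longleftrightarrow> in_qZ (b / a)" for a b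
    using in_qZ_inverse[of "a / b"] in_qZ_inverse[of "b / a"] by (auto simp: inverse_eq_divide)
  have xne: "\<not> in_qZ (x $ k / x $ l)" if "k \<noteq> l" for k l using NR that by (auto simp: NR_def qe)
  have ns: "\<not> in_qZ (c i j / (x $ k * x $ l))" if "k \<noteq> l" for i j k l
    using NS that unfolding NS_def qe c_def by blast
  have ns': "\<not> in_qZ (x $ k * x $ l / c i j)" if "k \<noteq> l" for i j k l
    using ns[OF that] inv by blast
  have cne: "\<not> in_qZ (c 1 1 / c 1 2)" "\<not> in_qZ (c 1 1 / c 2 1)"
    using NR inv[of "\<sigma> $ 1"] \<rho> \<sigma> by (simp_all add: NR_def qe c_def)
  have C: "c 1 1 * c 2 2 = x $ 1 * x $ 2 * x $ 3 * x $ 4" "c 1 2 * c 2 1 = x $ 1 * x $ 2 * x $ 3 * x $ 4"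
    using FR by (simp_all add: FR_def c_def mult.commute)
  have xq: "\<not> in_qZ (x $ 1 / x $ 2)" "\<not> in_qZ (x $ 1 / x $ 3)" "\<not> in_qZ (x $ 1 / x $ 4)" "\<not> in_qZ (x $ 2 / x $ 1)" "\<not> in_qZ (x $ 2 / x $ 3)" "\<not> in_qZ (x $ 2 / x $ 4)" "\<not> in_qZ (x $ 3 / x $ 1)" "\<not> in_qZ (x $ 3 / x $ 2)" "\<not> in_qZ (x $ 3 / x $ 4)" "\<not> in_qZ (x $ 4 / x $ 1)" "\<not> in_qZ (x $ 4 / x $ 2)" "\<not> in_qZ (x $ 4 / x $ 3)"
    by (rule xne, simp)+
  have nsq: "\<not> in_qZ (x $ 1 * x $ 2 / c i j)" "\<not> in_qZ (x $ 1 * x $ 3 / c i j)" "\<not> in_qZ (x $ 1 * x $ 4 / c i j)" "\<not> in_qZ (x $ 2 * x $ 1 / c i j)" "\<not> in_qZ (x $ 2 * x $ 3 / c i j)" "\<not> in_qZ (x $ 2 * x $ 4 / c i j)" "\<not> in_qZ (x $ 3 * x $ 1 / c i j)" "\<not> in_qZ (x $ 3 * x $ 2 / c i j)" "\<not> in_qZ (x $ 3 * x $ 4 / c i j)" "\<not> in_qZ (x $ 4 * x $ 1 / c i j)" "\<not> in_qZ (x $ 4 * x $ 2 / c i j)" "\<not> in_qZ (x $ 4 * x $ 3 / c i j)" for i j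
    by (rule ns', simp)+
  define f where "f = (\<lambda>i j. bas (c i j) (x $ 2) (x $ 3))"
  define g where "g = (\<lambda>i j. bas (c i j) (x $ 1) (x $ 3))"
  have fd: "f i j \<in> theta_deg 2 (c i j)" and gd: "g i j \<in> theta_deg 2 (c i j)" for i j
    unfolding f_def g_def using bas_in c0 x by auto
  have f2: "f i j (x $ 2) = 0" and g1: "g i j (x $ 1) = 0" for i j
    unfolding f_def g_def using bas_root x by auto
  have f3: "f i j (x $ 3) = 1" and g3: "g i j (x $ 3) = 1" for i j
    unfolding f_def g_def using bas_at c0 x xq nsq by auto
  have fz: "f i j z = 0 \<longleftrightarrow> in_qZ (z / x $ 2) \<or> in_qZ (x $ 2 * z / c i j)" if "z \<noteq> 0" for i j z
    unfolding f_def using c0 x xq nsq that by (intro bas_nz_iff) auto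
  have gz: "g i j z = 0 \<longleftrightarrow> in_qZ (z / x $ 1) \<or> in_qZ (x $ 1 * z / c i j)" if "z \<noteq> 0" for i j z
    unfolding g_def using c0 x xq nsq that by (intro bas_nz_iff) auto
  have f1: "f i j (x $ 1) \<noteq> 0" for i j using fz[of "x $ 1" i j] x xq nsq by auto
  have g2: "g i j (x $ 2) \<noteq> 0" for i j using gz[of "x $ 2" i j] x xq nsq by auto
  have span: "\<exists>a b. m = (\<lambda>z. a * f i j z + b * g i j z)" if m: "m \<in> theta_deg 2 (c i j)" for m i j
  proof -
    \<comment> \<open>The values at \<open>x $ 1\<close> and \<open>x $ 2\<close>, where one basis
      function vanishes, force the coefficients. The remainder vanishes at both points, and by (NS)
      their product is not equivalent to \<open>c i j\<close>.\<close>
    define a where "a = m (x $ 1) / f i j (x $ 1)"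
    define b where "b = m (x $ 2) / g i j (x $ 2)"
    have h0: "(\<lambda>z. m z - (a * f i j z + b * g i j z)) \<in> theta_deg 2 (c i j)"
      by (rule theta_deg_diff[OF m theta_deg_lincomb[OF fd gd]])
    have h1: "m (x $ 1) - (a * f i j (x $ 1) + b * g i j (x $ 1)) = 0"
      and h2: "m (x $ 2) - (a * f i j (x $ 2) + b * g i j (x $ 2)) = 0"
      using f1 f2 g1 g2 by (simp_all add: a_def b_def)
    have "m z - (a * f i j z + b * g i j z) = 0" for z
      by (rule theta_deg_2_zeros[OF h0 c0 _ _ h1 h2]) (use x xq ns in auto)
    then show ?thesis by (intro exI[of _ a] exI[of _ b]) auto
  qed
  have c22: "c 1 1 \<noteq> 0" "c 1 2 \<noteq> 0" "c 2 1 \<noteq> 0" "c 2 2 \<noteq> 0" by (auto simp: c0)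
  \<comment> \<open>The two products share the zero \<open>x $ 2\<close> and agree at
    \<open>x $ 3\<close> by normalization, so they cannot also agree at \<open>x $ 1\<close>. This
    becomes \<open>s1 \<noteq> 1\<close>; \<open>ne2\<close> becomes \<open>s2 \<noteq> 1\<close>
    and \<open>ne12\<close> becomes \<open>s1 \<noteq> s2\<close>.\<close>
  have ne1: "f 1 1 (x $ 1) * f 2 2 (x $ 1) \<noteq> f 1 2 (x $ 1) * f 2 1 (x $ 1)"
  proof
    assume e: "f 1 1 (x $ 1) * f 2 2 (x $ 1) = f 1 2 (x $ 1) * f 2 1 (x $ 1)"
    have "\<exists>z. f 1 2 z \<noteq> 0" "\<exists>z. f 2 1 z \<noteq> 0" using f1 by blast+
    moreover have "f 1 1 (x $ 3) * f 2 2 (x $ 3) = f 1 2 (x $ 3) * f 2 1 (x $ 3)" using f3 by simp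
    moreover have "c 1 1 * c 2 2 = x $ 2 * x $ 1 * x $ 3 * x $ 4" "c 1 2 * c 2 1 = x $ 2 * x $ 1 * x $ 3 * x $ 4"
      using C by (simp_all add: mult_ac)
    ultimately show False
      using common_zero_impossible[OF fd fd fd fd c22 _ _ _ _ _ _ _ _ _ _ cne f2 f2 f2 f2 _ _ e] x xq by blast
  qed
  have ne2: "g 1 1 (x $ 2) * g 2 2 (x $ 2) \<noteq> g 1 2 (x $ 2) * g 2 1 (x $ 2)"
  proof
    assume e: "g 1 1 (x $ 2) * g 2 2 (x $ 2) = g 1 2 (x $ 2) * g 2 1 (x $ 2)"
    have "\<exists>z. g 1 2 z \<noteq> 0" "\<exists>z. g 2 1 z \<noteq> 0" using g2 by blast+
    moreover have "g 1 1 (x $ 3) * g 2 2 (x $ 3) = g 1 2 (x $ 3) * g 2 1 (x $ 3)" using g3 by simp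
    ultimately show False
      using common_zero_impossible[OF gd gd gd gd c22 C _ _ _ _ _ _ _ _ cne g1 g1 g1 g1 _ _ e] x xq by blast
  qed
  have ne12: "f 1 1 (x $ 1) * f 2 2 (x $ 1) * (g 1 2 (x $ 2) * g 2 1 (x $ 2)) \<noteq>
               f 1 2 (x $ 1) * f 2 1 (x $ 1) * (g 1 1 (x $ 2) * g 2 2 (x $ 2))"
  proof
    assume e: "f 1 1 (x $ 1) * f 2 2 (x $ 1) * (g 1 2 (x $ 2) * g 2 1 (x $ 2)) =
               f 1 2 (x $ 1) * f 2 1 (x $ 1) * (g 1 1 (x $ 2) * g 2 2 (x $ 2))"
    \<comment> \<open>The same principle is applied to the differences \<open>f - g\<close>, which
      all vanish at \<open>x $ 3\<close>. The factor \<open>k\<close> in one entry makes the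
      products agree at \<open>x $ 1\<close>; the assumed equality \<open>e\<close> makes them agree
      at \<open>x $ 2\<close>.\<close>
    define k where "k = f 1 2 (x $ 1) * f 2 1 (x $ 1) / (f 1 1 (x $ 1) * f 2 2 (x $ 1))"
    define h where "h = (\<lambda>i j z. (if i = 1 \<and> j = 1 then k else 1) * (f i j z - g i j z))"
    have hd: "h i j \<in> theta_deg 2 (c i j)" for i j
      using theta_deg_lincomb[OF fd gd, of "if i = 1 \<and> j = 1 then k else 1" i j
          "- (if i = 1 \<and> j = 1 then k else 1)"]
      by (simp add: h_def right_diff_distrib)
    have h3: "h i j (x $ 3) = 0" for i j using f3 g3 by (simp add: h_def)
    have e1: "h 1 1 (x $ 1) * h 2 2 (x $ 1) = h 1 2 (x $ 1) * h 2 1 (x $ 1)"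
      using f1 g1 by (simp add: h_def k_def)
    have e2: "h 1 1 (x $ 2) * h 2 2 (x $ 2) = h 1 2 (x $ 2) * h 2 1 (x $ 2)"
      using e f2 f1 by (simp add: h_def k_def field_simps)
    have "h 1 2 (x $ 1) \<noteq> 0" "h 2 1 (x $ 1) \<noteq> 0" using f1 g1 by (simp_all add: h_def)
    then have "\<exists>z. h 1 2 z \<noteq> 0" "\<exists>z. h 2 1 z \<noteq> 0" by blast+
    moreover have "c 1 1 * c 2 2 = x $ 3 * x $ 1 * x $ 2 * x $ 4" "c 1 2 * c 2 1 = x $ 3 * x $ 1 * x $ 2 * x $ 4"
      using C by (simp_all add: mult_ac)
    ultimately show False
      using common_zero_impossible[OF hd hd hd hd c22 _ _ _ _ _ _ _ _ _ _ cne h3 h3 h3 h3 _ _ e1 e2] x xq by blast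
  qed
  have V_iff: "M \<in> V q \<rho> \<sigma> \<longleftrightarrow> (\<forall>i j. M $ i $ j \<in> theta_deg 2 (c i j))" for M
    by (simp add: V_def theta_space_eq c_def)
  define \<Theta> where "\<Theta> = (\<lambda>z. th (x $ 1) z * th (x $ 2) z * th (x $ 3) z * th (x $ 4) z)"
  have det_eq: "\<exists>k. \<forall>z. det (mat_at M z) = k * \<Theta> z"
    if M: "M \<in> V q \<rho> \<sigma>" and 0: "det (mat_at M (x $ 1)) = 0" "det (mat_at M (x $ 2)) = 0" "det (mat_at M (x $ 3)) = 0"
    for M
  proof -
    have Md: "M $ i $ j \<in> theta_deg 2 (c i j)" for i j using M V_iff by blast
    have "(\<lambda>z. det (mat_at M z)) \<in> theta_deg (2 + 2) (x $ 1 * x $ 2 * x $ 3 * x $ 4)"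
      unfolding det_mat_at
      using theta_deg_diff[OF theta_deg_mult[OF Md[of 1 1] Md[of 2 2], unfolded C]
                              theta_deg_mult[OF Md[of 1 2] Md[of 2 1], unfolded C]] .
    then have "(\<lambda>z. det (mat_at M z)) \<in> theta_deg 4 (x $ 1 * x $ 2 * x $ 3 * x $ 4)" by simp
    from theta_deg_4_zeros[OF this] show ?thesis
      using x xq 0 unfolding \<Theta>_def by auto
  qed
  \<comment> \<open>A matrix whose first row vanishes at \<open>x\<^sub>1\<close>; these form one of the 16 lines on the surface.\<close>
  obtain M where M: "M \<in> V q \<rho> \<sigma>" "det (mat_at M (x $ 1)) = 0" "det (mat_at M (x $ 2)) = 0"
      "det (mat_at M (x $ 3)) = 0" and Mz: "\<exists>z. z \<noteq> 0 \<and> det (mat_at M z) \<noteq> 0"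
  proof -
    \<comment> \<open>The second zero of \<open>g 1 1\<close>. An entry \<open>m21\<close> that is
      nonzero at \<open>y\<close> will keep the determinant from vanishing identically.\<close>
    define y where "y = c 1 1 / x $ 1"
    have y0: "y \<noteq> 0" using c0 x by (simp add: y_def)
    have "f 2 1 y \<noteq> 0 \<or> g 2 1 y \<noteq> 0"
    proof (rule ccontr)
      assume "\<not> ?thesis"
      then have a: "in_qZ (y / x $ 2) \<or> in_qZ (x $ 2 * y / c 2 1)" and b: "in_qZ (y / x $ 1) \<or> in_qZ (x $ 1 * y / c 2 1)"
        using fz[OF y0] gz[OF y0] by auto
      have "\<not> in_qZ (y / x $ 2)" using ns[of 1 2 1 1] by (simp add: y_def)
      with a have a: "in_qZ (x $ 2 * y / c 2 1)" by blast
      have "\<not> in_qZ (x $ 1 * y / c 2 1)" using cne x by (simp add: y_def)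
      with b have b: "in_qZ (y / x $ 1)" by blast
      have "in_qZ ((x $ 2 * y / c 2 1) / (y / x $ 1))" by (rule in_qZ_divide[OF a b])
      moreover have "(x $ 2 * y / c 2 1) / (y / x $ 1) = x $ 2 * x $ 1 / c 2 1" using y0 x by simp
      ultimately show False using nsq by simp
    qed
    then obtain m21 where m21: "m21 \<in> theta_deg 2 (c 2 1)" "m21 y \<noteq> 0" using fd gd by blast
    \<comment> \<open>The value that \<open>m22\<close> must take at \<open>x $ k\<close> for a
      vanishing determinant, used at \<open>x $ 2\<close> and \<open>x $ 3\<close>; at
      \<open>x $ 1\<close> the whole first row is zero.\<close>
    define t where "t = (\<lambda>k. g 1 2 (x $ k) * m21 (x $ k) / g 1 1 (x $ k))"
    define b where "b = t 2 / g 2 2 (x $ 2)"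
    define m22 where "m22 = (\<lambda>z. (t 3 - b) * f 2 2 z + b * g 2 2 z)"
    have m22: "m22 \<in> theta_deg 2 (c 2 2)" unfolding m22_def by (rule theta_deg_lincomb[OF fd gd])
    have m22x: "m22 (x $ 2) = t 2" "m22 (x $ 3) = t 3"
      using f2 g2 f3 g3 by (simp_all add: m22_def b_def)
    define M :: fun_matrix where "M = (\<chi> i j. if i = 1 then g 1 j else if j = 1 then m21 else m22)"
    have M2: "M $ 1 $ 1 = g 1 1" "M $ 1 $ 2 = g 1 2" "M $ 2 $ 1 = m21" "M $ 2 $ 2 = m22"
      by (simp_all add: M_def)
    have "M \<in> V q \<rho> \<sigma>" unfolding V_iff forall_2 M2 using gd m21 m22 by blast
    moreover have "det (mat_at M (x $ 1)) = 0" "det (mat_at M (x $ 2)) = 0" "det (mat_at M (x $ 3)) = 0"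
      unfolding det_mat_at M2 m22x using g1 g2 g3 by (simp_all add: t_def)
    moreover have "\<exists>z. z \<noteq> 0 \<and> det (mat_at M z) \<noteq> 0"
    proof (rule ccontr)
      assume "\<not> ?thesis"
      then have 0: "g 1 1 z * m22 z = g 1 2 z * m21 z" if "z \<noteq> 0" for z
        using that unfolding det_mat_at M2 by auto
      define k where "k = (\<lambda>j. 1 / (th (x $ 1) (x $ 3) * th (c 1 j / x $ 1) (x $ 3)))"
      have k0: "k j \<noteq> 0" for j
        using th_zero_iff[of "x $ 1" "x $ 3"] th_zero_iff[of "c 1 j / x $ 1" "x $ 3"] x c0 xq nsq
        by (auto simp: k_def mult.commute)
      have gk: "g 1 j z = k j * (th (x $ 1) z * th (c 1 j / x $ 1) z)" for j z
        by (simp add: g_def bas_def k_def)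
      \<comment> \<open>The determinant divided by \<open>th (x $ 1)\<close>. At \<open>y\<close>
        its first term is 0, whereas the second one is not, because \<open>c 1 1\<close> and
        \<open>c 1 2\<close> are inequivalent.\<close>
      define h where "h = (\<lambda>z. k 1 * th (c 1 1 / x $ 1) z * m22 z - k 2 * th (c 1 2 / x $ 1) z * m21 z)"
      have "h y = 0"
      proof (rule th_cancel[of h "x $ 1"])
        have "th (c 1 j / x $ 1) holomorphic_on - {0}" for j
          using th_theta_deg[of "c 1 j / x $ 1"] c0 x by (simp add: theta_deg_def)
        then show "h holomorphic_on - {0}" using m21 m22 unfolding h_def
          by (intro holomorphic_intros) (auto simp: theta_deg_def)
        show "th (x $ 1) z * h z = 0" if "z \<noteq> 0" for z
          using 0[OF that] unfolding gk h_def by (simp add: algebra_simps)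
      qed (use x y0 in auto)
      then have "k 2 * th (c 1 2 / x $ 1) y * m21 y = 0"
        using th_zero_iff[of "c 1 1 / x $ 1" y] y0 by (simp add: h_def y_def)
      then have "th (c 1 2 / x $ 1) y = 0" using k0 m21 by simp
      then show False using th_zero_iff[of "c 1 2 / x $ 1" y] y0 x c0 cne by (simp add: y_def)
    qed
    ultimately show ?thesis using that by blast
  qed
  obtain x0 where x0: "x0 \<noteq> 0" "det (mat_at M x0) \<noteq> 0" using Mz by blast
  \<comment> \<open>All determinants in question are multiples of the single function
    \<open>\<Theta>\<close>, so one point \<open>x0\<close> serves for every element of
    \<open>F\<close>.\<close>
  then have T0: "\<Theta> x0 \<noteq> 0" using det_eq[OF M] by auto
  have F_eq: "F q \<rho> \<sigma> x = {M \<in> V q \<rho> \<sigma>. det (mat_at M (x $ 1)) = 0 \<and> det (mat_at M (x $ 2)) = 0 \<and>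
                det (mat_at M (x $ 3)) = 0 \<and> det (mat_at M x0) \<noteq> 0}"
  proof (intro set_eqI iffI)
    fix M assume M: "M \<in> F q \<rho> \<sigma> x"
    then obtain k where "\<forall>z. det (mat_at M z) = k * \<Theta> z" using det_eq[of M] by (auto simp: F_def)
    then show "M \<in> {M \<in> V q \<rho> \<sigma>. det (mat_at M (x $ 1)) = 0 \<and> det (mat_at M (x $ 2)) = 0 \<and>
                det (mat_at M (x $ 3)) = 0 \<and> det (mat_at M x0) \<noteq> 0}"
      using M T0 by (auto simp: F_def)
  next
    fix M assume M: "M \<in> {M \<in> V q \<rho> \<sigma>. det (mat_at M (x $ 1)) = 0 \<and> det (mat_at M (x $ 2)) = 0 \<and>
                det (mat_at M (x $ 3)) = 0 \<and> det (mat_at M x0) \<noteq> 0}"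
    then obtain k where k: "\<forall>z. det (mat_at M z) = k * \<Theta> z" using det_eq[of M] by auto
    have "th (x $ 4) (x $ 4) = 0" using th_zero_iff x by simp
    then have "det (mat_at M (x $ 4)) = 0" unfolding k[rule_format] by (simp add: \<Theta>_def)
    then show "M \<in> F q \<rho> \<sigma> x" using M x0 by (auto simp: F_def forall_4)
  qed
  have "M \<in> F q \<rho> \<sigma> x" using M x0 F_eq by simp
  then have "theta_bases q \<rho> \<sigma> x f g x0"
    using fd gd span f1 f2 f3 g1 g2 g3 ne1 ne2 ne12 F_eq
    by unfold_locales (auto simp: theta_space_eq c_def)
  then show ?thesis by blast
qed

section \<open>Quasi-affine varieties\<close>

lemma poly_funs_uminus: "f \<in> poly_funs L \<Longrightarrow> (\<lambda>p. - f p) \<in> poly_funs L"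
  using poly_funs.mult[OF poly_funs.const[of "-1"]] by fastforce

lemma poly_funs_diff: "f \<in> poly_funs L \<Longrightarrow> g \<in> poly_funs L \<Longrightarrow> (\<lambda>p. f p - g p) \<in> poly_funs L"
  using poly_funs.add[OF _ poly_funs_uminus] by fastforce

lemma poly_funs_power: "f \<in> poly_funs L \<Longrightarrow> (\<lambda>p. f p ^ n) \<in> poly_funs L"
  by (induction n) (auto intro: poly_funs.const poly_funs.mult)

lemma poly_funs_sum: "(\<And>i. i \<in> I \<Longrightarrow> f i \<in> poly_funs L) \<Longrightarrow> (\<lambda>p. \<Sum>i\<in>I. f i p) \<in> poly_funs L"
  by (induction I rule: infinite_finite_induct) (auto intro: poly_funs.const poly_funs.add)

lemmas poly_funs_intros = poly_funs.const poly_funs.add poly_funs.mult poly_funs_uminus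
  poly_funs_diff poly_funs_power poly_funs_sum

lemma poly_funs_compose:
  assumes "f \<in> poly_funs L'" and "\<And>l. l \<in> L' \<Longrightarrow> (\<lambda>p. l (\<phi> p)) \<in> poly_funs L"
  shows "(\<lambda>p. f (\<phi> p)) \<in> poly_funs L"
  using assms(1) by induction (auto intro: poly_funs_intros assms(2))

section \<open>Zariski open sets and locally rational functions\<close>

definition zopen :: "('a \<Rightarrow> complex) set \<Rightarrow> 'a set \<Rightarrow> 'a set \<Rightarrow> bool" where
  "zopen L S U \<longleftrightarrow> (\<exists>T \<subseteq> poly_funs L. U = {p \<in> S. \<exists>f\<in>T. f p \<noteq> 0})"

lemma zariski_open_eq: "zariski_open C L = zopen L C"
proof (intro ext)
  fix U
  have "C - {p \<in> C. \<forall>f\<in>T. f p = 0} = {p \<in> C. \<exists>f\<in>T. f p \<noteq> 0}" for T :: "('a \<Rightarrow> complex) set" by blast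
  then show "zariski_open C L U = zopen L C U" by (simp add: zariski_open_def zopen_def)
qed

lemma zopen_basic: "f \<in> poly_funs L \<Longrightarrow> zopen L S {p \<in> S. f p \<noteq> 0}"
  unfolding zopen_def by (intro exI[of _ "{f}"]) auto

lemma zopen_subset: "zopen L S U \<Longrightarrow> U \<subseteq> S"
  unfolding zopen_def by auto

lemma zopen_basisE:
  assumes "zopen L S U" "p \<in> U"
  obtains k where "k \<in> poly_funs L" "k p \<noteq> 0" "\<And>y. y \<in> S \<Longrightarrow> k y \<noteq> 0 \<Longrightarrow> y \<in> U"
proof -
  from assms obtain T where T: "T \<subseteq> poly_funs L" "U = {p \<in> S. \<exists>f\<in>T. f p \<noteq> 0}"
    unfolding zopen_def by blast
  then obtain k where "k \<in> T" "k p \<noteq> 0" using assms by auto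
  with T show ?thesis by (intro that[of k]) auto
qed

lemma zopenI:
  assumes "U \<subseteq> S" and "\<And>p. p \<in> U \<Longrightarrow> \<exists>k\<in>poly_funs L. k p \<noteq> 0 \<and> (\<forall>y\<in>S. k y \<noteq> 0 \<longrightarrow> y \<in> U)"
  shows "zopen L S U"
  unfolding zopen_def
proof (intro exI conjI)
  show "U = {p \<in> S. \<exists>f\<in>{k \<in> poly_funs L. \<forall>y\<in>S. k y \<noteq> 0 \<longrightarrow> y \<in> U}. f p \<noteq> 0}"
  proof (intro set_eqI iffI)
    fix p assume "p \<in> U"
    moreover from assms(2)[OF this] obtain k where
      "k \<in> poly_funs L" "k p \<noteq> 0" "\<forall>y\<in>S. k y \<noteq> 0 \<longrightarrow> y \<in> U" by (elim bexE conjE)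
    ultimately show "p \<in> {p \<in> S. \<exists>f\<in>{k \<in> poly_funs L. \<forall>y\<in>S. k y \<noteq> 0 \<longrightarrow> y \<in> U}. f p \<noteq> 0}"
      using assms(1) by blast
  qed blast
qed auto

lemma zopen_self: "zopen L S S"
  by (rule zopenI) (auto intro!: bexI[of _ "\<lambda>_. 1"] poly_funs.const)

lemma zopen_Int_basic:
  assumes U: "zopen L S U" and k: "k \<in> poly_funs L"
  shows "zopen L S {y \<in> U. k y \<noteq> 0}"
proof (rule zopenI)
  show "{y \<in> U. k y \<noteq> 0} \<subseteq> S" using zopen_subset[OF U] by auto
  fix p assume p: "p \<in> {y \<in> U. k y \<noteq> 0}"
  then obtain k' where k': "k' \<in> poly_funs L" "k' p \<noteq> 0" "\<And>y. y \<in> S \<Longrightarrow> k' y \<noteq> 0 \<Longrightarrow> y \<in> U"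
    using zopen_basisE[OF U, of p] by blast
  then show "\<exists>k'\<in>poly_funs L. k' p \<noteq> 0 \<and> (\<forall>y\<in>S. k' y \<noteq> 0 \<longrightarrow> y \<in> {y \<in> U. k y \<noteq> 0})"
    using k p by (intro bexI[of _ "\<lambda>p. k' p * k p"]) (auto intro: poly_funs.mult)
qed

text \<open>Regularity tested on the principal open subsets of \<open>U\<close> instead of arbitrary
  open neighbourhoods. The ambient space disappears, so that passing to a subset of a subset changes
  nothing.\<close>

definition locrat :: "('a \<Rightarrow> complex) set \<Rightarrow> 'a set \<Rightarrow> ('a \<Rightarrow> complex) \<Rightarrow> bool" where
  "locrat L U f \<longleftrightarrow> (\<forall>p\<in>U. \<exists>g\<in>poly_funs L. \<exists>h\<in>poly_funs L. h p \<noteq> 0 \<and> (\<forall>y\<in>U. h y \<noteq> 0 \<longrightarrow> f y = g y / h y))"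

lemma locratE:
  assumes "locrat L U f" "p \<in> U"
  obtains g h where "g \<in> poly_funs L" "h \<in> poly_funs L" "h p \<noteq> 0" "\<And>y. y \<in> U \<Longrightarrow> h y \<noteq> 0 \<Longrightarrow> f y = g y / h y"
  using assms unfolding locrat_def by blast

lemma locrat_divide_poly:
  "g \<in> poly_funs L \<Longrightarrow> h \<in> poly_funs L \<Longrightarrow> (\<And>y. y \<in> U \<Longrightarrow> h y \<noteq> 0) \<Longrightarrow> (\<And>y. y \<in> U \<Longrightarrow> f y = g y / h y) \<Longrightarrow> locrat L U f"
  unfolding locrat_def by blast

lemma locrat_poly: "f \<in> poly_funs L \<Longrightarrow> locrat L U f"
  by (rule locrat_divide_poly[of f _ "\<lambda>_. 1"]) (auto intro: poly_funs.const)

lemma locrat_subset: "locrat L U f \<Longrightarrow> U' \<subseteq> U \<Longrightarrow> locrat L U' f"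
  unfolding locrat_def by blast

lemma locrat_cong: "(\<And>y. y \<in> U \<Longrightarrow> f y = f' y) \<Longrightarrow> locrat L U f \<longleftrightarrow> locrat L U f'"
  unfolding locrat_def by auto

lemma locrat_congI: "locrat L U f \<Longrightarrow> (\<And>y. y \<in> U \<Longrightarrow> f y = f' y) \<Longrightarrow> locrat L U f'"
  using locrat_cong[of U f f' L] by blast

text \<open>Multiplying numerator and denominator by \<open>k\<close> absorbs the restriction to
  \<open>k \<noteq> 0\<close> into the denominator.\<close>

lemma locrat_local:
  assumes "\<And>p. p \<in> U \<Longrightarrow> \<exists>k\<in>poly_funs L. k p \<noteq> 0 \<and> locrat L {y \<in> U. k y \<noteq> 0} f"
  shows "locrat L U f"
  unfolding locrat_def
proof
  fix p assume p: "p \<in> U"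
  then obtain k where k: "k \<in> poly_funs L" "k p \<noteq> 0" "locrat L {y \<in> U. k y \<noteq> 0} f" using assms by blast
  then obtain g h where gh: "g \<in> poly_funs L" "h \<in> poly_funs L" "h p \<noteq> 0"
     "\<And>y. y \<in> {y \<in> U. k y \<noteq> 0} \<Longrightarrow> h y \<noteq> 0 \<Longrightarrow> f y = g y / h y"
    using p by (elim locratE[of _ _ _ p]) auto
  then show "\<exists>g\<in>poly_funs L. \<exists>h\<in>poly_funs L. h p \<noteq> 0 \<and> (\<forall>y\<in>U. h y \<noteq> 0 \<longrightarrow> f y = g y / h y)"
    using k by (intro bexI[of _ "\<lambda>y. g y * k y"] bexI[of _ "\<lambda>y. h y * k y"]) (auto intro: poly_funs.mult)
qed

lemma locrat_commonE:
  assumes "locrat L U f1" "locrat L U f2" "p \<in> U"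
  obtains g1 g2 h where "g1 \<in> poly_funs L" "g2 \<in> poly_funs L" "h \<in> poly_funs L" "h p \<noteq> 0"
    "\<And>y. y \<in> U \<Longrightarrow> h y \<noteq> 0 \<Longrightarrow> f1 y = g1 y / h y \<and> f2 y = g2 y / h y"
proof -
  obtain g1 h1 where 1: "g1 \<in> poly_funs L" "h1 \<in> poly_funs L" "h1 p \<noteq> 0" "\<And>y. y \<in> U \<Longrightarrow> h1 y \<noteq> 0 \<Longrightarrow> f1 y = g1 y / h1 y"
    by (rule locratE[OF assms(1,3)]) blast
  obtain g2 h2 where 2: "g2 \<in> poly_funs L" "h2 \<in> poly_funs L" "h2 p \<noteq> 0" "\<And>y. y \<in> U \<Longrightarrow> h2 y \<noteq> 0 \<Longrightarrow> f2 y = g2 y / h2 y"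
    by (rule locratE[OF assms(2,3)]) blast
  show ?thesis
    by (rule that[of "\<lambda>y. g1 y * h2 y" "\<lambda>y. g2 y * h1 y" "\<lambda>y. h1 y * h2 y"])
       (use 1 2 in \<open>auto intro!: poly_funs_intros\<close>)
qed

lemma locrat_add:
  assumes "locrat L U f1" "locrat L U f2" shows "locrat L U (\<lambda>y. f1 y + f2 y)"
  unfolding locrat_def
proof
  fix p assume "p \<in> U"
  with assms obtain g1 g2 h where "g1 \<in> poly_funs L" "g2 \<in> poly_funs L" "h \<in> poly_funs L" "h p \<noteq> 0"
    "\<And>y. y \<in> U \<Longrightarrow> h y \<noteq> 0 \<Longrightarrow> f1 y = g1 y / h y \<and> f2 y = g2 y / h y" by (rule locrat_commonE) blast
  then show "\<exists>g\<in>poly_funs L. \<exists>h\<in>poly_funs L. h p \<noteq> 0 \<and> (\<forall>y\<in>U. h y \<noteq> 0 \<longrightarrow> f1 y + f2 y = g y / h y)"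
    by (intro bexI[of _ "\<lambda>y. g1 y + g2 y"] bexI[of _ h]) (auto intro!: poly_funs_intros simp: add_divide_distrib)
qed

lemma locrat_mult:
  assumes "locrat L U f1" "locrat L U f2" shows "locrat L U (\<lambda>y. f1 y * f2 y)"
  unfolding locrat_def
proof
  fix p assume "p \<in> U"
  with assms obtain g1 g2 h where "g1 \<in> poly_funs L" "g2 \<in> poly_funs L" "h \<in> poly_funs L" "h p \<noteq> 0"
    "\<And>y. y \<in> U \<Longrightarrow> h y \<noteq> 0 \<Longrightarrow> f1 y = g1 y / h y \<and> f2 y = g2 y / h y" by (rule locrat_commonE) blast
  then show "\<exists>g\<in>poly_funs L. \<exists>h\<in>poly_funs L. h p \<noteq> 0 \<and> (\<forall>y\<in>U. h y \<noteq> 0 \<longrightarrow> f1 y * f2 y = g y / h y)"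
    by (intro bexI[of _ "\<lambda>y. g1 y * g2 y"] bexI[of _ "\<lambda>y. h y * h y"]) (auto intro!: poly_funs_intros)
qed

lemma locrat_inverse:
  assumes "locrat L U f" "\<And>y. y \<in> U \<Longrightarrow> f y \<noteq> 0" shows "locrat L U (\<lambda>y. 1 / f y)"
  unfolding locrat_def
proof
  fix p assume p: "p \<in> U"
  obtain g h where 1: "g \<in> poly_funs L" "h \<in> poly_funs L" "h p \<noteq> 0" "\<And>y. y \<in> U \<Longrightarrow> h y \<noteq> 0 \<Longrightarrow> f y = g y / h y"
    by (rule locratE[OF assms(1) p]) blast
  have "g p \<noteq> 0" using 1 p assms(2)[OF p] by auto
  then show "\<exists>g\<in>poly_funs L. \<exists>h\<in>poly_funs L. h p \<noteq> 0 \<and> (\<forall>y\<in>U. h y \<noteq> 0 \<longrightarrow> 1 / f y = g y / h y)"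
    using 1 by (intro bexI[of _ "\<lambda>y. h y * h y"] bexI[of _ "\<lambda>y. g y * h y"]) (auto intro!: poly_funs_intros)
qed

lemma locrat_divide:
  assumes "locrat L U f1" "locrat L U f2" "\<And>y. y \<in> U \<Longrightarrow> f2 y \<noteq> 0"
  shows "locrat L U (\<lambda>y. f1 y / f2 y)"
  using locrat_mult[OF assms(1) locrat_inverse[OF assms(2,3)]] by simp

lemma locrat_compose_poly:
  assumes "f \<in> poly_funs L'" and "\<And>l. l \<in> L' \<Longrightarrow> locrat L U (\<lambda>p. l (\<phi> p))"
  shows "locrat L U (\<lambda>p. f (\<phi> p))"
  using assms(1)
  by induction (auto intro: assms(2) locrat_poly poly_funs.const locrat_add locrat_mult)

lemma locrat_zopen_preimage:
  assumes "locrat L U f" "zopen L S U"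
  shows "zopen L S {p \<in> U. f p \<noteq> 0}"
proof (rule zopenI)
  show "{p \<in> U. f p \<noteq> 0} \<subseteq> S" using zopen_subset[OF assms(2)] by auto
  fix p assume p: "p \<in> {p \<in> U. f p \<noteq> 0}"
  then obtain g h where 1: "g \<in> poly_funs L" "h \<in> poly_funs L" "h p \<noteq> 0" "\<And>y. y \<in> U \<Longrightarrow> h y \<noteq> 0 \<Longrightarrow> f y = g y / h y"
    using locratE[OF assms(1), of p] by blast
  obtain k where k: "k \<in> poly_funs L" "k p \<noteq> 0" "\<And>y. y \<in> S \<Longrightarrow> k y \<noteq> 0 \<Longrightarrow> y \<in> U"
    using zopen_basisE[OF assms(2), of p] p by blast
  show "\<exists>k\<in>poly_funs L. k p \<noteq> 0 \<and> (\<forall>y\<in>S. k y \<noteq> 0 \<longrightarrow> y \<in> {p \<in> U. f p \<noteq> 0})"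
    using 1 k p by (intro bexI[of _ "\<lambda>y. k y * (g y * h y)"]) (auto intro!: poly_funs.mult)
qed

lemma locrat_compose:
  assumes f: "locrat L' U' f" and \<phi>: "\<And>l. l \<in> L' \<Longrightarrow> locrat L U (\<lambda>p. l (\<phi> p))" and im: "\<And>p. p \<in> U \<Longrightarrow> \<phi> p \<in> U'"
  shows "locrat L U (\<lambda>p. f (\<phi> p))"
proof (rule locrat_local)
  fix p assume p: "p \<in> U"
  obtain g h where 1: "g \<in> poly_funs L'" "h \<in> poly_funs L'" "h (\<phi> p) \<noteq> 0" "\<And>y. y \<in> U' \<Longrightarrow> h y \<noteq> 0 \<Longrightarrow> f y = g y / h y"
    using locratE[OF f im[OF p]] by blast
  have lg: "locrat L U (\<lambda>p. g (\<phi> p))" and lh: "locrat L U (\<lambda>p. h (\<phi> p))"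
    by (rule locrat_compose_poly[OF 1(1) \<phi>], assumption) (rule locrat_compose_poly[OF 1(2) \<phi>])
  obtain a b where ab: "a \<in> poly_funs L" "b \<in> poly_funs L" "b p \<noteq> 0" "\<And>y. y \<in> U \<Longrightarrow> b y \<noteq> 0 \<Longrightarrow> h (\<phi> y) = a y / b y"
    using locratE[OF lh p] by blast
  have ap: "a p \<noteq> 0" using ab p 1 by auto
  \<comment> \<open>Where \<open>a * b\<close> is nonzero, the fraction \<open>a / b\<close> both
    represents the denominator \<open>h (\<phi> y)\<close> and shows that it is nonzero.\<close>
  define k where "k = (\<lambda>y. a y * b y)"
  have hk: "h (\<phi> y) \<noteq> 0" if "y \<in> {y \<in> U. k y \<noteq> 0}" for y using that ab by (auto simp: k_def)
  have "locrat L {y \<in> U. k y \<noteq> 0} (\<lambda>y. g (\<phi> y) / h (\<phi> y))"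
    by (intro locrat_divide locrat_subset[OF lg] locrat_subset[OF lh] hk) auto
  moreover have "g (\<phi> y) / h (\<phi> y) = f (\<phi> y)" if "y \<in> {y \<in> U. k y \<noteq> 0}" for y
    using 1(4) im hk[OF that] that by auto
  ultimately have "locrat L {y \<in> U. k y \<noteq> 0} (\<lambda>y. f (\<phi> y))" by (rule locrat_congI)
  then show "\<exists>k\<in>poly_funs L. k p \<noteq> 0 \<and> locrat L {y \<in> U. k y \<noteq> 0} (\<lambda>y. f (\<phi> y))"
    using ab ap by (intro bexI[of _ k]) (auto simp: k_def intro: poly_funs.mult)
qed

text \<open>The form in which every space except the quotient by \<open>H\<close> is handled:
  topology and regular functions come from the algebra generated by \<open>L\<close> on
  \<open>S\<close>. Morphisms between such spaces can be tested on the generators.\<close>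

definition quasi_affine :: "'a fspace \<Rightarrow> ('a \<Rightarrow> complex) set \<Rightarrow> 'a set \<Rightarrow> bool" where
  "quasi_affine X L S \<longleftrightarrow> (\<forall>U. openin (zar X) U \<longleftrightarrow> zopen L S U) \<and>
     (\<forall>U f. zopen L S U \<longrightarrow> (f \<in> regular X U \<longleftrightarrow> locrat L U f))"

lemma quasi_affineD:
  assumes "quasi_affine X L S"
  shows "openin (zar X) U \<longleftrightarrow> zopen L S U" "zopen L S U \<Longrightarrow> f \<in> regular X U \<longleftrightarrow> locrat L U f"
  using assms unfolding quasi_affine_def by blast+

lemma quasi_affine_points: "quasi_affine X L S \<Longrightarrow> points X = S"
  using zopen_self[of L S] zopen_subset[of L S]
  unfolding points_def topspace_def quasi_affine_def by blast

lemma quasi_affine_linear_space: "quasi_affine (linear_space C L) L C"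
  unfolding quasi_affine_def
proof (intro conjI allI impI)
  show "openin (zar (linear_space C L)) U = zopen L C U" for U
    by (simp add: openin_linear_space zariski_open_eq)
  fix U f assume U: "zopen L C U"
  show "f \<in> regular (linear_space C L) U \<longleftrightarrow> locrat L U f"
  proof
    assume f: "f \<in> regular (linear_space C L) U"
    show "locrat L U f" unfolding locrat_def
    proof
      fix p assume "p \<in> U"
      with f obtain W g h where W: "zopen L C W" "p \<in> W" "W \<subseteq> U" "g \<in> poly_funs L" "h \<in> poly_funs L"
        "\<forall>y\<in>W. h y \<noteq> 0 \<and> f y = g y / h y"
        unfolding linear_space_def zariski_open_eq by auto
      obtain k where k: "k \<in> poly_funs L" "k p \<noteq> 0" "\<And>y. y \<in> C \<Longrightarrow> k y \<noteq> 0 \<Longrightarrow> y \<in> W"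
        using zopen_basisE[OF W(1,2)] by blast
      show "\<exists>g\<in>poly_funs L. \<exists>h\<in>poly_funs L. h p \<noteq> 0 \<and> (\<forall>y\<in>U. h y \<noteq> 0 \<longrightarrow> f y = g y / h y)"
        using W k zopen_subset[OF U]
        by (intro bexI[of _ "\<lambda>y. g y * k y"] bexI[of _ "\<lambda>y. h y * k y"]) (auto intro: poly_funs.mult)
    qed
  next
    assume f: "locrat L U f"
    show "f \<in> regular (linear_space C L) U"
      unfolding linear_space_def zariski_open_eq
    proof (simp, intro ballI)
      fix p assume p: "p \<in> U"
      obtain g h where 1: "g \<in> poly_funs L" "h \<in> poly_funs L" "h p \<noteq> 0" "\<And>y. y \<in> U \<Longrightarrow> h y \<noteq> 0 \<Longrightarrow> f y = g y / h y"
        by (rule locratE[OF f p]) blast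
      show "\<exists>W. zopen L C W \<and> p \<in> W \<and> W \<subseteq> U \<and> (\<exists>g\<in>poly_funs L. \<exists>h\<in>poly_funs L. \<forall>y\<in>W. h y \<noteq> 0 \<and> f y = g y / h y)"
        using 1 p by (intro exI[of _ "{y \<in> U. h y \<noteq> 0}"]) (auto intro: zopen_Int_basic[OF U])
    qed
  qed
qed

lemma quasi_affine_subvariety:
  assumes X: "quasi_affine X L S" and TS: "T \<subseteq> S"
  shows "quasi_affine (subvariety X T) L T"
  unfolding quasi_affine_def
proof (intro conjI allI impI)
  fix U
  show op: "openin (zar (subvariety X T)) U = zopen L T U"
  proof
    assume "openin (zar (subvariety X T)) U"
    then obtain W where "zopen L S W" "U = W \<inter> T"
      using quasi_affineD(1)[OF X] unfolding subvariety_def by (auto simp: openin_subtopology)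
    then show "zopen L T U" using TS unfolding zopen_def by blast
  next
    assume "zopen L T U"
    then obtain K where K: "K \<subseteq> poly_funs L" "U = {p \<in> T. \<exists>f\<in>K. f p \<noteq> 0}" unfolding zopen_def by blast
    then have "U = {p \<in> S. \<exists>f\<in>K. f p \<noteq> 0} \<inter> T" using TS by auto
    moreover have "zopen L S {p \<in> S. \<exists>f\<in>K. f p \<noteq> 0}" using K unfolding zopen_def by blast
    ultimately show "openin (zar (subvariety X T)) U"
      using quasi_affineD(1)[OF X] unfolding subvariety_def by (auto simp: openin_subtopology)
  qed
  fix f assume U: "zopen L T U"
  show "f \<in> regular (subvariety X T) U \<longleftrightarrow> locrat L U f"
  proof
    assume f: "f \<in> regular (subvariety X T) U"
    show "locrat L U f"
    proof (rule locrat_local)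
      fix p assume "p \<in> U"
      then obtain W g where W: "zopen L S W" "p \<in> W" "locrat L W g" "\<forall>y\<in>W \<inter> U. f y = g y"
        using f quasi_affineD[OF X] unfolding subvariety_def by force
      obtain k where k: "k \<in> poly_funs L" "k p \<noteq> 0" "\<And>y. y \<in> S \<Longrightarrow> k y \<noteq> 0 \<Longrightarrow> y \<in> W"
        using zopen_basisE[OF W(1,2)] by blast
      have sub: "{y \<in> U. k y \<noteq> 0} \<subseteq> W" using k zopen_subset[OF U] TS by auto
      then have "locrat L {y \<in> U. k y \<noteq> 0} g" by (rule locrat_subset[OF W(3)])
      moreover have "f y = g y" if "y \<in> {y \<in> U. k y \<noteq> 0}" for y using W(4) sub that by auto
      ultimately have "locrat L {y \<in> U. k y \<noteq> 0} f" using locrat_cong[of "{y \<in> U. k y \<noteq> 0}" f g] by blast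
      then show "\<exists>k\<in>poly_funs L. k p \<noteq> 0 \<and> locrat L {y \<in> U. k y \<noteq> 0} f" using k by blast
    qed
  next
    assume f: "locrat L U f"
    have "\<exists>W g. openin (zar X) W \<and> p \<in> W \<and> g \<in> regular X W \<and> (\<forall>y\<in>W \<inter> U. f y = g y)" if p: "p \<in> U" for p
    proof -
      obtain g h where 1: "g \<in> poly_funs L" "h \<in> poly_funs L" "h p \<noteq> 0" "\<And>y. y \<in> U \<Longrightarrow> h y \<noteq> 0 \<Longrightarrow> f y = g y / h y"
        by (rule locratE[OF f p]) blast
      define W where "W = {y \<in> S. h y \<noteq> 0}"
      have W: "zopen L S W" unfolding W_def by (rule zopen_basic[OF 1(2)])
      have "locrat L W (\<lambda>y. g y / h y)" by (rule locrat_divide_poly[OF 1(1,2)]) (auto simp: W_def)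
      then show ?thesis using 1 W quasi_affineD[OF X] p zopen_subset[OF U] TS
        by (intro exI[of _ W] exI[of _ "\<lambda>y. g y / h y"]) (auto simp: W_def)
    qed
    then show "f \<in> regular (subvariety X T) U" by (simp add: subvariety_def)
  qed
qed

lemma quasi_affine_morphism:
  assumes X: "quasi_affine X L S" and Y: "quasi_affine Y L' S'"
    and im: "\<And>p. p \<in> S \<Longrightarrow> \<phi> p \<in> S'" and \<phi>: "\<And>l. l \<in> L' \<Longrightarrow> locrat L S (\<lambda>p. l (\<phi> p))"
  shows "morphism X Y \<phi>"
proof -
  have op: "zopen L S {p \<in> S. \<phi> p \<in> U}" if U: "zopen L' S' U" for U
  proof (rule zopenI)
    fix p assume p: "p \<in> {p \<in> S. \<phi> p \<in> U}"
    then obtain k where k: "k \<in> poly_funs L'" "k (\<phi> p) \<noteq> 0" "\<And>y. y \<in> S' \<Longrightarrow> k y \<noteq> 0 \<Longrightarrow> y \<in> U"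
      using zopen_basisE[OF U, of "\<phi> p"] by blast
    have "zopen L S {p \<in> S. k (\<phi> p) \<noteq> 0}"
      by (rule locrat_zopen_preimage[OF locrat_compose_poly[OF k(1) \<phi>] zopen_self])
    from zopen_basisE[OF this, of p] k(2) p obtain k'
      where k': "k' \<in> poly_funs L" "k' p \<noteq> 0" "\<And>y. y \<in> S \<Longrightarrow> k' y \<noteq> 0 \<Longrightarrow> y \<in> {p \<in> S. k (\<phi> p) \<noteq> 0}" by blast
    then show "\<exists>k\<in>poly_funs L. k p \<noteq> 0 \<and> (\<forall>y\<in>S. k y \<noteq> 0 \<longrightarrow> y \<in> {p \<in> S. \<phi> p \<in> U})"
      using k im by (intro bexI[of _ k']) auto
  qed auto
  show ?thesis unfolding morphism_def
  proof (intro conjI allI impI)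
    show "continuous_map (zar X) (zar Y) \<phi>"
      using im op quasi_affineD(1)[OF X] quasi_affineD(1)[OF Y] quasi_affine_points[OF X] quasi_affine_points[OF Y]
      by (auto simp: continuous_map_def points_def)
    fix U f assume "openin (zar Y) U" "f \<in> regular Y U"
    then have U: "zopen L' S' U" "locrat L' U f" using quasi_affineD[OF Y] by blast+
    have "locrat L {p \<in> S. \<phi> p \<in> U} (\<lambda>p. f (\<phi> p))"
      by (rule locrat_compose[OF U(2) locrat_subset[OF \<phi>]]) auto
    then show "f \<circ> \<phi> \<in> regular X {p \<in> points X. \<phi> p \<in> U}"
      using quasi_affineD(2)[OF X op[OF U(1)]] quasi_affine_points[OF X] by (simp add: comp_def)
  qed
qed

lemma quasi_affine_isomorphism:
  assumes X: "quasi_affine X L S" and Y: "quasi_affine Y L' S'"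
    and im: "\<And>p. p \<in> S \<Longrightarrow> \<phi> p \<in> S'" and \<phi>: "\<And>l. l \<in> L' \<Longrightarrow> locrat L S (\<lambda>p. l (\<phi> p))"
    and im': "\<And>p. p \<in> S' \<Longrightarrow> \<psi> p \<in> S" and \<psi>: "\<And>l. l \<in> L \<Longrightarrow> locrat L' S' (\<lambda>p. l (\<psi> p))"
    and inv: "\<And>p. p \<in> S \<Longrightarrow> \<psi> (\<phi> p) = p" "\<And>p. p \<in> S' \<Longrightarrow> \<phi> (\<psi> p) = p"
  shows "isomorphism X Y \<phi>"
  unfolding isomorphism_def
proof (intro conjI exI[of _ \<psi>])
  show "morphism X Y \<phi>" by (rule quasi_affine_morphism[OF X Y]) (auto intro: im \<phi>)
  show "morphism Y X \<psi>" by (rule quasi_affine_morphism[OF Y X]) (auto intro: im' \<psi>)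
qed (use inv quasi_affine_points[OF X] quasi_affine_points[OF Y] in auto)

lemma quasi_affine_closedin:
  assumes X: "quasi_affine X L S"
  shows "closedin (zar X) A \<longleftrightarrow> (\<exists>T \<subseteq> poly_funs L. A = {p \<in> S. \<forall>f\<in>T. f p = 0})"
proof -
  have S: "topspace (zar X) = S" using quasi_affine_points[OF X] by (simp add: points_def)
  have *: "A \<subseteq> S \<and> S - A = {p \<in> S. \<exists>f\<in>T. f p \<noteq> 0} \<longleftrightarrow> A = {p \<in> S. \<forall>f\<in>T. f p = 0}"
    for T :: "('a \<Rightarrow> complex) set" by blast
  have "closedin (zar X) A \<longleftrightarrow> (\<exists>T\<subseteq>poly_funs L. A \<subseteq> S \<and> S - A = {p \<in> S. \<exists>f\<in>T. f p \<noteq> 0})"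
    unfolding closedin_def S quasi_affineD(1)[OF X] zopen_def by blast
  then show ?thesis unfolding * .
qed

text \<open>Closed sets are intersections of zero sets of single functions, which reduces
  irreducibility to primality of the vanishing ideal.\<close>

lemma quasi_affine_irreducible:
  assumes X: "quasi_affine X L S" and Z: "Z \<subseteq> S"
  shows "irreducible_in (zar X) Z \<longleftrightarrow> Z \<noteq> {} \<and>
    (\<forall>f\<in>poly_funs L. \<forall>g\<in>poly_funs L. (\<forall>p\<in>Z. f p * g p = 0) \<longrightarrow> (\<forall>p\<in>Z. f p = 0) \<or> (\<forall>p\<in>Z. g p = 0))"
    (is "_ \<longleftrightarrow> _ \<and> ?prime")
proof -
  have S: "topspace (zar X) = S" using quasi_affine_points[OF X] by (simp add: points_def)
  have "?prime" if irr: "\<And>A B. closedin (zar X) A \<Longrightarrow> closedin (zar X) B \<Longrightarrow> Z \<subseteq> A \<union> B \<Longrightarrow> Z \<subseteq> A \<or> Z \<subseteq> B"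
  proof (intro ballI impI)
    fix f g assume fg: "f \<in> poly_funs L" "g \<in> poly_funs L" "\<forall>p\<in>Z. f p * g p = 0"
    have cl: "closedin (zar X) {p \<in> S. h p = 0}" if "h \<in> poly_funs L" for h
      unfolding quasi_affine_closedin[OF X] using that by (intro exI[of _ "{h}"]) simp
    from irr[OF cl[OF fg(1)] cl[OF fg(2)]] show "(\<forall>p\<in>Z. f p = 0) \<or> (\<forall>p\<in>Z. g p = 0)" using fg Z by auto
  qed
  moreover have "Z \<subseteq> A \<or> Z \<subseteq> B" if prime: ?prime and AB: "closedin (zar X) A" "closedin (zar X) B" "Z \<subseteq> A \<union> B" for A B
  proof (rule ccontr)
    assume n: "\<not> ?thesis"
    obtain T1 where T1: "T1 \<subseteq> poly_funs L" "A = {p \<in> S. \<forall>f\<in>T1. f p = 0}"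
      using AB quasi_affine_closedin[OF X] by auto
    obtain T2 where T2: "T2 \<subseteq> poly_funs L" "B = {p \<in> S. \<forall>f\<in>T2. f p = 0}"
      using AB quasi_affine_closedin[OF X] by auto
    obtain a where "a \<in> Z" "a \<notin> A" using n by blast
    then obtain f where f: "f \<in> T1" "f a \<noteq> 0" "a \<in> Z" using T1 Z by auto
    obtain b where "b \<in> Z" "b \<notin> B" using n by blast
    then obtain g where g: "g \<in> T2" "g b \<noteq> 0" "b \<in> Z" using T2 Z by auto
    have "f p * g p = 0" if "p \<in> Z" for p
    proof -
      have "p \<in> A \<or> p \<in> B" using AB(3) that by blast
      then show ?thesis using T1(2) T2(2) f(1) g(1) by auto
    qed
    moreover have "f \<in> poly_funs L" "g \<in> poly_funs L" using T1(1) T2(1) f(1) g(1) by blast+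
    ultimately have "(\<forall>p\<in>Z. f p = 0) \<or> (\<forall>p\<in>Z. g p = 0)" using prime by simp
    then show False using f g by blast
  qed
  ultimately show ?thesis unfolding irreducible_in_def S using Z by blast
qed

section \<open>Composition, restriction and transport of isomorphisms\<close>

lemma morphism_compose:
  assumes f: "morphism X Y \<phi>" and g: "morphism Y Z \<psi>" shows "morphism X Z (\<psi> \<circ> \<phi>)"
  unfolding morphism_def
proof (intro conjI allI impI)
  show "continuous_map (zar X) (zar Z) (\<psi> \<circ> \<phi>)"
    using f g unfolding morphism_def by (meson continuous_map_compose)
  fix U h assume U: "openin (zar Z) U" "h \<in> regular Z U"
  have "h \<circ> \<psi> \<in> regular Y {p \<in> points Y. \<psi> p \<in> U}" using g U unfolding morphism_def by blast
  moreover have "openin (zar Y) {p \<in> points Y. \<psi> p \<in> U}"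
    using g U unfolding morphism_def continuous_map_def points_def by blast
  ultimately have "(h \<circ> \<psi>) \<circ> \<phi> \<in> regular X {p \<in> points X. \<phi> p \<in> {p \<in> points Y. \<psi> p \<in> U}}"
    using f unfolding morphism_def by blast
  moreover have "{p \<in> points X. \<phi> p \<in> {p \<in> points Y. \<psi> p \<in> U}} = {p \<in> points X. (\<psi> \<circ> \<phi>) p \<in> U}"
    using f unfolding morphism_def continuous_map_def points_def by auto
  ultimately show "h \<circ> (\<psi> \<circ> \<phi>) \<in> regular X {p \<in> points X. (\<psi> \<circ> \<phi>) p \<in> U}" by (simp add: comp_assoc)
qed

lemma morphism_points: "morphism X Y \<phi> \<Longrightarrow> p \<in> points X \<Longrightarrow> \<phi> p \<in> points Y"
  unfolding morphism_def continuous_map_def points_def by auto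

lemma isomorphism_compose:
  assumes "isomorphism X Y \<phi>" "isomorphism Y Z \<psi>" shows "isomorphism X Z (\<psi> \<circ> \<phi>)"
proof -
  obtain \<phi>' where 1: "morphism X Y \<phi>" "morphism Y X \<phi>'" "\<forall>p\<in>points X. \<phi>' (\<phi> p) = p" "\<forall>y\<in>points Y. \<phi> (\<phi>' y) = y"
    using assms(1) unfolding isomorphism_def by blast
  obtain \<psi>' where 2: "morphism Y Z \<psi>" "morphism Z Y \<psi>'" "\<forall>p\<in>points Y. \<psi>' (\<psi> p) = p" "\<forall>y\<in>points Z. \<psi> (\<psi>' y) = y"
    using assms(2) unfolding isomorphism_def by blast
  show ?thesis unfolding isomorphism_def
    using 1 2 morphism_compose[OF 1(1) 2(1)] morphism_compose[OF 2(2) 1(2)]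
      morphism_points[OF 1(1)] morphism_points[OF 2(2)]
    by (intro conjI exI[of _ "\<phi>' \<circ> \<psi>'"]) auto
qed

lemma points_subvariety: "points (subvariety X S) = points X \<inter> S"
  by (simp add: points_def subvariety_def)

lemma morphism_subvariety:
  assumes \<phi>: "morphism X Y \<phi>" and ST: "\<And>p. p \<in> points X \<Longrightarrow> p \<in> S \<Longrightarrow> \<phi> p \<in> T"
  shows "morphism (subvariety X S) (subvariety Y T) \<phi>"
  unfolding morphism_def
proof (intro conjI allI impI)
  have c: "continuous_map (zar X) (zar Y) \<phi>" using \<phi> unfolding morphism_def by blast
  then show "continuous_map (zar (subvariety X S)) (zar (subvariety Y T)) \<phi>"
    using ST by (auto simp: subvariety_def continuous_map_in_subtopology points_def intro: continuous_map_from_subtopology)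
  fix U f assume U: "openin (zar (subvariety Y T)) U" "f \<in> regular (subvariety Y T) U"
  have "\<exists>W g. openin (zar X) W \<and> p \<in> W \<and> g \<in> regular X W \<and> (\<forall>y\<in>W \<inter> U'. (f \<circ> \<phi>) y = g y)"
    if U': "U' = {p \<in> points (subvariety X S). \<phi> p \<in> U}" and p: "p \<in> U'" for p U'
  proof -
    from p U' U obtain W g where W: "openin (zar Y) W" "\<phi> p \<in> W" "g \<in> regular Y W" "\<forall>y\<in>W \<inter> U. f y = g y"
      unfolding subvariety_def by auto
    have "openin (zar X) {p \<in> points X. \<phi> p \<in> W}" using c W unfolding continuous_map_def points_def by blast
    moreover have "g \<circ> \<phi> \<in> regular X {p \<in> points X. \<phi> p \<in> W}" using \<phi> W unfolding morphism_def by blast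
    ultimately show ?thesis using W p U'
      by (intro exI[of _ "{p \<in> points X. \<phi> p \<in> W}"] exI[of _ "g \<circ> \<phi>"]) (auto simp: points_subvariety)
  qed
  then show "f \<circ> \<phi> \<in> regular (subvariety X S) {p \<in> points (subvariety X S). \<phi> p \<in> U}"
    unfolding subvariety_def by auto
qed

lemma isomorphism_subvariety:
  assumes iso: "isomorphism X Y \<phi>" and S: "S \<subseteq> points X"
  shows "isomorphism (subvariety X S) (subvariety Y (\<phi> ` S)) \<phi>"
proof -
  obtain \<phi>' where 1: "morphism X Y \<phi>" "morphism Y X \<phi>'" "\<forall>p\<in>points X. \<phi>' (\<phi> p) = p" "\<forall>y\<in>points Y. \<phi> (\<phi>' y) = y"
    using iso unfolding isomorphism_def by blast
  show ?thesis unfolding isomorphism_def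
    by (intro conjI exI[of _ \<phi>'] morphism_subvariety 1) (use 1 S in \<open>auto simp: points_subvariety\<close>)
qed

lemma isomorphism_sym:
  assumes "isomorphism X Y \<phi>"
  obtains \<psi> where "isomorphism Y X \<psi>" "\<And>p. p \<in> points X \<Longrightarrow> \<psi> (\<phi> p) = p" "\<And>y. y \<in> points Y \<Longrightarrow> \<phi> (\<psi> y) = y"
  using assms unfolding isomorphism_def by blast

lemma morphism_irreducible_image:
  assumes "morphism X Y \<phi>" "irreducible_in (zar X) Z"
  shows "irreducible_in (zar Y) (\<phi> ` Z)"
proof -
  have c: "continuous_map (zar X) (zar Y) \<phi>" using assms(1) unfolding morphism_def by blast
  show ?thesis unfolding irreducible_in_def
  proof (intro conjI allI impI)
    show "\<phi> ` Z \<noteq> {}" using assms(2) by (auto simp: irreducible_in_def)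
    show "\<phi> ` Z \<subseteq> topspace (zar Y)"
      using assms(2) c by (auto simp: irreducible_in_def continuous_map_def)
    fix A B assume AB: "closedin (zar Y) A" "closedin (zar Y) B" "\<phi> ` Z \<subseteq> A \<union> B"
    have "closedin (zar X) {p \<in> topspace (zar X). \<phi> p \<in> A}" "closedin (zar X) {p \<in> topspace (zar X). \<phi> p \<in> B}"
      using closedin_continuous_map_preimage[OF c] AB by auto
    moreover have "Z \<subseteq> {p \<in> topspace (zar X). \<phi> p \<in> A} \<union> {p \<in> topspace (zar X). \<phi> p \<in> B}"
      using AB assms(2) by (auto simp: irreducible_in_def)
    ultimately have "Z \<subseteq> {p \<in> topspace (zar X). \<phi> p \<in> A} \<or> Z \<subseteq> {p \<in> topspace (zar X). \<phi> p \<in> B}"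
      using assms(2) unfolding irreducible_in_def by blast
    then show "\<phi> ` Z \<subseteq> A \<or> \<phi> ` Z \<subseteq> B" by auto
  qed
qed

text \<open>Carries rationality from the affine surface to the quotient. The open subset of
  \<open>Y\<close> is pulled back, and \<open>X\<close> is irreducible as the image of
  \<open>Y\<close> under the inverse.\<close>

lemma birational_isomorphism:
  assumes iso: "isomorphism X Y \<phi>" and Y: "birational Y Z"
  shows "birational X Z"
proof -
  obtain \<psi> where \<psi>: "isomorphism Y X \<psi>" "\<And>p. p \<in> points X \<Longrightarrow> \<psi> (\<phi> p) = p" "\<And>y. y \<in> points Y \<Longrightarrow> \<phi> (\<psi> y) = y"
    by (rule isomorphism_sym[OF iso]) blast
  have m: "morphism Y X \<psi>" "morphism X Y \<phi>" using \<psi>(1) iso unfolding isomorphism_def by auto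
  obtain U W \<omega> where 1: "irreducible_in (zar Y) (points Y)" "irreducible_in (zar Z) (points Z)"
    "openin (zar Y) U" "U \<noteq> {}" "openin (zar Z) W" "W \<noteq> {}" "isomorphism (subvariety Y U) (subvariety Z W) \<omega>"
    using Y unfolding birational_def by blast
  have UY: "U \<subseteq> points Y" using 1(3) openin_subset unfolding points_def by blast
  have "\<psi> ` points Y = points X"
  proof (intro set_eqI iffI)
    fix p assume "p \<in> points X"
    then show "p \<in> \<psi> ` points Y" using morphism_points[OF m(2)] \<psi>(2) by (intro image_eqI[of _ _ "\<phi> p"]) auto
  qed (use morphism_points[OF m(1)] in auto)
  then have "irreducible_in (zar X) (points X)" using morphism_irreducible_image[OF m(1) 1(1)] by simp
  moreover have "openin (zar X) {p \<in> points X. \<phi> p \<in> U}"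
    using m(2) 1(3) unfolding morphism_def continuous_map_def points_def by blast
  moreover have img: "\<phi> ` {p \<in> points X. \<phi> p \<in> U} = U"
  proof (intro set_eqI iffI)
    fix u assume u: "u \<in> U"
    then have "\<psi> u \<in> points X" "\<phi> (\<psi> u) = u" using UY \<psi>(3) morphism_points[OF m(1)] by auto
    then show "u \<in> \<phi> ` {p \<in> points X. \<phi> p \<in> U}" using u by (intro image_eqI[of _ _ "\<psi> u"]) auto
  qed auto
  moreover have "{p \<in> points X. \<phi> p \<in> U} \<noteq> {}" using img 1(4) by auto
  moreover have "isomorphism (subvariety X {p \<in> points X. \<phi> p \<in> U}) (subvariety Y U) \<phi>"
    using isomorphism_subvariety[OF iso, of "{p \<in> points X. \<phi> p \<in> U}"] img by auto
  then have "isomorphism (subvariety X {p \<in> points X. \<phi> p \<in> U}) (subvariety Z W) (\<omega> \<circ> \<phi>)"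
    using isomorphism_compose 1(7) by blast
  ultimately show ?thesis
    unfolding birational_def using 1(2,5,6) by (intro conjI exI[of _ "{p \<in> points X. \<phi> p \<in> U}"] exI[of _ W] exI[of _ "\<omega> \<circ> \<phi>"]) auto
qed

section \<open>The cone over the surface\<close>

lemma coords_in [simp]: "(\<lambda>v. v $ i) \<in> poly_funs coords"
  by (rule poly_funs.gen) (simp add: coords_def)

lemma exhaust_5:
  fixes x :: 5
  shows "x = 1 \<or> x = 2 \<or> x = 3 \<or> x = 4 \<or> x = 5"
proof (induct x)
  case (of_int z)
  then have "0 \<le> z" and "z < 5" by simp_all
  then have "z = 0 \<or> z = 1 \<or> z = 2 \<or> z = 3 \<or> z = 4" by arith
  then show ?case by auto
qed

lemma forall_5: "(\<forall>i::5. P i) \<longleftrightarrow> P 1 \<and> P 2 \<and> P 3 \<and> P 4 \<and> P 5"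
  by (metis exhaust_5)

lemma UNIV_5: "UNIV = {1, 2, 3, 4, 5::5}"
  using exhaust_5 by auto

lemma sum_5: "sum f (UNIV::5 set) = f 1 + f 2 + f 3 + f 4 + f 5"
  unfolding UNIV_5 by (simp add: ac_simps)

lemma poly_funs_line:
  assumes "f \<in> poly_funs (coords :: (complex^'n \<Rightarrow> complex) set)"
  shows "\<exists>P. \<forall>t. f (p + t *s v) = poly P t"
  using assms
proof induction
  case (const c)
  show ?case by (intro exI[of _ "[:c:]"]) simp
next
  case (gen l)
  then obtain i where "l = (\<lambda>v. v $ i)" by (auto simp: coords_def)
  then show ?case by (intro exI[of _ "[:p $ i, v $ i:]"]) simp
next
  case (add f g)
  then show ?case by (metis poly_add)
next
  case (mult f g)
  then show ?case by (metis poly_mult)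
qed

text \<open>On the line through a point with \<open>f \<noteq> 0\<close> and a point with
  \<open>g \<noteq> 0\<close> both functions become nonzero polynomials in one variable, and these
  form a domain.\<close>

lemma poly_funs_domain:
  assumes f: "f \<in> poly_funs (coords :: (complex^'n \<Rightarrow> complex) set)" and g: "g \<in> poly_funs coords"
    and 0: "\<And>x. f x * g x = 0"
  shows "(\<forall>x. f x = 0) \<or> (\<forall>x. g x = 0)"
proof (rule ccontr)
  assume "\<not> ?thesis"
  then obtain a b where ab: "f a \<noteq> 0" "g b \<noteq> 0" by blast
  obtain P where P: "\<forall>t. f (a + t *s (b - a)) = poly P t" using poly_funs_line[OF f] by blast
  obtain Q where Q: "\<forall>t. g (a + t *s (b - a)) = poly Q t" using poly_funs_line[OF g] by blast
  have "poly (P * Q) t = 0" for t using 0 P Q by (metis poly_mult)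
  then have "P * Q = 0" using poly_all_0_iff_0 by blast
  moreover have "P \<noteq> 0" using spec[OF P, of 0] ab by auto
  moreover have "Q \<noteq> 0" using spec[OF Q, of 1] ab by auto
  ultimately show False by simp
qed

lemma poly_funs_nonzero_mult:
  assumes "f \<in> poly_funs (coords :: (complex^'n \<Rightarrow> complex) set)" "g \<in> poly_funs coords"
    and "\<exists>x. f x \<noteq> 0" "\<exists>x. g x \<noteq> 0"
  shows "\<exists>x. f x * g x \<noteq> 0"
  using poly_funs_domain[OF assms(1,2)] assms(3,4) by blast

lemma poly_funs_line_differentiable:
  assumes "f \<in> poly_funs (coords :: (complex^'n \<Rightarrow> complex) set)"
  shows "(\<lambda>t. f (p + t *s v)) field_differentiable at 0"
proof -
  obtain P where "\<forall>t. f (p + t *s v) = poly P t" using poly_funs_line[OF assms] by blast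
  then have "(\<lambda>t. f (p + t *s v)) = poly P" by auto
  then show ?thesis using poly_DERIV field_differentiable_def by metis
qed

text \<open>The coordinates 1 to 5 are p, r, u, v, z of the cone. \<open>d\<close> gives the linear
  form that equals 1 on the surface, \<open>m\<close> is a coordinate for which that equation can be
  solved, and \<open>\<beta>\<close> numbers the other four.\<close>

locale segre =
  fixes s1 s2 :: complex and d :: "complex^5" and m :: 5 and \<beta> :: "4 \<Rightarrow> 5"
  assumes s1: "s1 \<noteq> 0" "s1 \<noteq> 1" and s2: "s2 \<noteq> 0" "s2 \<noteq> 1" and s12: "s1 \<noteq> s2"
    and m: "d $ m \<noteq> 0" and \<beta>: "bij_betw \<beta> UNIV (UNIV - {m})"
begin

definition "kk = 1 - s1"
definition "ll = 1 - s2"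
definition "ss = s1 * s2"
text \<open>The sum w + z; the coordinate w is eliminated in favour of
  \<open>lin x - x $ 5\<close>.\<close>

definition lin :: "complex^5 \<Rightarrow> complex" where "lin x = x $ 3 + x $ 4 + kk * x $ 1 + ll * x $ 2"
definition q1 :: "complex^5 \<Rightarrow> complex" where "q1 x = x $ 3 * x $ 4 - x $ 1 * x $ 2"
definition q2 :: "complex^5 \<Rightarrow> complex" where "q2 x = x $ 5 * (lin x - x $ 5) - ss * x $ 1 * x $ 2"
definition D :: "complex^5 \<Rightarrow> complex" where "D x = (\<Sum>i\<in>UNIV. d $ i * x $ i)"
text \<open>Multiply \<open>q2 x = 0\<close> by \<open>x $ 4\<close> and use
  \<open>q1 x = 0\<close>: the result is
  \<open>chi x * x $ 2 = x $ 5 * x $ 4 * (x $ 4 + kk * x $ 1 - x $ 5)\<close>. Where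
  \<open>chi\<close> and \<open>x $ 4\<close> are nonzero, the coordinates 1, 4, 5 thus determine
  the point of the cone.\<close>

definition chi :: "complex^5 \<Rightarrow> complex" where
  "chi x = ss * x $ 1 * x $ 4 - x $ 5 * x $ 1 - ll * x $ 5 * x $ 4"
definition cone :: "(complex^5) set" where "cone = {x. q1 x = 0 \<and> q2 x = 0}"
definition chart :: "(complex^5) set" where "chart = {x \<in> cone. x $ 4 \<noteq> 0 \<and> chi x \<noteq> 0}"

lemma nz: "kk \<noteq> 0" "ll \<noteq> 0" "ss \<noteq> 0" "kk \<noteq> ll"
  using s1 s2 s12 by (auto simp: kk_def ll_def ss_def)

lemma poly_in [simp]: "q1 \<in> poly_funs coords" "q2 \<in> poly_funs coords" "D \<in> poly_funs coords"
  "lin \<in> poly_funs coords" "chi \<in> poly_funs coords"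
  unfolding q1_def[abs_def] q2_def[abs_def] D_def[abs_def] lin_def[abs_def] chi_def[abs_def]
  by (intro poly_funs_intros coords_in)+

text \<open>Modulo \<open>q1\<close> and \<open>q2\<close>, which are monic in \<open>x$3\<close> and \<open>x$5\<close> over the ring generated by
  \<open>x$1\<close>, \<open>x$2\<close> and \<open>x$3 + x$4\<close>, every polynomial has a normal form with basis
  \<open>1, x$3, x$5, x$3 x$5\<close>.\<close>

definition base :: "(complex^5 \<Rightarrow> complex) set" where
  "base = poly_funs {\<lambda>x. x $ 1, \<lambda>x. x $ 2, \<lambda>x. x $ 3 + x $ 4}"

lemma base_gens: "(\<lambda>x. x $ 1) \<in> base" "(\<lambda>x. x $ 2) \<in> base" "(\<lambda>x. x $ 3 + x $ 4) \<in> base"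
  unfolding base_def by (rule poly_funs.gen, simp)+

lemma base_poly: "g \<in> base \<Longrightarrow> g \<in> poly_funs coords"
  unfolding base_def
  by (erule poly_funs_compose[where \<phi> = "\<lambda>x. x"]) (auto intro!: poly_funs_intros)

lemma base_cong:
  assumes "g \<in> base" "x $ 1 = y $ 1" "x $ 2 = y $ 2" "x $ 3 + x $ 4 = y $ 3 + y $ 4"
  shows "g x = g y"
  using assms(1) unfolding base_def by induction (auto simp: assms(2-))

definition nform :: "(complex^5 \<Rightarrow> complex) \<Rightarrow> bool" where
  "nform f \<longleftrightarrow> (\<exists>g0\<in>base. \<exists>g1\<in>base. \<exists>g2\<in>base. \<exists>g3\<in>base. \<exists>h1\<in>poly_funs coords. \<exists>h2\<in>poly_funs coords.
     \<forall>x. f x = g0 x + g1 x * x $ 3 + g2 x * x $ 5 + g3 x * x $ 3 * x $ 5 + q1 x * h1 x + q2 x * h2 x)"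

lemma nformI:
  assumes "g0 \<in> base" "g1 \<in> base" "g2 \<in> base" "g3 \<in> base" "h1 \<in> poly_funs coords" "h2 \<in> poly_funs coords"
    "\<And>x. f x = g0 x + g1 x * x $ 3 + g2 x * x $ 5 + g3 x * x $ 3 * x $ 5 + q1 x * h1 x + q2 x * h2 x"
  shows "nform f"
  using assms unfolding nform_def by blast

lemma nformE:
  assumes "nform f"
  obtains g0 g1 g2 g3 h1 h2 where
    "g0 \<in> base" "g1 \<in> base" "g2 \<in> base" "g3 \<in> base" "h1 \<in> poly_funs coords" "h2 \<in> poly_funs coords"
    "\<And>x. f x = g0 x + g1 x * x $ 3 + g2 x * x $ 5 + g3 x * x $ 3 * x $ 5 + q1 x * h1 x + q2 x * h2 x"
  using assms unfolding nform_def by blast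

lemma base_const: "(\<lambda>_. c) \<in> base" unfolding base_def by (rule poly_funs.const)
lemma base_add: "f \<in> base \<Longrightarrow> g \<in> base \<Longrightarrow> (\<lambda>x. f x + g x) \<in> base" unfolding base_def by (rule poly_funs.add)
lemma base_mult: "f \<in> base \<Longrightarrow> g \<in> base \<Longrightarrow> (\<lambda>x. f x * g x) \<in> base" unfolding base_def by (rule poly_funs.mult)
lemma base_uminus: "f \<in> base \<Longrightarrow> (\<lambda>x. - f x) \<in> base" unfolding base_def by (rule poly_funs_uminus)

lemma lin_base: "lin \<in> base"
  unfolding lin_def[abs_def] by (intro base_add[OF base_add] base_mult base_const base_gens)

lemma nform_base: "g \<in> base \<Longrightarrow> nform g"
  by (rule nformI[of g "\<lambda>_. 0" "\<lambda>_. 0" "\<lambda>_. 0" "\<lambda>_. 0" "\<lambda>_. 0"]) (auto intro: base_const poly_funs.const)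

lemma nform_add: assumes "nform f" "nform f'" shows "nform (\<lambda>x. f x + f' x)"
proof -
  obtain g0 g1 g2 g3 h1 h2 where 1: "g0 \<in> base" "g1 \<in> base" "g2 \<in> base" "g3 \<in> base" "h1 \<in> poly_funs coords" "h2 \<in> poly_funs coords"
    "\<And>x. f x = g0 x + g1 x * x $ 3 + g2 x * x $ 5 + g3 x * x $ 3 * x $ 5 + q1 x * h1 x + q2 x * h2 x"
    by (rule nformE[OF assms(1)]) blast
  obtain g0' g1' g2' g3' h1' h2' where 2: "g0' \<in> base" "g1' \<in> base" "g2' \<in> base" "g3' \<in> base" "h1' \<in> poly_funs coords" "h2' \<in> poly_funs coords"
    "\<And>x. f' x = g0' x + g1' x * x $ 3 + g2' x * x $ 5 + g3' x * x $ 3 * x $ 5 + q1 x * h1' x + q2 x * h2' x"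
    by (rule nformE[OF assms(2)]) blast
  show ?thesis
    by (rule nformI[OF base_add[OF 1(1) 2(1)] base_add[OF 1(2) 2(2)] base_add[OF 1(3) 2(3)] base_add[OF 1(4) 2(4)]
          poly_funs.add[OF 1(5) 2(5)] poly_funs.add[OF 1(6) 2(6)]])
       (simp only: 1(7) 2(7), algebra)
qed

lemma nform_base_mult: assumes "g \<in> base" "nform f" shows "nform (\<lambda>x. g x * f x)"
proof -
  obtain g0 g1 g2 g3 h1 h2 where 1: "g0 \<in> base" "g1 \<in> base" "g2 \<in> base" "g3 \<in> base" "h1 \<in> poly_funs coords" "h2 \<in> poly_funs coords"
    "\<And>x. f x = g0 x + g1 x * x $ 3 + g2 x * x $ 5 + g3 x * x $ 3 * x $ 5 + q1 x * h1 x + q2 x * h2 x"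
    by (rule nformE[OF assms(2)]) blast
  note g = assms(1)
  show ?thesis
    by (rule nformI[OF base_mult[OF g 1(1)] base_mult[OF g 1(2)] base_mult[OF g 1(3)] base_mult[OF g 1(4)]
          poly_funs.mult[OF base_poly[OF g] 1(5)] poly_funs.mult[OF base_poly[OF g] 1(6)]])
       (simp only: 1(7), algebra)
qed

text \<open>Modulo \<open>q1\<close>, \<open>x $ 3\<close> is a root of T^2 - e T +
  \<open>x $ 1 * x $ 2\<close> with e = \<open>x $ 3 + x $ 4\<close>, so its square is reduced over
  \<open>base\<close>.\<close>

lemma nform_mult_3: assumes "nform f" shows "nform (\<lambda>x. x $ 3 * f x)"
proof -
  obtain g0 g1 g2 g3 h1 h2 where 1: "g0 \<in> base" "g1 \<in> base" "g2 \<in> base" "g3 \<in> base" "h1 \<in> poly_funs coords" "h2 \<in> poly_funs coords"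
    "\<And>x. f x = g0 x + g1 x * x $ 3 + g2 x * x $ 5 + g3 x * x $ 3 * x $ 5 + q1 x * h1 x + q2 x * h2 x"
    by (rule nformE[OF assms(1)]) blast
  let ?pr = "\<lambda>x::complex^5. x $ 1 * x $ 2" and ?e = "\<lambda>x::complex^5. x $ 3 + x $ 4"
  show ?thesis
  proof (rule nformI)
    show "(\<lambda>x. - (g1 x * ?pr x)) \<in> base" "(\<lambda>x. g0 x + g1 x * ?e x) \<in> base"
      "(\<lambda>x. - (g3 x * ?pr x)) \<in> base" "(\<lambda>x. g2 x + g3 x * ?e x) \<in> base"
      by (intro base_add base_mult base_uminus 1 base_gens)+
    show "(\<lambda>x. x $ 3 * h1 x + (- g1 x - g3 x * x $ 5)) \<in> poly_funs coords" "(\<lambda>x. x $ 3 * h2 x) \<in> poly_funs coords"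
      by (intro poly_funs_intros coords_in 1 base_poly)+
  qed (simp only: 1(7) q1_def, algebra)
qed

text \<open>Likewise \<open>x $ 5\<close> is, modulo \<open>q2\<close>, a root of T^2 -
  \<open>lin x\<close> T + \<open>ss * x $ 1 * x $ 2\<close>, and \<open>lin\<close> belongs to
  \<open>base\<close>.\<close>

lemma nform_mult_5: assumes "nform f" shows "nform (\<lambda>x. x $ 5 * f x)"
proof -
  obtain g0 g1 g2 g3 h1 h2 where 1: "g0 \<in> base" "g1 \<in> base" "g2 \<in> base" "g3 \<in> base" "h1 \<in> poly_funs coords" "h2 \<in> poly_funs coords"
    "\<And>x. f x = g0 x + g1 x * x $ 3 + g2 x * x $ 5 + g3 x * x $ 3 * x $ 5 + q1 x * h1 x + q2 x * h2 x"
    by (rule nformE[OF assms(1)]) blast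
  let ?pr = "\<lambda>x::complex^5. ss * x $ 1 * x $ 2"
  show ?thesis
  proof (rule nformI)
    show "(\<lambda>x. - (g2 x * ?pr x)) \<in> base" "(\<lambda>x. - (g3 x * ?pr x)) \<in> base"
      "(\<lambda>x. g0 x + g2 x * lin x) \<in> base" "(\<lambda>x. g1 x + g3 x * lin x) \<in> base"
      by (intro base_add base_mult base_uminus 1 base_gens base_const lin_base)+
    show "(\<lambda>x. x $ 5 * h1 x) \<in> poly_funs coords" "(\<lambda>x. x $ 5 * h2 x + (- g2 x - g3 x * x $ 3)) \<in> poly_funs coords"
      by (intro poly_funs_intros coords_in 1 base_poly)+
  qed (simp only: 1(7) q2_def, algebra)
qed

lemma nform_q: 
  assumes "h1 \<in> poly_funs coords" "h2 \<in> poly_funs coords" shows "nform (\<lambda>x. q1 x * h1 x + q2 x * h2 x)"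
  by (rule nformI[OF base_const[of 0] base_const[of 0] base_const[of 0] base_const[of 0] assms]) simp

lemma nform_mult: assumes "nform f" "f' \<in> poly_funs coords" "nform f'" shows "nform (\<lambda>x. f x * f' x)"
proof -
  obtain g0 g1 g2 g3 h1 h2 where 1: "g0 \<in> base" "g1 \<in> base" "g2 \<in> base" "g3 \<in> base" "h1 \<in> poly_funs coords" "h2 \<in> poly_funs coords"
    "\<And>x. f x = g0 x + g1 x * x $ 3 + g2 x * x $ 5 + g3 x * x $ 3 * x $ 5 + q1 x * h1 x + q2 x * h2 x"
    by (rule nformE[OF assms(1)]) blast
  have "nform (\<lambda>x. g0 x * f' x + g1 x * (x $ 3 * f' x) + g2 x * (x $ 5 * f' x) + g3 x * (x $ 3 * (x $ 5 * f' x))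
      + (q1 x * (h1 x * f' x) + q2 x * (h2 x * f' x)))"
    by (intro nform_add nform_base_mult nform_q nform_mult_3 nform_mult_5 1 assms poly_funs.mult)
  moreover have "(\<lambda>x. g0 x * f' x + g1 x * (x $ 3 * f' x) + g2 x * (x $ 5 * f' x) + g3 x * (x $ 3 * (x $ 5 * f' x))
      + (q1 x * (h1 x * f' x) + q2 x * (h2 x * f' x))) = (\<lambda>x. f x * f' x)"
    by (rule ext) (simp only: 1(7), algebra)
  ultimately show ?thesis by simp
qed

lemma nform_poly: "f \<in> poly_funs coords \<Longrightarrow> nform f"
proof (induction rule: poly_funs.induct)
  case (const c)
  show ?case by (rule nform_base[OF base_const])
next
  case (gen l)
  then obtain i where l: "l = (\<lambda>x. x $ i)" by (auto simp: coords_def)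
  have 3: "nform (\<lambda>x. x $ 3)" using nform_mult_3[OF nform_base[OF base_const[of 1]]] by simp
  have 5: "nform (\<lambda>x. x $ 5)" using nform_mult_5[OF nform_base[OF base_const[of 1]]] by simp
  have 4: "nform (\<lambda>x. x $ 4)"
    using nform_add[OF nform_base[OF base_gens(3)] nform_base_mult[OF base_const[of "-1"] 3]] by simp
  have "\<forall>i. nform (\<lambda>x. x $ i)"
    unfolding forall_5 using 3 4 5 nform_base[OF base_gens(1)] nform_base[OF base_gens(2)] by simp
  then show ?case unfolding l by blast
qed (auto intro: nform_add nform_mult)

lemma base_mult_zero:
  assumes g: "g \<in> base" and N: "N \<in> poly_funs coords" "N a \<noteq> 0" and 0: "\<And>x. N x \<noteq> 0 \<Longrightarrow> g x = 0"
  shows "g x = 0"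
proof -
  have "(\<forall>x. g x = 0) \<or> (\<forall>x. N x = 0)"
    by (rule poly_funs_domain[OF base_poly[OF g] N(1)]) (use 0 in auto)
  then show ?thesis using N(2) by blast
qed

text \<open>A condition on the base values alone. The factors say in order that \<open>x $ 1\<close>
  and \<open>x $ 2\<close> are nonzero, that the quadratic equations for \<open>x $ 3\<close> and
  \<open>x $ 5\<close> have distinct roots, and that the two ways in which \<open>chi\<close> could
  vanish on the cone are excluded.\<close>

definition disc :: "complex^5 \<Rightarrow> complex" where
  "disc x = (let e = x $ 3 + x $ 4 in
     x $ 1 * x $ 2 * (e ^ 2 - 4 * (x $ 1 * x $ 2)) * (lin x ^ 2 - 4 * (ss * x $ 1 * x $ 2)) *
     (x $ 1 + e + x $ 2) * (kk ^ 2 * x $ 1 + kk * ll * e + ll ^ 2 * x $ 2))"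

lemma disc_poly: "disc \<in> poly_funs coords"
  unfolding disc_def[abs_def] Let_def by (intro poly_funs_intros coords_in poly_in)

lemma disc_nz: "\<exists>a. disc a \<noteq> 0"
  unfolding disc_def Let_def
proof (intro poly_funs_nonzero_mult poly_funs_intros coords_in poly_in)
  show "\<exists>x::complex^5. x $ 1 \<noteq> 0" "\<exists>x::complex^5. x $ 2 \<noteq> 0"
    by (intro exI[of _ "axis 1 1"], simp add: axis_def) (intro exI[of _ "axis 2 1"], simp add: axis_def)
  show "\<exists>x::complex^5. (x $ 3 + x $ 4)\<^sup>2 - 4 * (x $ 1 * x $ 2) \<noteq> 0" "\<exists>x. (lin x)\<^sup>2 - 4 * (ss * x $ 1 * x $ 2) \<noteq> 0"
    by (intro exI[of _ "axis 3 1"], simp add: axis_def lin_def)+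
  show "\<exists>x::complex^5. x $ 1 + (x $ 3 + x $ 4) + x $ 2 \<noteq> 0"
    "\<exists>x::complex^5. kk\<^sup>2 * x $ 1 + kk * ll * (x $ 3 + x $ 4) + ll\<^sup>2 * x $ 2 \<noteq> 0"
    by (intro exI[of _ "axis 1 1"], simp add: axis_def nz)+
qed

text \<open>On the cone, \<open>chi x = 0\<close> forces \<open>x$5 = x$4 + kk x$1\<close> and then a quadratic equation for
  \<open>x$4\<close>, which splits because \<open>1 + kk ll - ss = kk + ll\<close>.\<close>

lemma chi_nz:
  assumes "x \<in> cone" "disc x \<noteq> 0" shows "x $ 4 \<noteq> 0" "chi x \<noteq> 0"
proof -
  define p r u v z where "p = x $ 1" and "r = x $ 2" and "u = x $ 3" and "v = x $ 4" and "z = x $ 5"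
  note defs = p_def[symmetric] r_def[symmetric] u_def[symmetric] v_def[symmetric] z_def[symmetric]
  have q: "u * v = p * r" "z * (u + v + kk * p + ll * r - z) = ss * p * r"
    using assms(1) by (simp_all add: cone_def q1_def q2_def lin_def defs)
  have n: "p \<noteq> 0" "r \<noteq> 0" "p + (u + v) + r \<noteq> 0" "kk ^ 2 * p + kk * ll * (u + v) + ll ^ 2 * r \<noteq> 0"
    using assms(2) by (auto simp: disc_def Let_def defs)
  have v: "v \<noteq> 0" using q n by auto
  then show "x $ 4 \<noteq> 0" by (simp add: v_def)
  have zz: "z \<noteq> 0" using q n nz by auto
  show "chi x \<noteq> 0"
  proof
    assume "chi x = 0"
    then have c: "ss * p * v - z * p - ll * z * v = 0" by (simp add: chi_def defs)
    have "z * v * (v + kk * p - z) = r * (ss * p * v - z * p - ll * z * v)" using q by algebra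
    then have z: "z = v + kk * p" using c v zz by simp
    have sk: "ss = 1 + kk * ll - kk - ll" by (simp add: ss_def kk_def ll_def algebra_simps)
    have "(ll * v + kk * p) * (v + p) = 0" using c unfolding z sk by algebra
    then consider "v = - p" | "ll * v = - kk * p" by (auto simp: eq_neg_iff_add_eq_0)
    then show False
    proof cases
      case 1
      then have "p * (p + (u + v) + r) = 0" using q by algebra
      then show False using n by simp
    next
      case 2
      then have "p * (kk ^ 2 * p + kk * ll * (u + v) + ll ^ 2 * r) = 0" using q by algebra
      then show False using n by simp
    qed
  qed
qed

lemma quadratic_roots:
  fixes e f :: complex
  assumes "e ^ 2 - 4 * f \<noteq> 0"
  obtains a b where "a \<noteq> b" "a * (e - a) = f" "b * (e - b) = f"
proof -
  define w where "w = csqrt (e ^ 2 - 4 * f)"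
  have w2: "w ^ 2 = e ^ 2 - 4 * f" by (simp add: w_def)
  then have w: "w \<noteq> 0" using assms by auto
  have "(e + w) / 2 * (e - (e + w) / 2) = f" "(e - w) / 2 * (e - (e - w) / 2) = f"
    using w2 by (simp_all add: field_simps power2_eq_square)
  moreover have "(e + w) / 2 \<noteq> (e - w) / 2" using w by (simp add: field_simps)
  ultimately show ?thesis by (rule that[rotated])
qed

lemma bilinear_interpolation:
  fixes g0 g1 g2 g3 :: complex
  assumes "a \<noteq> a'" "b \<noteq> b'"
    and "g0 + g1 * a + g2 * b + g3 * a * b = 0" "g0 + g1 * a' + g2 * b + g3 * a' * b = 0"
    and "g0 + g1 * a + g2 * b' + g3 * a * b' = 0" "g0 + g1 * a' + g2 * b' + g3 * a' * b' = 0"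
  shows "g0 = 0 \<and> g1 = 0 \<and> g2 = 0 \<and> g3 = 0"
proof -
  have "(a - a') * (g1 + g3 * b) = 0" using assms(3,4) by algebra
  moreover have "(a - a') * (g1 + g3 * b') = 0" using assms(5,6) by algebra
  ultimately have "(a - a') * (g1 + g3 * b) = 0" "(a - a') * (g1 + g3 * b') = 0" .
  then have 1: "g1 + g3 * b = 0" "g1 + g3 * b' = 0" using assms by auto
  then have "(b - b') * g3 = 0" by algebra
  then have 3: "g3 = 0" using assms by simp
  then have g1: "g1 = 0" using 1 by simp
  then have "(b - b') * g2 = 0" using 3 assms(3,5) by algebra
  then have "g2 = 0" using assms by simp
  then show ?thesis using 3 g1 assms(3) by simp
qed

text \<open>Over base values with \<open>disc\<close> nonzero the cone has four points, from
  independent choices of a root for \<open>x $ 3\<close> and for \<open>x $ 5\<close>, and all four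
  lie in the chart. Vanishing there kills the four coefficients of the normal form, first where
  \<open>disc\<close> is nonzero and then everywhere.\<close>

lemma ideal_of_chart:
  assumes f: "f \<in> poly_funs coords" and 0: "\<And>x. x \<in> chart \<Longrightarrow> f x = 0"
  shows "\<exists>h1\<in>poly_funs coords. \<exists>h2\<in>poly_funs coords. \<forall>x. f x = q1 x * h1 x + q2 x * h2 x"
proof -
  obtain g0 g1 g2 g3 h1 h2 where 1: "g0 \<in> base" "g1 \<in> base" "g2 \<in> base" "g3 \<in> base" "h1 \<in> poly_funs coords" "h2 \<in> poly_funs coords"
    "\<And>x. f x = g0 x + g1 x * x $ 3 + g2 x * x $ 5 + g3 x * x $ 3 * x $ 5 + q1 x * h1 x + q2 x * h2 x"
    by (rule nformE[OF nform_poly[OF f]]) blast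
  have g: "g0 x = 0 \<and> g1 x = 0 \<and> g2 x = 0 \<and> g3 x = 0" if x: "disc x \<noteq> 0" for x
  proof -
    define e where "e = x $ 3 + x $ 4"
    have "e ^ 2 - 4 * (x $ 1 * x $ 2) \<noteq> 0" using x by (auto simp: disc_def Let_def e_def)
    then obtain a a' where a: "a \<noteq> a'" "a * (e - a) = x $ 1 * x $ 2" "a' * (e - a') = x $ 1 * x $ 2"
      by (rule quadratic_roots)
    have "lin x ^ 2 - 4 * (ss * x $ 1 * x $ 2) \<noteq> 0" using x by (auto simp: disc_def Let_def)
    then obtain b b' where b: "b \<noteq> b'" "b * (lin x - b) = ss * x $ 1 * x $ 2" "b' * (lin x - b') = ss * x $ 1 * x $ 2"
      by (rule quadratic_roots)
    have eq: "g0 x + g1 x * A + g2 x * B + g3 x * A * B = 0"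
      if A: "A * (e - A) = x $ 1 * x $ 2" and B: "B * (lin x - B) = ss * x $ 1 * x $ 2" for A B
    proof -
      \<comment> \<open>\<open>y\<close> keeps the base values of \<open>x\<close> and takes the
        chosen roots as coordinates 3 and 5, so the coefficients \<open>g0\<close> to
        \<open>g3\<close> are the same at \<open>y\<close> as at \<open>x\<close>.\<close>
      define y :: "complex^5" where
        "y = (\<chi> i. if i = 1 then x $ 1 else if i = 2 then x $ 2 else if i = 3 then A else if i = 4 then e - A else B)"
      have y: "y $ 1 = x $ 1" "y $ 2 = x $ 2" "y $ 3 = A" "y $ 4 = e - A" "y $ 5 = B" by (simp_all add: y_def)
      have ly: "lin y = lin x" by (simp add: lin_def y e_def)
      have yc: "y \<in> cone" using A B by (simp add: cone_def q1_def q2_def y ly)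
      moreover have "disc y = disc x" using ly by (simp add: disc_def y e_def)
      ultimately have "y \<in> chart" using chi_nz[of y] x by (simp add: chart_def)
      then have "f y = 0" by (rule 0)
      moreover have bc: "g y = g x" if "g \<in> base" for g
        by (rule base_cong[OF that]) (simp_all add: y e_def)
      note bc[OF 1(1)] bc[OF 1(2)] bc[OF 1(3)] bc[OF 1(4)]
      ultimately show ?thesis using 1(7)[of y] yc by (simp add: y cone_def)
    qed
    show ?thesis
      by (rule bilinear_interpolation[OF a(1) b(1)]) (intro eq a b)+
  qed
  obtain w where w: "disc w \<noteq> 0" using disc_nz by blast
  have "g0 x = 0" "g1 x = 0" "g2 x = 0" "g3 x = 0" for x
    using base_mult_zero[OF 1(1) disc_poly w] base_mult_zero[OF 1(2) disc_poly w]
      base_mult_zero[OF 1(3) disc_poly w] base_mult_zero[OF 1(4) disc_poly w] g by blast+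
  then have "\<forall>x. f x = q1 x * h1 x + q2 x * h2 x" using 1(7) by simp
  then show ?thesis using 1(5,6) by blast
qed

section \<open>The affine surface\<close>

text \<open>The inverse of \<open>proj\<close> on the hyperplane \<open>D = 1\<close>, with the
  coordinate \<open>m\<close> solved for.\<close>

definition emb :: "complex^4 \<Rightarrow> complex^5" where
  "emb y = (\<chi> i. if i = m then (1 - (\<Sum>j\<in>UNIV. d $ \<beta> j * y $ j)) / d $ m else y $ inv \<beta> i)"

definition proj :: "complex^5 \<Rightarrow> complex^4" where
  "proj x = (\<chi> j. x $ \<beta> j)"

text \<open>The linear part of \<open>emb\<close>; it parametrizes the directions with
  \<open>D = 0\<close>.\<close>

definition emb0 :: "complex^4 \<Rightarrow> complex^5" where
  "emb0 y = (\<chi> i. if i = m then - (\<Sum>j\<in>UNIV. d $ \<beta> j * y $ j) / d $ m else y $ inv \<beta> i)"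

lemma \<beta>': "inj \<beta>" "\<beta> j \<noteq> m" "i \<noteq> m \<Longrightarrow> \<beta> (inv \<beta> i) = i" "inv \<beta> (\<beta> j) = j"
  using \<beta> by (auto simp: bij_betw_def f_inv_into_f inv_f_f)

lemma D_split: "D x = d $ m * x $ m + (\<Sum>j\<in>UNIV. d $ \<beta> j * x $ \<beta> j)"
proof -
  have "D x = d $ m * x $ m + (\<Sum>i\<in>UNIV - {m}. d $ i * x $ i)"
    unfolding D_def by (rule sum.remove) auto
  also have "(\<Sum>i\<in>UNIV - {m}. d $ i * x $ i) = (\<Sum>j\<in>UNIV. d $ \<beta> j * x $ \<beta> j)"
    by (rule sum.reindex_bij_betw[OF \<beta>, symmetric])
  finally show ?thesis .
qed

lemma emb_nth: "emb y $ \<beta> j = y $ j" "emb y $ m = (1 - (\<Sum>j\<in>UNIV. d $ \<beta> j * y $ j)) / d $ m"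
  using \<beta>' by (auto simp: emb_def)

lemma D_emb: "D (emb y) = 1"
  unfolding D_split emb_nth using m by simp

lemma proj_emb: "proj (emb y) = y"
  by (simp add: vec_eq_iff proj_def emb_nth)

lemma emb_proj: assumes "D x = 1" shows "emb (proj x) = x"
proof -
  have "emb (proj x) $ i = x $ i" for i
  proof (cases "i = m")
    case True
    have "(1 - (\<Sum>j\<in>UNIV. d $ \<beta> j * x $ \<beta> j)) = d $ m * x $ m" using assms D_split[of x] by (simp add: algebra_simps)
    then show ?thesis using m True by (simp add: emb_nth(2) proj_def)
  next
    case False
    then obtain j where "i = \<beta> j" using \<beta>' by metis
    then show ?thesis by (simp add: emb_nth(1) proj_def)
  qed
  then show ?thesis by (simp add: vec_eq_iff)
qed

lemma emb_line: "emb (y + t *s v) = emb y + t *s emb0 v"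
  by (simp add: vec_eq_iff emb_def emb0_def sum.distrib sum_distrib_left algebra_simps diff_divide_distrib add_divide_distrib)

lemma emb0_surj: assumes "D x = 0" shows "emb0 (proj x) = x"
proof -
  have "emb0 (proj x) $ i = x $ i" for i
  proof (cases "i = m")
    case True
    have "- (\<Sum>j\<in>UNIV. d $ \<beta> j * x $ \<beta> j) = d $ m * x $ m" using assms D_split[of x] by (simp add: algebra_simps neg_eq_iff_add_eq_0)
    then show ?thesis using m True by (simp add: emb0_def proj_def)
  next
    case False
    then show ?thesis using \<beta>' by (simp add: emb0_def proj_def)
  qed
  then show ?thesis by (simp add: vec_eq_iff)
qed

lemma emb_poly: "(\<lambda>y. emb y $ i) \<in> poly_funs coords"
proof (cases "i = m")
  case True
  have "(\<lambda>y. (1 - (\<Sum>j\<in>UNIV. d $ \<beta> j * y $ j)) * (1 / d $ m)) \<in> poly_funs coords"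
    by (intro poly_funs_intros coords_in)
  then show ?thesis by (simp add: emb_def True)
qed (simp add: emb_def)

lemma poly_emb: "f \<in> poly_funs coords \<Longrightarrow> (\<lambda>y. f (emb y)) \<in> poly_funs coords"
  by (erule poly_funs_compose) (auto simp: coords_def intro: emb_poly[unfolded coords_def])

text \<open>The power of \<open>D\<close> clears the denominators that the substitution of
  \<open>x / D\<close> creates.\<close>

lemma homogenize:
  assumes "f \<in> poly_funs coords"
  shows "\<exists>n. \<exists>G\<in>poly_funs coords. \<forall>x. D x \<noteq> 0 \<longrightarrow> G x = D x ^ n * f (proj ((1 / D x) *s x))"
  using assms
proof induction
  case (const c)
  show ?case by (intro exI[of _ 0] bexI[of _ "\<lambda>_. c"]) (auto intro: poly_funs.const)
next
  case (gen l)
  then obtain i where "l = (\<lambda>x. x $ i)" by (auto simp: coords_def)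
  then show ?case by (intro exI[of _ 1] bexI[of _ "\<lambda>x. x $ \<beta> i"]) (auto simp: proj_def)
next
  case (add f g)
  then obtain n1 n2 F1 F2 where 1: "F1 \<in> poly_funs coords" "F2 \<in> poly_funs coords"
    "\<forall>x. D x \<noteq> 0 \<longrightarrow> F1 x = D x ^ n1 * f (proj ((1 / D x) *s x))"
    "\<forall>x. D x \<noteq> 0 \<longrightarrow> F2 x = D x ^ n2 * g (proj ((1 / D x) *s x))" by blast
  then show ?case
    by (intro exI[of _ "n1 + n2"] bexI[of _ "\<lambda>x. D x ^ n2 * F1 x + D x ^ n1 * F2 x"])
       (auto intro!: poly_funs_intros simp: power_add algebra_simps)
next
  case (mult f g)
  then obtain n1 n2 F1 F2 where 1: "F1 \<in> poly_funs coords" "F2 \<in> poly_funs coords"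
    "\<forall>x. D x \<noteq> 0 \<longrightarrow> F1 x = D x ^ n1 * f (proj ((1 / D x) *s x))"
    "\<forall>x. D x \<noteq> 0 \<longrightarrow> F2 x = D x ^ n2 * g (proj ((1 / D x) *s x))" by blast
  then show ?case
    by (intro exI[of _ "n1 + n2"] bexI[of _ "\<lambda>x. F1 x * F2 x"])
       (auto intro!: poly_funs_intros simp: power_add algebra_simps)
qed

lemma D_scale: "D (t *s x) = t * D x"
  by (simp add: D_def sum_distrib_left mult_ac)

lemma chart_scale: "x \<in> chart \<Longrightarrow> t \<noteq> 0 \<Longrightarrow> t *s x \<in> chart"
proof -
  have "q1 (t *s x) = t ^ 2 * q1 x" "q2 (t *s x) = t ^ 2 * q2 x" "chi (t *s x) = t ^ 2 * chi x"
    by (simp_all add: q1_def q2_def chi_def lin_def power2_eq_square algebra_simps)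
  then show "x \<in> chart \<Longrightarrow> t \<noteq> 0 \<Longrightarrow> t *s x \<in> chart" by (simp add: chart_def cone_def)
qed

definition Y :: "(complex^4) set" where "Y = {y. emb y \<in> cone}"
definition chartY :: "(complex^4) set" where "chartY = {y. emb y \<in> chart}"

text \<open>The extra factor \<open>D\<close> makes the homogenized polynomial vanish also at the
  chart points with \<open>D = 0\<close>. The result for the cone then applies, and on
  \<open>D = 1\<close> the factor disappears again.\<close>

lemma ideal_of_chartY:
  assumes f: "f \<in> poly_funs coords" and 0: "\<And>y. y \<in> chartY \<Longrightarrow> f y = 0"
  shows "\<exists>h1\<in>poly_funs coords. \<exists>h2\<in>poly_funs coords. \<forall>y. f y = q1 (emb y) * h1 y + q2 (emb y) * h2 y"
proof -
  obtain n G where G: "G \<in> poly_funs coords" "\<And>x. D x \<noteq> 0 \<Longrightarrow> G x = D x ^ n * f (proj ((1 / D x) *s x))"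
    using homogenize[OF f] by blast
  have "D x * G x = 0" if x: "x \<in> chart" for x
  proof (cases "D x = 0")
    case False
    have "(1 / D x) *s x \<in> chart" "D ((1 / D x) *s x) = 1"
      using chart_scale[OF x, of "1 / D x"] False by (simp_all add: D_scale)
    then have "f (proj ((1 / D x) *s x)) = 0" by (intro 0) (simp add: chartY_def emb_proj)
    then show ?thesis using G(2)[OF False] by simp
  qed simp
  then obtain h1 h2 where h: "h1 \<in> poly_funs coords" "h2 \<in> poly_funs coords" "\<forall>x. D x * G x = q1 x * h1 x + q2 x * h2 x"
    using ideal_of_chart[OF poly_funs.mult[OF poly_in(3) G(1)]] by blast
  have "f y = q1 (emb y) * h1 (emb y) + q2 (emb y) * h2 (emb y)" for y
    using spec[OF h(3), of "emb y"] G(2)[of "emb y"] by (simp add: D_emb proj_emb)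
  then show ?thesis by (intro bexI[OF _ poly_emb[OF h(1)]] bexI[OF _ poly_emb[OF h(2)]]) auto
qed


section \<open>Rational parametrization of the surface\<close>

definition parX :: "complex^2 \<Rightarrow> complex" where "parX w = ss * w $ 1 - w $ 2 * w $ 1 - ll * w $ 2"
definition parY :: "complex^2 \<Rightarrow> complex" where "parY w = w $ 2 * (1 + kk * w $ 1 - w $ 2)"

text \<open>For \<open>x $ 4 = 1\<close>, \<open>x $ 1 = w $ 1\<close>, \<open>x $ 5 = w $ 2\<close>
  the value of \<open>chi\<close> is \<open>parX w\<close>, and the equation for
  \<open>x $ 2\<close> reads \<open>x $ 2 * parX w = parY w\<close>; moreover
  \<open>x $ 3 = x $ 1 * x $ 2\<close>. The point is multiplied by \<open>parX w\<close> to clear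
  the denominator.\<close>

definition par :: "complex^2 \<Rightarrow> complex^5" where
  "par w = (\<chi> i. if i = 1 then w $ 1 * parX w else if i = 2 then parY w else if i = 3 then w $ 1 * parY w
     else if i = 4 then parX w else w $ 2 * parX w)"

lemma par_nth [simp]: "par w $ 1 = w $ 1 * parX w" "par w $ 2 = parY w" "par w $ 3 = w $ 1 * parY w"
  "par w $ 4 = parX w" "par w $ 5 = w $ 2 * parX w"
  by (simp_all add: par_def)

lemma parXY_poly: "parX \<in> poly_funs coords" "parY \<in> poly_funs coords"
  unfolding parX_def[abs_def] parY_def[abs_def] by (intro poly_funs_intros coords_in)+

lemma par_poly: "(\<lambda>w. par w $ i) \<in> poly_funs coords"
proof -
  have "\<forall>i. (\<lambda>w. par w $ i) \<in> poly_funs coords"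
    unfolding forall_5 par_nth by (intro conjI poly_funs_intros coords_in parXY_poly)
  then show ?thesis by blast
qed

lemma poly_par: "f \<in> poly_funs coords \<Longrightarrow> (\<lambda>w. f (par w)) \<in> poly_funs coords"
  by (erule poly_funs_compose) (auto simp: coords_def intro: par_poly[unfolded coords_def])

lemma par_cone: "par w \<in> cone"
proof -
  have "q1 (par w) = 0" by (simp add: q1_def)
  moreover have "q2 (par w) = 0" unfolding q2_def lin_def par_nth parX_def parY_def by algebra
  ultimately show ?thesis by (simp add: cone_def)
qed

lemma chi_par: "chi (par w) = parX w ^ 3"
  unfolding chi_def par_nth parX_def by algebra

definition dpar :: "complex^2 \<Rightarrow> complex" where "dpar w = parX w * D (par w)"

definition dom :: "(complex^2) set" where "dom = {w. dpar w \<noteq> 0}"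

definition toY :: "complex^2 \<Rightarrow> complex^4" where "toY w = proj ((1 / D (par w)) *s par w)"

definition fromY :: "complex^4 \<Rightarrow> complex^2" where
  "fromY y = (\<chi> i. (if i = 1 then emb y $ 1 else emb y $ 5) / emb y $ 4)"

lemma dpar_poly: "dpar \<in> poly_funs coords"
  unfolding dpar_def[abs_def] by (intro poly_funs_intros parXY_poly poly_par poly_in)

lemma emb_toY: "w \<in> dom \<Longrightarrow> emb (toY w) = (1 / D (par w)) *s par w"
  unfolding toY_def by (rule emb_proj) (simp add: D_scale dom_def dpar_def)

lemma toY_chart: assumes "w \<in> dom" shows "toY w \<in> chartY"
proof -
  have "par w \<in> chart" using assms par_cone chi_par by (simp add: chart_def dom_def dpar_def)
  then have "(1 / D (par w)) *s par w \<in> chart" using assms by (intro chart_scale) (auto simp: dom_def dpar_def)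
  then show ?thesis using emb_toY[OF assms] by (simp add: chartY_def)
qed

lemma fromY_toY: assumes "w \<in> dom" shows "fromY (toY w) = w"
  using assms emb_toY[OF assms] by (simp add: fromY_def vec_eq_iff forall_2 dom_def dpar_def)

lemma par_ratio:
  assumes "x \<in> chart" and w: "w $ 1 = x $ 1 / x $ 4" "w $ 2 = x $ 5 / x $ 4"
  shows "parX w = chi x / x $ 4 ^ 2" "par w = (chi x / x $ 4 ^ 3) *s x"
proof -
  define p r u v z where "p = x $ 1" and "r = x $ 2" and "u = x $ 3" and "v = x $ 4" and "z = x $ 5"
  note defs = p_def[symmetric] r_def[symmetric] u_def[symmetric] v_def[symmetric] z_def[symmetric]
  have q: "u * v = p * r" "z * (u + v + kk * p + ll * r - z) = ss * p * r"
    using assms(1) by (simp_all add: chart_def cone_def q1_def q2_def lin_def defs)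
  have v: "v \<noteq> 0" using assms(1) by (simp add: chart_def defs)
  have wp: "w $ 1 * v = p" "w $ 2 * v = z" using w v by (simp_all add: defs)
  have X: "parX w * v ^ 2 = chi x" unfolding parX_def chi_def defs wp[symmetric] by (simp add: power2_eq_square algebra_simps)
  then show "parX w = chi x / x $ 4 ^ 2" using v by (simp add: defs field_simps)
  have chi: "chi x = ss * p * v - z * p - ll * z * v" by (simp add: chi_def defs)
  have yv: "parY w * v ^ 2 = z * (v + kk * p - z)" unfolding parY_def wp[symmetric] by (simp add: power2_eq_square algebra_simps)
  have zv: "z * (v + kk * p - z) * v = chi x * r" using q unfolding chi by algebra
  have "parY w * v ^ 3 = parY w * v ^ 2 * v" by (simp add: power2_eq_square power3_eq_cube)
  then have Yr: "parY w * v ^ 3 = chi x * r" unfolding yv zv .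
  have Xv: "parX w * v ^ 3 = chi x * v"
    using arg_cong[OF X, of "\<lambda>t. t * v"] by (simp add: power2_eq_square power3_eq_cube mult_ac)
  have "w $ 1 * parX w * v ^ 3 = w $ 1 * (parX w * v ^ 3)" by simp
  also have "\<dots> = chi x * (w $ 1 * v)" unfolding Xv by simp
  finally have "w $ 1 * parX w * v ^ 3 = chi x * p" unfolding wp .
  \<comment> \<open>The additional factor \<open>v\<close> brings in \<open>u * v = p * r\<close>
    and is cancelled afterwards.\<close>
  moreover have "w $ 1 * parY w * v ^ 3 * v = chi x * u * v"
  proof -
    have "w $ 1 * parY w * v ^ 3 * v = (w $ 1 * v) * (parY w * v ^ 3)" by (simp only: mult_ac)
    also have "\<dots> = chi x * (p * r)" unfolding wp Yr by simp
    finally show ?thesis unfolding q(1)[symmetric] by (simp only: mult.assoc)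
  qed
  then have "w $ 1 * parY w * v ^ 3 = chi x * u" using v by simp
  moreover have "w $ 2 * parX w * v ^ 3 = chi x * z"
  proof -
    have "w $ 2 * parX w * v ^ 3 = w $ 2 * (parX w * v ^ 3)" by simp
    also have "\<dots> = chi x * (w $ 2 * v)" unfolding Xv by simp
    finally show ?thesis unfolding wp .
  qed
  ultimately have "\<forall>i. par w $ i * v ^ 3 = chi x * x $ i"
    unfolding forall_5 par_nth defs using Yr Xv by simp
  then show "par w = (chi x / x $ 4 ^ 3) *s x"
    using v by (simp add: vec_eq_iff defs field_simps)
qed

lemma chartY_D: "y \<in> chartY \<Longrightarrow> emb y \<in> chart" "y \<in> chartY \<Longrightarrow> emb y $ 4 \<noteq> 0" "y \<in> chartY \<Longrightarrow> chi (emb y) \<noteq> 0"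
  by (simp_all add: chartY_def chart_def)

lemma fromY_dom: assumes y: "y \<in> chartY" shows "fromY y \<in> dom" "toY (fromY y) = y"
proof -
  let ?c = "chi (emb y) / emb y $ 4 ^ 3"
  have r: "parX (fromY y) = chi (emb y) / emb y $ 4 ^ 2" "par (fromY y) = ?c *s emb y"
    by (rule par_ratio[OF chartY_D(1)[OF y]], simp_all add: fromY_def)+
  have Dp: "D (par (fromY y)) = ?c" unfolding r(2) D_scale D_emb by simp
  have c: "?c \<noteq> 0" using chartY_D[OF y] by simp
  show "fromY y \<in> dom" using chartY_D[OF y] by (simp add: dom_def dpar_def Dp r(1))
  have "(1 / ?c) *s (?c *s emb y) = emb y" using c by (simp only: vector_smult_assoc) simp
  then show "toY (fromY y) = y" unfolding toY_def Dp unfolding r(2) by (simp add: proj_emb)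
qed

text \<open>The cone contains a basis of the whole space, namely \<open>pt 1\<close> to
  \<open>pt 4\<close> and \<open>pt 3 + pt 5\<close>, so no nonzero linear form vanishes on
  it.\<close>

lemma d_nz: "\<exists>x\<in>cone. D x \<noteq> 0"
proof (rule ccontr)
  assume "\<not> ?thesis"
  then have 0: "\<And>x. x \<in> cone \<Longrightarrow> D x = 0" by blast
  define pt where "pt = (\<lambda>i. axis i 1 :: complex^5)"
  have pt: "pt i $ j = (if i = j then 1 else 0)" for i j by (simp add: pt_def axis_def)
  have "pt i \<in> cone" if "i \<noteq> 5" for i using exhaust_5[of i] that by (auto simp: cone_def q1_def q2_def lin_def pt)
  moreover have Dpt: "D (pt i) = d $ i" for i using exhaust_5[of i] by (auto simp: D_def sum_5 pt)
  ultimately have d: "d $ i = 0" if "i \<noteq> 5" for i using 0 that by metis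
  have "pt 3 + pt 5 \<in> cone" by (simp add: cone_def q1_def q2_def lin_def pt)
  then have "D (pt 3 + pt 5) = 0" by (rule 0)
  moreover have "D (pt 3 + pt 5) = d $ 3 + d $ 5" by (simp add: D_def sum_5 pt)
  ultimately have "d $ 5 = 0" using d[of 3] by simp
  then have "d $ i = 0" for i using d by (cases "i = 5") auto
  then show False using m by simp
qed

text \<open>\<open>parX\<close> is not identically 0. If \<open>D\<close> vanished at all
  parametrized points, it would vanish on the chart and then, by \<open>ideal_of_chart\<close>, on
  the cone.\<close>

lemma dom_nonempty: "\<exists>w. w \<in> dom"
proof (rule ccontr)
  assume "\<not> ?thesis"
  then have "parX w * D (par w) = 0" for w by (auto simp: dom_def dpar_def)
  from poly_funs_domain[OF parXY_poly(1) poly_par[OF poly_in(3)] this]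
  have "(\<forall>w. parX w = 0) \<or> (\<forall>w. D (par w) = 0)" .
  moreover have "parX (axis 1 1) \<noteq> 0" using nz by (simp add: parX_def axis_def)
  ultimately have D0: "D (par w) = 0" for w by blast
  have "D x = 0" if x: "x \<in> chart" for x
  proof -
    define w :: "complex^2" where "w = (\<chi> i. (if i = 1 then x $ 1 else x $ 5) / x $ 4)"
    have "par w = (chi x / x $ 4 ^ 3) *s x" by (rule par_ratio(2)[OF x]) (simp_all add: w_def)
    then have "chi x / x $ 4 ^ 3 * D x = 0" using D0[of w] by (simp add: D_scale)
    then show ?thesis using x by (simp add: chart_def)
  qed
  from ideal_of_chart[OF poly_in(3) this] obtain h1 h2 where "\<forall>x. D x = q1 x * h1 x + q2 x * h2 x" by blast
  then have "D x = 0" if "x \<in> cone" for x using that by (simp add: cone_def)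
  then show False using d_nz by blast
qed

text \<open>Density of the chart: its points have the form \<open>toY w\<close>, and membership in
  the ideal of the two quadrics extends the vanishing to \<open>Y\<close>.\<close>

lemma vanish_Y:
  assumes "f \<in> poly_funs coords" "\<And>w. w \<in> dom \<Longrightarrow> f (toY w) = 0" "y \<in> Y"
  shows "f y = 0"
proof -
  have "f y = 0" if "y \<in> chartY" for y using assms(2)[OF fromY_dom(1)[OF that]] fromY_dom(2)[OF that] by simp
  from ideal_of_chartY[OF assms(1) this] assms(3) show ?thesis by (auto simp: Y_def cone_def)
qed

lemma pull_back:
  assumes "f \<in> poly_funs coords"
  shows "\<exists>n. \<exists>G\<in>poly_funs coords. \<forall>w. D (par w) \<noteq> 0 \<longrightarrow> G w = D (par w) ^ n * f (toY w)"
proof -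
  obtain n G where "G \<in> poly_funs coords" "\<forall>x. D x \<noteq> 0 \<longrightarrow> G x = D x ^ n * f (proj ((1 / D x) *s x))"
    using homogenize[OF assms] by blast
  then show ?thesis unfolding toY_def by (intro exI[of _ n] bexI[OF _ poly_par]) auto
qed

lemma Y_prime:
  assumes f: "f \<in> poly_funs coords" and g: "g \<in> poly_funs coords" and 0: "\<And>y. y \<in> Y \<Longrightarrow> f y * g y = 0"
  shows "(\<forall>y\<in>Y. f y = 0) \<or> (\<forall>y\<in>Y. g y = 0)"
proof -
  obtain n F1 where F1: "F1 \<in> poly_funs coords" "\<forall>w. D (par w) \<noteq> 0 \<longrightarrow> F1 w = D (par w) ^ n * f (toY w)"
    using pull_back[OF f] by blast
  obtain k G1 where G1: "G1 \<in> poly_funs coords" "\<forall>w. D (par w) \<noteq> 0 \<longrightarrow> G1 w = D (par w) ^ k * g (toY w)"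
    using pull_back[OF g] by blast
  \<comment> \<open>The factor \<open>dpar\<close> covers the parameters outside \<open>dom\<close>,
    so that the identity holds on the whole plane.\<close>
  have "dpar w * F1 w * G1 w = 0" for w
  proof (cases "w \<in> dom")
    case True
    then have "toY w \<in> Y" using toY_chart by (auto simp: chartY_def Y_def chart_def)
    then have "f (toY w) * g (toY w) = 0" by (rule 0)
    then show ?thesis using True F1 G1 by (auto simp: dom_def dpar_def)
  qed (simp add: dom_def)
  from poly_funs_domain[OF poly_funs.mult[OF dpar_poly F1(1)] G1(1) this]
  have "(\<forall>w. dpar w * F1 w = 0) \<or> (\<forall>w. G1 w = 0)" .
  then have "(\<forall>w\<in>dom. f (toY w) = 0) \<or> (\<forall>w\<in>dom. g (toY w) = 0)"
    using F1(2) G1(2) unfolding dom_def dpar_def by force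
  then show ?thesis using vanish_Y[OF f] vanish_Y[OF g] by blast
qed

lemma chartY_sub: "chartY \<subseteq> Y"
  by (auto simp: chartY_def Y_def chart_def)

lemma qa_cart: "quasi_affine cart_space coords UNIV"
  unfolding cart_space_def by (rule quasi_affine_linear_space)

lemma qa_Y: "quasi_affine (subvariety cart_space Y) coords Y"
  by (rule quasi_affine_subvariety[OF qa_cart]) simp

lemma Y_nonempty: "Y \<noteq> {}"
  using dom_nonempty toY_chart chartY_sub by blast

lemma Y_irreducible: "irreducible_in (zar (subvariety cart_space Y)) Y"
  unfolding quasi_affine_irreducible[OF qa_Y subset_refl]
  by (intro conjI ballI impI Y_nonempty Y_prime) auto

lemma cart_irreducible: "irreducible_in (zar (cart_space :: (complex^'n) fspace)) UNIV"
proof -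
  have "quasi_affine (cart_space :: (complex^'n) fspace) coords UNIV"
    unfolding cart_space_def by (rule quasi_affine_linear_space)
  show ?thesis unfolding quasi_affine_irreducible[OF \<open>quasi_affine cart_space coords UNIV\<close> subset_refl]
    by (intro conjI ballI impI) (use poly_funs_domain in auto)
qed

lemma Y_rational: "birational (subvariety cart_space Y) (cart_space :: (complex^2) fspace)"
  unfolding birational_def
proof (intro conjI exI)
  show "irreducible_in (zar (subvariety cart_space Y)) (points (subvariety cart_space Y))"
    using Y_irreducible quasi_affine_points[OF qa_Y] by simp
  have qa2: "quasi_affine (cart_space :: (complex^2) fspace) coords UNIV"
    unfolding cart_space_def by (rule quasi_affine_linear_space)
  show "irreducible_in (zar (cart_space :: (complex^2) fspace)) (points (cart_space :: (complex^2) fspace))"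
    using cart_irreducible quasi_affine_points[OF qa2] by simp
  have "chartY = {y \<in> Y. emb y $ 4 * chi (emb y) \<noteq> 0}" by (auto simp: chartY_def Y_def chart_def)
  moreover have "(\<lambda>y. emb y $ 4 * chi (emb y)) \<in> poly_funs coords"
    by (intro poly_funs_intros emb_poly poly_emb poly_in)
  note zopen_basic[OF this, of Y]
  ultimately have "zopen coords Y chartY" by simp
  then show "openin (zar (subvariety cart_space Y)) chartY" using quasi_affineD(1)[OF qa_Y] by blast
  show "chartY \<noteq> {}" using dom_nonempty toY_chart by blast
  have "zopen coords UNIV dom" unfolding dom_def using zopen_basic[OF dpar_poly, of UNIV] by simp
  then show "openin (zar (cart_space :: (complex^2) fspace)) dom" using quasi_affineD(1)[OF qa2] by blast
  show "dom \<noteq> {}" using dom_nonempty by blast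
  show "isomorphism (subvariety (subvariety cart_space Y) chartY) (subvariety cart_space dom) fromY"
  proof (rule quasi_affine_isomorphism)
    show "quasi_affine (subvariety (subvariety cart_space Y) chartY) coords chartY"
      by (rule quasi_affine_subvariety[OF qa_Y chartY_sub])
    show "quasi_affine (subvariety (cart_space :: (complex^2) fspace) dom) coords dom"
      by (rule quasi_affine_subvariety[OF qa2]) simp
    fix l :: "complex^2 \<Rightarrow> complex" assume "l \<in> coords"
    then obtain i where l: "l = (\<lambda>w. w $ i)" by (auto simp: coords_def)
    have "(\<lambda>y. if i = 1 then emb y $ 1 else emb y $ 5) \<in> poly_funs coords"
      by (cases "i = 1") (simp_all add: emb_poly)
    then show "locrat coords chartY (\<lambda>y. l (fromY y))"
      unfolding l fromY_def
      by (rule locrat_divide_poly[of "\<lambda>y. if i = 1 then emb y $ 1 else emb y $ 5" _ "\<lambda>y. emb y $ 4"])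
         (auto simp: emb_poly chartY_D)
  next
    fix l :: "complex^4 \<Rightarrow> complex" assume "l \<in> coords"
    then obtain i where l: "l = (\<lambda>w. w $ i)" by (auto simp: coords_def)
    show "locrat coords dom (\<lambda>w. l (toY w))"
      unfolding l toY_def
      by (rule locrat_divide_poly[of "\<lambda>w. par w $ \<beta> i" _ "\<lambda>w. D (par w)"])
         (auto simp: par_poly poly_par proj_def dom_def dpar_def)
  qed (use fromY_dom fromY_toY toY_chart in auto)
qed

end

text \<open>\<open>e1\<close> and \<open>v2\<close> form a dual pair for \<open>f\<close> and
  \<open>g\<close>, and they span a complement of the common kernel.\<close>

lemma vec_dim_common_kernel:
  fixes f g :: "complex^'n \<Rightarrow> complex"
  assumes f: "\<And>a v w. f (a *s v + w) = a * f v + f w" and g: "\<And>a v w. g (a *s v + w) = a * g v + g w"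
    and indep: "\<And>a b. (\<And>v. a * f v + b * g v = 0) \<Longrightarrow> a = 0 \<and> b = 0"
  shows "vec.dim {v. f v = 0 \<and> g v = 0} + 2 = CARD('n)"
proof -
  define K where "K = {v. f v = 0 \<and> g v = 0}"
  have f0: "f 0 = 0" using f[of 1 0 0] by simp
  have g0: "g 0 = 0" using g[of 1 0 0] by simp
  have fa: "f (v + w) = f v + f w" "f (a *s v) = a * f v" for v w a
    using f[of 1 v w] f[of a v 0] f0 by simp_all
  have ga: "g (v + w) = g v + g w" "g (a *s v) = a * g v" for v w a
    using g[of 1 v w] g[of a v 0] g0 by simp_all
  obtain v1' where "f v1' \<noteq> 0"
  proof (rule ccontr)
    assume n: "\<not> thesis"
    have "(1::complex) = 0 \<and> (0::complex) = 0" by (rule indep) (use n that in auto)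
    then show False by simp
  qed
  define v1 where "v1 = (1 / f v1') *s v1'"
  have v1: "f v1 = 1" using \<open>f v1' \<noteq> 0\<close> by (simp add: v1_def fa(2))
  obtain v2' where v2': "g v2' - g v1 * f v2' \<noteq> 0"
  proof (rule ccontr)
    assume n: "\<not> thesis"
    have "- g v1 = 0 \<and> (1::complex) = 0" by (rule indep) (use n that in auto)
    then show False by simp
  qed
  define v2 where "v2 = (1 / (g v2' - g v1 * f v2')) *s (v2' + (- f v2') *s v1)"
  have "g (v2' + (- f v2') *s v1) = g v2' - g v1 * f v2'" unfolding ga by simp
  moreover have "f (v2' + (- f v2') *s v1) = 0" unfolding fa v1 by simp
  ultimately have v2: "f v2 = 0" "g v2 = 1" unfolding v2_def fa(2) ga(2) using v2' by simp_all
  define e1 where "e1 = v1 + (- g v1) *s v2"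
  have e1: "f e1 = 1" "g e1 = 0" unfolding e1_def fa ga v1 v2 by simp_all
  have K: "vec.subspace K" unfolding vec.subspace_def K_def by (auto simp: f0 g0 fa ga)
  define E where "E = vec.span {e1, v2}"
  have ne: "e1 \<noteq> v2" using e1 v2 by auto
  have "vec.independent {e1, v2}"
  proof (rule ccontr)
    assume "\<not> ?thesis"
    then have "e1 \<in> vec.span {v2} \<or> v2 = 0"
      using ne by (auto simp: vec.independent_insert vec.dependent_single)
    moreover have "v2 \<noteq> 0" using v2 g0 by auto
    ultimately obtain c where "e1 = c *s v2" by (auto simp: vec.span_singleton)
    then have "f e1 = c * f v2" by (simp add: fa)
    then show False using e1 v2 by simp
  qed
  then have "vec.dim E = 2" unfolding E_def using ne by (simp add: vec.dim_eq_card_independent)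
  have "K \<inter> E = {0}"
  proof (intro set_eqI iffI)
    fix v assume v: "v \<in> K \<inter> E"
    then obtain a b where ab: "v = a *s e1 + b *s v2"
      unfolding E_def by (auto simp: vec.span_insert vec.span_singleton) (metis add_diff_cancel_left' add_diff_eq diff_add_cancel)
    then have "f v = a" "g v = b" using e1 v2 by (simp_all add: fa ga)
    then show "v \<in> {0}" using v ab by (simp add: K_def)
  qed (auto simp: K_def E_def f0 g0 vec.span_zero)
  moreover have "{x + y |x y. x \<in> K \<and> y \<in> E} = UNIV"
  proof (intro set_eqI iffI UNIV_I)
    fix v
    have "f v *s e1 + g v *s v2 \<in> E" unfolding E_def
      by (intro vec.span_add vec.span_scale vec.span_base) auto
    moreover have "f (v + (-1) *s (f v *s e1 + g v *s v2)) = 0" "g (v + (-1) *s (f v *s e1 + g v *s v2)) = 0"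
      unfolding fa ga using e1 v2 by simp_all
    then have "v + (-1) *s (f v *s e1 + g v *s v2) \<in> K" by (simp add: K_def)
    moreover have "v = (v + (-1) *s (f v *s e1 + g v *s v2)) + (f v *s e1 + g v *s v2)" by (simp add: vec_eq_iff)
    ultimately show "v \<in> {x + y |x y. x \<in> K \<and> y \<in> E}" by blast
  qed
  moreover have "vec.dim {x + y |x y. x \<in> K \<and> y \<in> E} + vec.dim (K \<inter> E) = vec.dim K + vec.dim E"
    by (rule vec.dim_sums_Int[OF K]) (simp add: E_def)
  ultimately show ?thesis using \<open>vec.dim E = 2\<close> by (simp add: K_def[symmetric] vec_dim_card card_cart_basis)
qed

context segre
begin

section \<open>Polar forms of the two quadrics, and tangent spaces\<close>

definition b1 :: "complex^5 \<Rightarrow> complex^5 \<Rightarrow> complex" where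
  "b1 x y = (x $ 3 * y $ 4 + x $ 4 * y $ 3 - x $ 1 * y $ 2 - x $ 2 * y $ 1) / 2"
definition b2 :: "complex^5 \<Rightarrow> complex^5 \<Rightarrow> complex" where
  "b2 x y = (x $ 5 * (lin y - y $ 5) + y $ 5 * (lin x - x $ 5) - ss * (x $ 1 * y $ 2 + x $ 2 * y $ 1)) / 2"

lemma b_sym: "b1 x y = b1 y x" "b2 x y = b2 y x"
  by (simp_all add: b1_def b2_def algebra_simps)

lemma b_lin: "b1 (x + x') y = b1 x y + b1 x' y" "b1 (a *s x) y = a * b1 x y"
  "b2 (x + x') y = b2 x y + b2 x' y" "b2 (a *s x) y = a * b2 x y"
  by (simp_all add: b1_def b2_def lin_def field_simps)

lemma b_lin2: "b1 x (y + y') = b1 x y + b1 x y'" "b1 x (a *s y) = a * b1 x y"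
  "b2 x (y + y') = b2 x y + b2 x y'" "b2 x (a *s y) = a * b2 x y"
  by (simp_all add: b1_def b2_def lin_def field_simps)

lemma q_b: "q1 x = b1 x x" "q2 x = b2 x x"
  by (simp_all add: b1_def b2_def q1_def q2_def field_simps)

lemma emb_expand: "emb y = emb 0 + y $ 1 *s emb0 (axis 1 1) + y $ 2 *s emb0 (axis 2 1) +
    y $ 3 *s emb0 (axis 3 1) + y $ 4 *s emb0 (axis 4 1)"
proof -
  have "emb y = emb 0 + emb0 y" using emb_line[of 0 1 y] by simp
  moreover have "emb0 y = y $ 1 *s emb0 (axis 1 1) + y $ 2 *s emb0 (axis 2 1) +
    y $ 3 *s emb0 (axis 3 1) + y $ 4 *s emb0 (axis 4 1)"
  proof -
    have a: "(axis i 1 :: complex^4) $ j = (if i = j then 1 else 0)" for i j by (simp add: axis_def)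
    have "emb0 y $ i = (y $ 1 *s emb0 (axis 1 1) + y $ 2 *s emb0 (axis 2 1) +
      y $ 3 *s emb0 (axis 3 1) + y $ 4 *s emb0 (axis 4 1)) $ i" for i
    proof (cases "i = m")
      case True
      then show ?thesis using m by (simp add: emb0_def sum_4 a field_simps)
    next
      case False
      then show ?thesis using exhaust_4[of "inv \<beta> i"] by (auto simp: emb0_def a)
    qed
    then show ?thesis by (simp only: vec_eq_iff) simp
  qed
  ultimately show ?thesis by (simp add: add.assoc)
qed

text \<open>Along a direction \<open>x\<close> with \<open>D x = 0\<close> the polynomial has
  \<open>b x x\<close> as coefficient of \<open>t ^ 2\<close>, so its quadratic part survives on the
  hyperplane.\<close>

lemma affine_quadric_emb:
  fixes b :: "complex^5 \<Rightarrow> complex^5 \<Rightarrow> complex"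
  assumes sym: "\<And>x y. b x y = b y x"
    and add: "\<And>x x' y. b (x + x') y = b x y + b x' y" and scale: "\<And>a x y. b (a *s x) y = a * b x y"
    and nz: "\<exists>x. D x = 0 \<and> b x x \<noteq> 0"
  shows "affine_quadric {y. b (emb y) (emb y) = 0}"
proof -
  define n where "n = (\<lambda>i. emb0 (axis i 1))"
  define A :: "complex^4^4" where "A = (\<chi> i j. b (n i) (n j))"
  define c :: "complex^4" where "c = (\<chi> i. 2 * b (emb 0) (n i))"
  have add': "b x (y + y') = b x y + b x y'" for x y y' using add sym by metis
  have scale': "b x (a *s y) = a * b x y" for x a y using scale sym by metis
  have ex: "emb y = emb 0 + y $ 1 *s n 1 + y $ 2 *s n 2 + y $ 3 *s n 3 + y $ 4 *s n 4" for y
    unfolding n_def by (rule emb_expand)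
  have e: "b (emb y) (emb y) = (\<Sum>i\<in>UNIV. \<Sum>j\<in>UNIV. A $ i $ j * y $ i * y $ j) + (\<Sum>i\<in>UNIV. c $ i * y $ i) + b (emb 0) (emb 0)" for y
    unfolding ex[of y] sum_4 A_def c_def
    using sym[of "n 1" "emb 0"] sym[of "n 2" "emb 0"] sym[of "n 3" "emb 0"] sym[of "n 4" "emb 0"]
    by (simp add: add add' scale scale' algebra_simps)
  have "A \<noteq> 0"
  proof
    assume A: "A = 0"
    obtain x where x: "D x = 0" "b x x \<noteq> 0" using nz by blast
    have lin: "b (emb (t *s proj x)) (emb (t *s proj x)) = t * (\<Sum>i\<in>UNIV. c $ i * proj x $ i) + b (emb 0) (emb 0)" for t
      by (subst e) (simp add: A sum_distrib_left mult_ac)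
    have em: "emb (t *s proj x) = emb 0 + t *s x" for t
      using emb_line[of 0 t "proj x"] emb0_surj[OF x(1)] by simp
    have "b (emb (t *s proj x)) (emb (t *s proj x)) = b (emb 0) (emb 0) + 2 * t * b (emb 0) x + t ^ 2 * b x x" for t
      unfolding em by (simp only: add add' scale scale' sym[of x "emb 0"]) (simp add: power2_eq_square algebra_simps)
    then have q: "2 * t * b (emb 0) x + t ^ 2 * b x x = t * (\<Sum>i\<in>UNIV. c $ i * proj x $ i)" for t
      using lin[of t] by simp
    have "b x x + b x x = (2 * b (emb 0) x + b x x) + (b x x - 2 * b (emb 0) x)" by simp
    also have "\<dots> = 0" using q[of 1] q[of "-1"] by simp
    finally have "b x x = 0" by simp
    then show False using x by simp
  qed
  moreover have "transpose A = A" by (simp add: A_def transpose_def vec_eq_iff sym)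
  ultimately show ?thesis unfolding affine_quadric_def by (intro exI[of _ A] exI[of _ c] exI[of _ "b (emb 0) (emb 0)"]) (simp add: e[symmetric])
qed

text \<open>The vector \<open>D y *s x + (- D x) *s y\<close> lies in \<open>D = 0\<close>, and its
  value under \<open>b\<close> is \<open>b x x\<close> times the square of \<open>D y\<close>.
  Enough pairs \<open>x\<close>, \<open>y\<close> show that \<open>b\<close> cannot vanish on the
  hyperplane.\<close>

lemma D_isotropic:
  fixes b :: "complex^5 \<Rightarrow> complex^5 \<Rightarrow> complex"
  assumes sym: "\<And>x y. b x y = b y x"
    and add: "\<And>x x' y. b (x + x') y = b x y + b x' y" and scale: "\<And>a x y. b (a *s x) y = a * b x y"
    and 0: "\<And>x. D x = 0 \<Longrightarrow> b x x = 0"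
    and x: "b x x \<noteq> 0" "b y y = 0" "b x y = 0"
  shows "D y = 0"
proof -
  have add': "b x (y + y') = b x y + b x y'" for x y y' using add sym by metis
  have scale': "b x (a *s y) = a * b x y" for x a y using scale sym by metis
  have Dadd: "D (u + v) = D u + D v" for u v by (simp add: D_def sum.distrib algebra_simps)
  have "D (D y *s x + (- D x) *s y) = 0" by (simp only: Dadd D_scale) simp
  from 0[OF this] have "b (D y *s x + (- D x) *s y) (D y *s x + (- D x) *s y) = 0" .
  then have "D y * (D y * b x x) = 0"
    by (simp only: add add' scale scale' x sym[of y x]) simp
  then show ?thesis using x by simp
qed

definition pt :: "5 \<Rightarrow> complex^5" where "pt i = axis i 1"
lemma pt: "pt i $ j = (if i = j then 1 else 0)" by (simp add: pt_def axis_def)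

lemma D_pt: "D (pt i) = d $ i"
  using exhaust_5[of i] by (auto simp: D_def sum_5 pt)

lemma D_lin: "D (a *s x + y) = a * D x + D y"
  by (simp add: D_def sum.distrib sum_distrib_left algebra_simps)

lemma d_all_zero: "d $ 1 = 0 \<Longrightarrow> d $ 2 = 0 \<Longrightarrow> d $ 3 = 0 \<Longrightarrow> d $ 4 = 0 \<Longrightarrow> d $ 5 = 0 \<Longrightarrow> False"
  using m exhaust_5[of m] by auto

lemma q1_not_isotropic: "\<exists>x. D x = 0 \<and> b1 x x \<noteq> 0"
proof (rule ccontr)
  assume n: "\<not> ?thesis"
  have iso: "D y = 0" if "b1 x x \<noteq> 0" "b1 y y = 0" "b1 x y = 0" for x y
    by (rule D_isotropic[of b1, OF b_sym(1) b_lin(1,2) _ that]) (use n in auto)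
  have "D (pt 1) = 0" "D (pt 2) = 0" "D (pt 5) = 0"
    by (rule iso[of "pt 3 + pt 4"]; simp add: b1_def pt)+
  moreover have "D (pt 3) = 0" "D (pt 4) = 0"
    by (rule iso[of "pt 1 + pt 2"]; simp add: b1_def pt)+
  ultimately show False using d_all_zero by (simp add: D_pt)
qed

lemma q2_not_isotropic: "\<exists>x. D x = 0 \<and> b2 x x \<noteq> 0"
proof (rule ccontr)
  assume n: "\<not> ?thesis"
  have iso: "D y = 0" if "b2 x x \<noteq> 0" "b2 y y = 0" "b2 x y = 0" for x y
    by (rule D_isotropic[of b2, OF b_sym(2) b_lin(3,4) _ that]) (use n in auto)
  have "D (pt 3) = 0" by (rule iso[of "pt 1 + pt 2"]; use nz in \<open>simp add: b2_def lin_def pt\<close>)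
  \<comment> \<open>The multiples of \<open>pt 3\<close> make both vectors orthogonal to
    \<open>pt 5\<close>.\<close>
  moreover have "D ((- kk) *s pt 3 + pt 1) = 0" "D ((- ll) *s pt 3 + pt 2) = 0"
    by (rule iso[of "pt 5"]; simp add: b2_def lin_def pt)+
  ultimately have "D (pt 1) = 0" "D (pt 2) = 0" unfolding D_lin by simp_all
  then have "D (1 *s pt 1 + pt 2) = 0" unfolding D_lin by simp
  moreover have "b2 (1 *s pt 1 + pt 2) (1 *s pt 1 + pt 2) \<noteq> 0" using nz by (simp add: b2_def lin_def pt)
  ultimately show False using n by blast
qed

lemma Y_quadrics: "affine_quadric {y. q1 (emb y) = 0}" "affine_quadric {y. q2 (emb y) = 0}"
  unfolding q_b
  by (rule affine_quadric_emb; (rule b_sym b_lin q1_not_isotropic q2_not_isotropic))+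

text \<open>A relation makes \<open>x\<close> a singular point of a quadric in the pencil. If
  \<open>b\<close> and \<open>z\<close> are nonzero, multiplying the equations in pairs gives
  \<open>a\<^sup>2 = b\<^sup>2 * ss\<close> and
  \<open>(a + b * ss)\<^sup>2 = b\<^sup>2 * kk * ll * ss\<close>. Together they yield
  \<open>2 * a = - (b * (s1 + s2))\<close>, and then
  \<open>b\<^sup>2 * (s1 - s2)\<^sup>2 = 0\<close>.\<close>

lemma gradients_independent:
  assumes x: "x \<in> cone" "x \<noteq> 0" and c: "\<And>h. a * b1 x h + b * b2 x h = 0"
  shows "a = 0 \<and> b = 0"
proof -
  define p r u v z where "p = x $ 1" and "r = x $ 2" and "u = x $ 3" and "v = x $ 4" and "z = x $ 5"
  note defs = p_def[symmetric] r_def[symmetric] u_def[symmetric] v_def[symmetric] z_def[symmetric]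
  have q: "u * v = p * r" "z * (u + v + kk * p + ll * r - z) = ss * p * r"
    using x(1) by (simp_all add: cone_def q1_def q2_def lin_def defs)
  have c': "a * (2 * b1 x h) + b * (2 * b2 x h) = 0" for h using c[of h] by algebra
  have "2 * (a * (- r) + b * (kk * z - ss * r)) = 0" "2 * (a * (- p) + b * (ll * z - ss * p)) = 0"
    "2 * (a * v + b * z) = 0" "2 * (a * u + b * z) = 0" "2 * (b * (u + v + kk * p + ll * r - 2 * z)) = 0"
    using c'[of "pt 1"] c'[of "pt 2"] c'[of "pt 3"] c'[of "pt 4"] c'[of "pt 5"]
    by (simp_all add: b1_def b2_def lin_def pt defs algebra_simps)
  then have e: "a * (- r) + b * (kk * z - ss * r) = 0" "a * (- p) + b * (ll * z - ss * p) = 0"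
    "a * v + b * z = 0" "a * u + b * z = 0" "b * (u + v + kk * p + ll * r - 2 * z) = 0"
    by (simp_all only: mult_eq_0_iff zero_neq_numeral[symmetric] simp_thms)
  have x0: False if "p = 0" "r = 0" "u = 0" "v = 0" "z = 0"
  proof -
    have "\<forall>i. x $ i = 0" unfolding forall_5 defs using that by simp
    then show False using x(2) by (simp add: vec_eq_iff)
  qed
  show ?thesis
  proof (cases "b = 0")
    case True
    have "a = 0"
    proof (rule ccontr)
      assume "a \<noteq> 0"
      then have 0: "p = 0" "r = 0" "u = 0" "v = 0" using e True by auto
      then have "z = 0" using q by auto
      then show False using x0 0 by blast
    qed
    then show ?thesis using True by simp
  next
    case False
    \<comment> \<open>So \<open>z\<close> is a double root of its quadratic equation.\<close>
    then have w: "u + v + kk * p + ll * r = 2 * z" using e by simp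
    have z2: "z * z = ss * p * r" using q(2) w by algebra
    have False
    proof (cases "z = 0")
      case True
      have 1: "(a + b * ss) * r = 0" "(a + b * ss) * p = 0" using e True by algebra+
      have pr: "p * r = 0" using z2 True nz by simp
      show False
      proof (cases "a = 0")
        case True
        then have "p = 0" "r = 0" using 1 False nz by auto
        then show False using q w \<open>z = 0\<close> x0 by auto
      next
        case False
        then have "u = 0" "v = 0" using e True by auto
        then show False using pr w True nz x0 by auto
      qed
    next
      case zn: False
      have A: "a \<noteq> 0" using e(3) zn \<open>b \<noteq> 0\<close> by auto
      have pr: "p * r \<noteq> 0" using z2 zn by auto
      have av: "a * v = - (b * z)" and au: "a * u = - (b * z)" using e(3,4) by (simp_all add: eq_neg_iff_add_eq_0)
      have "a\<^sup>2 * (p * r) = (a * u) * (a * v)" unfolding q(1)[symmetric] by (simp add: power2_eq_square mult_ac)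
      also have "\<dots> = b\<^sup>2 * (z * z)" unfolding av au by (simp add: power2_eq_square mult_ac)
      also have "\<dots> = b\<^sup>2 * ss * (p * r)" unfolding z2 by (simp add: mult_ac)
      finally have a2: "a\<^sup>2 = b\<^sup>2 * ss" using pr by simp
      have ar: "(a + b * ss) * r = b * kk * z" and ap: "(a + b * ss) * p = b * ll * z" using e(1,2) by algebra+
      have "(a + b * ss)\<^sup>2 * (p * r) = ((a + b * ss) * r) * ((a + b * ss) * p)" by (simp add: power2_eq_square mult_ac)
      also have "\<dots> = b\<^sup>2 * kk * ll * (z * z)" unfolding ar ap by (simp add: power2_eq_square mult_ac)
      also have "\<dots> = b\<^sup>2 * kk * ll * ss * (p * r)" unfolding z2 by (simp add: mult_ac)
      finally have "(a + b * ss)\<^sup>2 = b\<^sup>2 * kk * ll * ss" using pr by simp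
      then have "b * ss * (b + 2 * a + b * ss - b * kk * ll) = 0" using a2 by algebra
      then have "b + 2 * a + b * ss - b * kk * ll = 0" using \<open>b \<noteq> 0\<close> nz by simp
      then have "2 * a = - (b * (s1 + s2))" unfolding kk_def ll_def ss_def by algebra
      then have "4 * a\<^sup>2 = b\<^sup>2 * (s1 + s2)\<^sup>2" by algebra
      then have "b\<^sup>2 * (s1 - s2)\<^sup>2 = 0" using a2 unfolding ss_def by algebra
      then show False using s12 \<open>b \<noteq> 0\<close> by simp
    qed
    then show ?thesis ..
  qed
qed

lemma b_emb0: "b1 x (emb0 (a *s v + w)) = a * b1 x (emb0 v) + b1 x (emb0 w)"
  "b2 x (emb0 (a *s v + w)) = a * b2 x (emb0 v) + b2 x (emb0 w)"
proof -
  have "emb0 (a *s v + w) = a *s emb0 v + emb0 w"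
    by (simp add: vec_eq_iff emb0_def sum.distrib sum_distrib_left sum_negf algebra_simps add_divide_distrib diff_divide_distrib)
  then show "b1 x (emb0 (a *s v + w)) = a * b1 x (emb0 v) + b1 x (emb0 w)"
    "b2 x (emb0 (a *s v + w)) = a * b2 x (emb0 v) + b2 x (emb0 w)"
    by (simp_all add: b_lin2)
qed

lemma quadric_derivative:
  fixes b :: "complex^5 \<Rightarrow> complex^5 \<Rightarrow> complex"
  assumes sym: "\<And>x y. b x y = b y x"
    and add: "\<And>x x' y. b (x + x') y = b x y + b x' y" and scale: "\<And>a x y. b (a *s x) y = a * b x y"
  shows "((\<lambda>t. b (emb (p + t *s v)) (emb (p + t *s v))) has_field_derivative 2 * b (emb p) (emb0 v)) (at 0)"
proof -
  have add': "b x (y + y') = b x y + b x y'" for x y y' using add sym by metis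
  have scale': "b x (a *s y) = a * b x y" for x a y using scale sym by metis
  have "b (emb (p + t *s v)) (emb (p + t *s v)) =
      b (emb p) (emb p) + t * (2 * b (emb p) (emb0 v)) + t ^ 2 * b (emb0 v) (emb0 v)" for t
    unfolding emb_line by (simp only: add add' scale scale' sym[of "emb0 v" "emb p"])
      (simp add: power2_eq_square algebra_simps)
  then have eq: "(\<lambda>t. b (emb (p + t *s v)) (emb (p + t *s v))) =
      (\<lambda>t. b (emb p) (emb p) + t * (2 * b (emb p) (emb0 v)) + t ^ 2 * b (emb0 v) (emb0 v))" by blast
  show ?thesis unfolding eq by (rule derivative_eq_intros refl | simp)+
qed

text \<open>By \<open>ideal_of_chartY\<close> every function in the vanishing ideal is a combination
  of the two quadrics, so at a point of \<open>Y\<close> its differential is a combination of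
  theirs.\<close>

lemma tangent_space_Y:
  assumes p: "p \<in> Y"
  shows "tangent_space Y p = {v. b1 (emb p) (emb0 v) = 0 \<and> b2 (emb p) (emb0 v) = 0}"
proof -
  have q0: "q1 (emb p) = 0" "q2 (emb p) = 0" using p by (simp_all add: Y_def cone_def)
  note d1 = quadric_derivative[of b1 p, OF b_sym(1) b_lin(1,2), folded q_b]
    and d2 = quadric_derivative[of b2 p, OF b_sym(2) b_lin(3,4), folded q_b]
  show ?thesis
  proof (intro set_eqI iffI)
    fix v assume v: "v \<in> tangent_space Y p"
    have "(\<lambda>y. q1 (emb y)) \<in> vanishing_ideal Y" "(\<lambda>y. q2 (emb y)) \<in> vanishing_ideal Y"
      by (auto simp: vanishing_ideal_def Y_def cone_def intro!: poly_emb)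
    then have "deriv (\<lambda>t. q1 (emb (p + t *s v))) 0 = 0" "deriv (\<lambda>t. q2 (emb (p + t *s v))) 0 = 0"
      using v unfolding tangent_space_def by auto
    then show "v \<in> {v. b1 (emb p) (emb0 v) = 0 \<and> b2 (emb p) (emb0 v) = 0}"
      using DERIV_imp_deriv[OF d1[of v]] DERIV_imp_deriv[OF d2[of v]] by simp
  next
    fix v assume v: "v \<in> {v. b1 (emb p) (emb0 v) = 0 \<and> b2 (emb p) (emb0 v) = 0}"
    have "deriv (\<lambda>t. f (p + t *s v)) 0 = 0" if f: "f \<in> vanishing_ideal Y" for f
    proof -
      have "f \<in> poly_funs coords" "\<And>y. y \<in> chartY \<Longrightarrow> f y = 0"
        using f chartY_sub by (auto simp: vanishing_ideal_def)
      from ideal_of_chartY[OF this] obtain h1 h2 where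
        h: "h1 \<in> poly_funs coords" "h2 \<in> poly_funs coords" "\<forall>y. f y = q1 (emb y) * h1 y + q2 (emb y) * h2 y" by blast
      obtain h1' where h1': "((\<lambda>t. h1 (p + t *s v)) has_field_derivative h1') (at 0)"
        using poly_funs_line_differentiable[OF h(1)] unfolding field_differentiable_def by blast
      obtain h2' where h2': "((\<lambda>t. h2 (p + t *s v)) has_field_derivative h2') (at 0)"
        using poly_funs_line_differentiable[OF h(2)] unfolding field_differentiable_def by blast
      have "((\<lambda>t. q1 (emb (p + t *s v)) * h1 (p + t *s v) + q2 (emb (p + t *s v)) * h2 (p + t *s v)) has_field_derivative
          (q1 (emb (p + 0 *s v)) * h1' + 2 * b1 (emb p) (emb0 v) * h1 (p + 0 *s v)) +
          (q2 (emb (p + 0 *s v)) * h2' + 2 * b2 (emb p) (emb0 v) * h2 (p + 0 *s v))) (at 0)"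
        by (intro DERIV_add DERIV_mult' d1 d2 h1' h2')
      then have "((\<lambda>t. f (p + t *s v)) has_field_derivative 0) (at 0)"
        using v q0 h(3) by simp
      then show ?thesis by (rule DERIV_imp_deriv)
    qed
    then show "v \<in> tangent_space Y p" by (simp add: tangent_space_def)
  qed
qed

lemma dim_tangent_space_Y:
  assumes p: "p \<in> Y"
  shows "vec.dim (tangent_space Y p) = 2"
proof -
  define x where "x = emb p"
  have x: "x \<in> cone" "D x = 1" using p D_emb by (auto simp: Y_def x_def)
  then have x0: "x \<noteq> 0" using D_def by auto
  have ind: "a = 0 \<and> b = 0" if ab: "\<And>v. a * b1 x (emb0 v) + b * b2 x (emb0 v) = 0" for a b
  proof (rule gradients_independent[OF x(1) x0])
    fix h
    \<comment> \<open>Since \<open>D x = 1\<close>, \<open>b1 x x = 0\<close> and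
      \<open>b2 x x = 0\<close>, any \<open>h\<close> can be moved into \<open>D = 0\<close> along
      \<open>x\<close> without changing either form.\<close>
    define h' where "h' = (- D h) *s x + h"
    have "D h' = 0" unfolding h'_def D_lin using x by simp
    then have "h' = emb0 (proj h')" using emb0_surj by simp
    then have 1: "a * b1 x h' + b * b2 x h' = 0" using ab by metis
    have "b1 x x = 0" "b2 x x = 0" using x by (simp_all add: cone_def q_b)
    then have "b1 x h' = b1 x h" "b2 x h' = b2 x h"
      unfolding h'_def by (simp_all only: b_lin2) simp_all
    then show "a * b1 x h + b * b2 x h = 0" using 1 by simp
  qed
  have "vec.dim {v. b1 x (emb0 v) = 0 \<and> b2 x (emb0 v) = 0} + 2 = CARD(4)"
    by (rule vec_dim_common_kernel[OF b_emb0 ind])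
  then show ?thesis using tangent_space_Y[OF p] by (simp add: x_def)
qed

end

section \<open>Krull dimension\<close>

interpretation fun_space: vector_space "\<lambda>(c::complex) (f :: 'a \<Rightarrow> complex) x. c * f x"
  by unfold_locales (auto simp: algebra_simps)

lemma fun_space_sum_apply: "(\<Sum>i\<in>I. f i) x = (\<Sum>i\<in>I. (f i :: 'a \<Rightarrow> complex) x)"
  by (induction I rule: infinite_finite_induct) auto

text \<open>Dimension count for indexed families: if two members with different indices coincide,
  their difference is already a relation.\<close>

lemma linear_relation:
  fixes M :: "'i \<Rightarrow> 'a \<Rightarrow> complex"
  assumes T: "finite T" "card T < card I" and I: "finite I" and M: "\<And>i. i \<in> I \<Longrightarrow> M i \<in> fun_space.span T"
  shows "\<exists>c. (\<exists>i\<in>I. c i \<noteq> 0) \<and> (\<forall>x. (\<Sum>i\<in>I. c i * M i x) = 0)"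
proof (cases "inj_on M I")
  case True
  have "fun_space.dependent (M ` I)"
  proof (rule ccontr)
    assume "\<not> ?thesis"
    moreover have "M ` I \<subseteq> fun_space.span T" using M by auto
    ultimately have "card (M ` I) \<le> card T" using fun_space.independent_span_bound[OF T(1)] by blast
    then show False using T card_image[OF True] by simp
  qed
  then obtain u where u: "\<exists>v\<in>M ` I. u v \<noteq> 0" "(\<Sum>v\<in>M ` I. (\<lambda>x. u v * v x)) = 0"
    using fun_space.dependent_finite[of "M ` I"] I by auto
  have "(\<Sum>i\<in>I. u (M i) * M i x) = 0" for x
  proof -
    have "(\<Sum>i\<in>I. u (M i) * M i x) = (\<Sum>v\<in>M ` I. u v * v x)"
      by (simp add: sum.reindex[OF True])
    also have "\<dots> = 0" using fun_cong[OF u(2), of x] by (simp add: fun_space_sum_apply)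
    finally show ?thesis .
  qed
  then show ?thesis using u(1) by (intro exI[of _ "u \<circ> M"]) auto
next
  case False
  then obtain i j where ij: "i \<in> I" "j \<in> I" "i \<noteq> j" "M i = M j" by (auto simp: inj_on_def)
  define c :: "'i \<Rightarrow> complex" where "c = (\<lambda>k. if k = i then 1 else if k = j then -1 else 0)"
  have "(\<Sum>k\<in>I. c k * M k x) = 0" for x
  proof -
    have "(\<Sum>k\<in>I. c k * M k x) = (\<Sum>k\<in>{i, j}. c k * M k x)"
      by (rule sum.mono_neutral_right[OF I]) (use ij in \<open>auto simp: c_def\<close>)
    also have "\<dots> = 0" using ij by (simp add: c_def)
    finally show ?thesis .
  qed
  then show ?thesis using ij by (intro exI[of _ c]) (auto simp: c_def)
qed

text \<open>Both exponents are bounded separately, so that bounds add under products and the number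
  of monomials is quadratic in \<open>n\<close>.\<close>

definition mons :: "nat \<Rightarrow> (complex^2 \<Rightarrow> complex) set" where
  "mons n = (\<lambda>(i, j) w. w $ 1 ^ i * w $ 2 ^ j) ` ({..n} \<times> {..n})"

lemma mons_card: "finite (mons n)" "card (mons n) \<le> (n + 1) ^ 2"
proof -
  show "finite (mons n)" by (simp add: mons_def)
  have "card (mons n) \<le> card ({..n} \<times> {..n})" unfolding mons_def by (rule card_image_le) simp
  then show "card (mons n) \<le> (n + 1) ^ 2" by (simp add: card_cartesian_product power2_eq_square)
qed

lemma mons_mono: "n \<le> k \<Longrightarrow> fun_space.span (mons n) \<subseteq> fun_space.span (mons k)"
  by (rule fun_space.span_mono) (force simp: mons_def)

lemma span_mons_mult:
  assumes f: "f \<in> fun_space.span (mons n)" and g: "g \<in> fun_space.span (mons k)"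
  shows "(\<lambda>w. f w * g w) \<in> fun_space.span (mons (n + k))"
  using f
proof (induction rule: fun_space.span_induct_alt)
  case base
  have "(\<lambda>w. 0) = (0 :: complex^2 \<Rightarrow> complex)" by auto
  then show ?case using fun_space.span_zero by simp
next
  case (step c a f)
  have "(\<lambda>w. a w * g w) \<in> fun_space.span (mons (n + k))"
    using g
  proof (induction rule: fun_space.span_induct_alt)
    case base
    have "(\<lambda>w. 0) = (0 :: complex^2 \<Rightarrow> complex)" by auto
    then show ?case using fun_space.span_zero by simp
  next
    case (step c b g)
    obtain i j where a: "a = (\<lambda>w. w $ 1 ^ i * w $ 2 ^ j)" "i \<le> n" "j \<le> n" using \<open>a \<in> mons n\<close> by (auto simp: mons_def)
    obtain i' j' where b: "b = (\<lambda>w. w $ 1 ^ i' * w $ 2 ^ j')" "i' \<le> k" "j' \<le> k" using \<open>b \<in> mons k\<close> by (auto simp: mons_def)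
    have "(\<lambda>w. w $ 1 ^ (i + i') * w $ 2 ^ (j + j')) \<in> mons (n + k)"
      using a(2,3) b(2,3) unfolding mons_def by (intro image_eqI[of _ _ "(i + i', j + j')"]) auto
    then have "(\<lambda>w. c * (w $ 1 ^ (i + i') * w $ 2 ^ (j + j'))) \<in> fun_space.span (mons (n + k))"
      using fun_space.span_base fun_space.span_scale by blast
    from fun_space.span_add[OF this step.IH]
    show ?case by (simp add: a(1) b(1) power_add algebra_simps plus_fun_def)
  qed
  from fun_space.span_add[OF fun_space.span_scale[OF this, of c] step.IH]
  show ?case by (simp add: algebra_simps plus_fun_def)
qed

lemma span_mons_power: "f \<in> fun_space.span (mons n) \<Longrightarrow> (\<lambda>w. f w ^ k) \<in> fun_space.span (mons (n * k))"
proof (induction k)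
  case 0
  have "(\<lambda>w. 1) \<in> mons 0" by (auto simp: mons_def)
  then show ?case using fun_space.span_base by (simp add: one_fun_def)
next
  case (Suc k)
  from span_mons_mult[OF Suc.prems Suc.IH[OF Suc.prems]] show ?case by simp
qed

lemma poly_funs_span_mons:
  assumes "f \<in> poly_funs (coords :: (complex^2 \<Rightarrow> complex) set)"
  shows "\<exists>n. f \<in> fun_space.span (mons n)"
  using assms
proof induction
  case (const c)
  have "(\<lambda>w. 1) \<in> mons 0" by (auto simp: mons_def)
  then have "(\<lambda>w. c * 1) \<in> fun_space.span (mons 0)" using fun_space.span_base fun_space.span_scale by blast
  then show ?case by (intro exI[of _ 0]) simp
next
  case (gen l)
  then obtain i where l: "l = (\<lambda>w. w $ i)" by (auto simp: coords_def)
  have "l \<in> mons 1"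
    using exhaust_2[of i] unfolding mons_def l
    by (auto intro: image_eqI[of _ _ "(1, 0)"] image_eqI[of _ _ "(0, 1)"])
  then show ?case using fun_space.span_base by blast
next
  case (add f g)
  then obtain n k where "f \<in> fun_space.span (mons n)" "g \<in> fun_space.span (mons k)" by blast
  then have "f \<in> fun_space.span (mons (n + k))" "g \<in> fun_space.span (mons (n + k))"
    using mons_mono[of n "n + k"] mons_mono[of k "n + k"] by auto
  from fun_space.span_add[OF this] show ?case by (auto simp: plus_fun_def)
next
  case (mult f g)
  then show ?case using span_mons_mult by blast
qed

text \<open>If \<open>f\<close> vanishes on \<open>A\<close> but not on the irreducible set \<open>B\<close>, then a relation
  \<open>\<Sum>\<^sub>k a\<^sub>k f\<^sup>k = 0\<close> on \<open>B\<close> can only involve coefficients that vanish on \<open>A\<close>.\<close>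

lemma relation_descends:
  assumes AB: "A \<subseteq> B"
    and prime: "\<And>f g. f \<in> poly_funs L \<Longrightarrow> g \<in> poly_funs L \<Longrightarrow> (\<forall>p\<in>B. f p * g p = 0) \<Longrightarrow> (\<forall>p\<in>B. f p = 0) \<or> (\<forall>p\<in>B. g p = 0)"
    and f: "f \<in> poly_funs L" "\<forall>p\<in>A. f p = 0" "\<exists>p\<in>B. f p \<noteq> 0"
    and a: "\<And>k. a k \<in> poly_funs L" "\<And>k. k < N \<Longrightarrow> \<forall>p\<in>A. a k p = 0 \<Longrightarrow> \<forall>p\<in>B. a k p = 0"
    and rel: "\<forall>p\<in>B. (\<Sum>k<N. a k p * f p ^ k) = 0"
  shows "k < N \<Longrightarrow> \<forall>p\<in>A. a k p = 0"
proof (induction k rule: less_induct)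
  case (less k)
  define R where "R = (\<lambda>p. a k p + f p * (\<Sum>j\<in>{k<..<N}. a j p * f p ^ (j - Suc k)))"
  have R: "R \<in> poly_funs L" unfolding R_def by (intro poly_funs_intros a(1) f(1))
  have fp: "\<forall>p\<in>B. f p ^ k * R p = 0"
  proof
    fix p assume p: "p \<in> B"
    have split: "{..<N} = {..<k} \<union> ({k} \<union> {k<..<N})" using less.prems by auto
    have "(\<Sum>j<N. a j p * f p ^ j) = (\<Sum>j\<in>{..<k} \<union> ({k} \<union> {k<..<N}). a j p * f p ^ j)"
      by (rule sum.cong[OF split refl])
    also have "\<dots> = (\<Sum>j<k. a j p * f p ^ j) + (\<Sum>j\<in>{k} \<union> {k<..<N}. a j p * f p ^ j)"
      by (rule sum.union_disjoint) auto
    also have "(\<Sum>j<k. a j p * f p ^ j) = 0"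
    proof (rule sum.neutral, rule ballI)
      fix j assume "j \<in> {..<k}"
      then have j: "j < k" "j < N" using less.prems by auto
      from a(2)[OF j(2) less.IH[OF j]] p show "a j p * f p ^ j = 0" by simp
    qed
    also have "(\<Sum>j\<in>{k} \<union> {k<..<N}. a j p * f p ^ j) = a k p * f p ^ k + (\<Sum>j\<in>{k<..<N}. a j p * f p ^ j)"
      by simp
    also have "(\<Sum>j\<in>{k<..<N}. a j p * f p ^ j) = (\<Sum>j\<in>{k<..<N}. f p ^ k * (f p * (a j p * f p ^ (j - Suc k))))"
    proof (rule sum.cong[OF refl])
      fix j assume "j \<in> {k<..<N}"
      then have "j = k + Suc (j - Suc k)" by auto
      then have "f p ^ j = f p ^ k * (f p * f p ^ (j - Suc k))" by (metis power_Suc power_add)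
      then show "a j p * f p ^ j = f p ^ k * (f p * (a j p * f p ^ (j - Suc k)))" by (simp add: mult_ac)
    qed
    finally have "(\<Sum>j<N. a j p * f p ^ j) = f p ^ k * R p"
      by (simp add: R_def sum_distrib_left algebra_simps)
    then show "f p ^ k * R p = 0" using rel p by auto
  qed
  have fk: "\<not> (\<forall>p\<in>B. f p ^ k = 0)"
    using f(3) by auto
  from prime[OF poly_funs_power[OF f(1)] R fp] have "\<forall>p\<in>B. R p = 0"
  proof (elim disjE)
    assume "\<forall>p\<in>B. f p ^ k = 0"
    with fk show ?thesis by contradiction
  qed
  then have "R p = 0" "f p = 0" if "p \<in> A" for p using AB f(2) that by auto
  then show ?case by (simp add: R_def)
qed

context segre
begin

lemma Y_chain_separation:
  assumes "closedin (zar (subvariety cart_space Y)) A" "B \<subseteq> Y" "A \<subset> B"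
  obtains f where "f \<in> poly_funs coords" "\<forall>p\<in>A. f p = 0" "\<exists>p\<in>B. f p \<noteq> 0"
proof -
  obtain T where T: "T \<subseteq> poly_funs coords" "A = {p \<in> Y. \<forall>f\<in>T. f p = 0}"
    using assms(1) quasi_affine_closedin[OF qa_Y] by auto
  obtain b where b: "b \<in> B" "b \<notin> A" using assms(3) by blast
  then obtain f where "f \<in> T" "f b \<noteq> 0" using T assms(2) by auto
  then show ?thesis using that[of f] T b by blast
qed

text \<open>Functions \<open>f0\<close>, \<open>f1\<close>, \<open>f2\<close>, each vanishing on one
  member of the chain but not on the next, satisfy no relation on the fourth member, by three
  descents. Pulled back to the plane and cleared of denominators, the products of their powers below
  \<open>N\<close> lie in a space of dimension quadratic in \<open>N\<close>, while there are
  \<open>N ^ 3\<close> of them.\<close>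

lemma chain_length_le:
  assumes cl: "\<forall>i\<le>n. closedin (zar (subvariety cart_space Y)) (C i) \<and> irreducible_in (zar (subvariety cart_space Y)) (C i)"
    and strict: "\<forall>i<n. C i \<subset> C (Suc i)"
  shows "n \<le> 2"
proof (rule ccontr)
  assume n: "\<not> n \<le> 2"
  have CY: "C i \<subseteq> Y" if "i \<le> n" for i
    using cl that quasi_affine_points[OF qa_Y] unfolding irreducible_in_def points_def by auto
  have ne: "C 0 \<noteq> {}" using cl unfolding irreducible_in_def by auto
  have prime: "(\<forall>p\<in>C i. f p = 0) \<or> (\<forall>p\<in>C i. g p = 0)"
    if "i \<le> n" "f \<in> poly_funs coords" "g \<in> poly_funs coords" "\<forall>p\<in>C i. f p * g p = 0" for i f g
  proof -
    have "irreducible_in (zar (subvariety cart_space Y)) (C i)" using cl that by blast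
    then show ?thesis unfolding quasi_affine_irreducible[OF qa_Y CY[OF that(1)]] using that(2-4) by simp
  qed
  note primes = prime[of "Suc 0"] prime[of "Suc (Suc 0)"] prime[of "Suc (Suc (Suc 0))"]
  have n3: "0 < n" "Suc 0 \<le> n" "Suc 0 < n" "Suc (Suc 0) \<le> n" "Suc (Suc 0) < n" "Suc (Suc (Suc 0)) \<le> n" using n by auto
  have sub: "C i \<subseteq> C (Suc i)" if "i < n" for i using strict that by blast
  have sep: "\<exists>f\<in>poly_funs coords. (\<forall>p\<in>C i. f p = 0) \<and> (\<exists>p\<in>C (Suc i). f p \<noteq> 0)" if i: "i < n" for i
  proof -
    have "closedin (zar (subvariety cart_space Y)) (C i)" "C (Suc i) \<subseteq> Y" "C i \<subset> C (Suc i)"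
      using cl strict i CY[of "Suc i"] by auto
    then obtain f where "f \<in> poly_funs coords" "\<forall>p\<in>C i. f p = 0" "\<exists>p\<in>C (Suc i). f p \<noteq> 0"
      by (rule Y_chain_separation)
    then show ?thesis by blast
  qed
  obtain f0 where f0: "f0 \<in> poly_funs coords" "\<forall>p\<in>C 0. f0 p = 0" "\<exists>p\<in>C (Suc 0). f0 p \<noteq> 0" using sep[of 0] n by auto
  obtain f1 where f1: "f1 \<in> poly_funs coords" "\<forall>p\<in>C (Suc 0). f1 p = 0" "\<exists>p\<in>C (Suc (Suc 0)). f1 p \<noteq> 0" using sep[of "Suc 0"] n by auto
  obtain f2 where f2: "f2 \<in> poly_funs coords" "\<forall>p\<in>C (Suc (Suc 0)). f2 p = 0" "\<exists>p\<in>C (Suc (Suc (Suc 0))). f2 p \<noteq> 0"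
    using sep[of "Suc (Suc 0)"] n by auto
  \<comment> \<open>The start of the descent: on the nonempty set \<open>C 0\<close> a constant
    coefficient vanishes only if it is 0.\<close>
  have L1: "\<forall>i<N. c i = 0" if rel: "\<forall>p\<in>C (Suc 0). (\<Sum>i<N. c i * f0 p ^ i) = 0" for N and c :: "nat \<Rightarrow> complex"
  proof (intro allI impI)
    fix i assume i: "i < N"
    have "\<forall>p\<in>C 0. c i = 0"
    proof (rule relation_descends[where a = "\<lambda>k p. c k" and L = coords and A = "C 0" and B = "C (Suc 0)" and f = f0, OF sub[OF n3(1)] primes(1)[OF n3(2)] f0 _ _ rel i])
      show "(\<lambda>p. c k) \<in> poly_funs coords" for k by (rule poly_funs.const)
      show "\<forall>p\<in>C (Suc 0). c k = 0" if "\<forall>p\<in>C 0. c k = 0" for k using that ne by auto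
    qed
    then show "c i = 0" using ne by auto
  qed
  have L2: "\<forall>j<N. \<forall>i<N. c j i = 0"
    if rel: "\<forall>p\<in>C (Suc (Suc 0)). (\<Sum>j<N. (\<Sum>i<N. c j i * f0 p ^ i) * f1 p ^ j) = 0" for N and c :: "nat \<Rightarrow> nat \<Rightarrow> complex"
  proof (intro allI impI)
    fix j i assume ij: "j < N" "i < N"
    have "\<forall>p\<in>C (Suc 0). (\<Sum>i<N. c j i * f0 p ^ i) = 0"
    proof (rule relation_descends[where a = "\<lambda>j p. (\<Sum>i<N. c j i * f0 p ^ i)" and L = coords and A = "C (Suc 0)" and B = "C (Suc (Suc 0))" and f = f1, OF sub[OF n3(3)] primes(2)[OF n3(4)] f1 _ _ rel ij(1)])
      show "(\<lambda>p. \<Sum>i<N. c k i * f0 p ^ i) \<in> poly_funs coords" for k by (intro poly_funs_intros f0(1))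
      show "\<forall>p\<in>C (Suc (Suc 0)). (\<Sum>i<N. c k i * f0 p ^ i) = 0" if "\<forall>p\<in>C (Suc 0). (\<Sum>i<N. c k i * f0 p ^ i) = 0" for k
        using L1[OF that] by simp
    qed
    then show "c j i = 0" using L1 ij by blast
  qed
  have L3: "\<forall>k<N. \<forall>j<N. \<forall>i<N. c k j i = 0"
    if rel: "\<forall>p\<in>C (Suc (Suc (Suc 0))). (\<Sum>k<N. (\<Sum>j<N. (\<Sum>i<N. c k j i * f0 p ^ i) * f1 p ^ j) * f2 p ^ k) = 0"
    for N and c :: "nat \<Rightarrow> nat \<Rightarrow> nat \<Rightarrow> complex"
  proof (intro allI impI)
    fix k j i assume ij: "k < N" "j < N" "i < N"
    have "\<forall>p\<in>C (Suc (Suc 0)). (\<Sum>j<N. (\<Sum>i<N. c k j i * f0 p ^ i) * f1 p ^ j) = 0"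
    proof (rule relation_descends[where a = "\<lambda>k p. (\<Sum>j<N. (\<Sum>i<N. c k j i * f0 p ^ i) * f1 p ^ j)" and L = coords and A = "C (Suc (Suc 0))" and B = "C (Suc (Suc (Suc 0)))" and f = f2, OF sub[OF n3(5)] primes(3)[OF n3(6)] f2 _ _ rel ij(1)])
      show "(\<lambda>p. (\<Sum>j<N. (\<Sum>i<N. c k j i * f0 p ^ i) * f1 p ^ j)) \<in> poly_funs coords" for k
        by (intro poly_funs_intros f0(1) f1(1))
      show "\<forall>p\<in>C (Suc (Suc (Suc 0))). (\<Sum>j<N. (\<Sum>i<N. c k j i * f0 p ^ i) * f1 p ^ j) = 0"
        if "\<forall>p\<in>C (Suc (Suc 0)). (\<Sum>j<N. (\<Sum>i<N. c k j i * f0 p ^ i) * f1 p ^ j) = 0" for k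
        using L2[OF that] by simp
    qed
    then show "c k j i = 0" using L2 ij by blast
  qed
  obtain n0 G0 where G0: "G0 \<in> poly_funs coords" "\<forall>w. D (par w) \<noteq> 0 \<longrightarrow> G0 w = D (par w) ^ n0 * f0 (toY w)"
    using pull_back[OF f0(1)] by blast
  obtain n1 G1 where G1: "G1 \<in> poly_funs coords" "\<forall>w. D (par w) \<noteq> 0 \<longrightarrow> G1 w = D (par w) ^ n1 * f1 (toY w)"
    using pull_back[OF f1(1)] by blast
  obtain n2 G2 where G2: "G2 \<in> poly_funs coords" "\<forall>w. D (par w) \<noteq> 0 \<longrightarrow> G2 w = D (par w) ^ n2 * f2 (toY w)"
    using pull_back[OF f2(1)] by blast
  \<comment> \<open>A common denominator: on \<open>dom\<close>, each of \<open>F0\<close>,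
    \<open>F1\<close>, \<open>F2\<close> is \<open>H\<close> times a pulled back function.\<close>
  define H where "H = (\<lambda>w. D (par w) ^ (n0 + n1 + n2))"
  define F0 where "F0 = (\<lambda>w. D (par w) ^ (n1 + n2) * G0 w)"
  define F1 where "F1 = (\<lambda>w. D (par w) ^ (n0 + n2) * G1 w)"
  define F2 where "F2 = (\<lambda>w. D (par w) ^ (n0 + n1) * G2 w)"
  have polys: "H \<in> poly_funs coords" "F0 \<in> poly_funs coords" "F1 \<in> poly_funs coords" "F2 \<in> poly_funs coords"
    unfolding H_def F0_def F1_def F2_def by (intro poly_funs_intros poly_par poly_in G0 G1 G2)+
  have HF: "H w \<noteq> 0" "F0 w = H w * f0 (toY w)" "F1 w = H w * f1 (toY w)" "F2 w = H w * f2 (toY w)" if "w \<in> dom" for w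
    using that G0(2) G1(2) G2(2) by (auto simp: dom_def dpar_def H_def F0_def F1_def F2_def power_add)
  obtain e where e: "H \<in> fun_space.span (mons e)" "F0 \<in> fun_space.span (mons e)" "F1 \<in> fun_space.span (mons e)" "F2 \<in> fun_space.span (mons e)"
  proof -
    obtain a b c d where "H \<in> fun_space.span (mons a)" "F0 \<in> fun_space.span (mons b)"
      "F1 \<in> fun_space.span (mons c)" "F2 \<in> fun_space.span (mons d)"
      using polys[THEN poly_funs_span_mons] by auto
    then show ?thesis
      using that[of "a + b + c + d"] mons_mono[of a "a + b + c + d"] mons_mono[of b "a + b + c + d"]
        mons_mono[of c "a + b + c + d"] mons_mono[of d "a + b + c + d"] by auto
  qed
  \<comment> \<open>With this choice
    \<open>(e * (3 * N) + 1) ^ 2 \<le> (3 * e + 1) ^ 2 * N ^ 2 < N ^ 3\<close>, so there are more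
    products than monomials.\<close>
  define N where "N = (3 * e + 1) ^ 2 + 1"
  define I where "I = {..<N} \<times> {..<N} \<times> {..<N}"
  \<comment> \<open>The power of \<open>H\<close> pads each product to degree \<open>3 * N\<close>,
    so that all of them carry the same factor \<open>H w ^ (3 * N)\<close>.\<close>
  define M where "M = (\<lambda>(k, j, i) w. F0 w ^ i * F1 w ^ j * F2 w ^ k * H w ^ (3 * N - i - j - k))"
  have span: "M t \<in> fun_space.span (mons (e * (3 * N)))" if tI: "t \<in> I" for t
  proof -
    obtain k j i where t: "t = (k, j, i)" "k < N" "j < N" "i < N" using tI by (auto simp: I_def)
    have "M t \<in> fun_space.span (mons (e * i + e * j + e * k + e * (3 * N - i - j - k)))"
      unfolding M_def t(1) prod.case by (intro span_mons_mult span_mons_power e)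
    also have "e * i + e * j + e * k + e * (3 * N - i - j - k) = e * (i + j + k + (3 * N - i - j - k))"
      by (simp only: distrib_left)
    also have "i + j + k + (3 * N - i - j - k) = 3 * N" using t by auto
    finally show ?thesis .
  qed
  have "card (mons (e * (3 * N))) \<le> (e * (3 * N) + 1) ^ 2" by (rule mons_card)
  also have "\<dots> \<le> ((3 * e + 1) * N) ^ 2" by (rule power_mono) (auto simp: algebra_simps N_def)
  also have "\<dots> = (3 * e + 1) ^ 2 * N ^ 2" by (rule power_mult_distrib)
  also have "\<dots> < N * N ^ 2" by (rule mult_strict_right_mono) (auto simp: N_def)
  also have "\<dots> = card I" by (simp add: I_def card_cartesian_product power2_eq_square)
  finally have "card (mons (e * (3 * N))) < card I" .
  moreover have "finite I" by (simp add: I_def)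
  ultimately have "\<exists>c. (\<exists>t\<in>I. c t \<noteq> 0) \<and> (\<forall>w. (\<Sum>t\<in>I. c t * M t w) = 0)"
    by (rule linear_relation[OF mons_card(1)]) (rule span)
  then obtain c where c: "\<exists>t\<in>I. c t \<noteq> 0" "\<forall>w. (\<Sum>t\<in>I. c t * M t w) = 0" by (elim exE conjE)
  define P where "P = (\<lambda>p. \<Sum>k<N. (\<Sum>j<N. (\<Sum>i<N. c (k, j, i) * f0 p ^ i) * f1 p ^ j) * f2 p ^ k)"
  have P: "P \<in> poly_funs coords" unfolding P_def by (intro poly_funs_intros f0(1) f1(1) f2(1))
  have "P (toY w) = 0" if w: "w \<in> dom" for w
  proof -
    define R where "R = (\<lambda>t. case t of (k, j, i) \<Rightarrow> c t * f0 (toY w) ^ i * f1 (toY w) ^ j * f2 (toY w) ^ k)"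
    have mt: "c t * M t w = H w ^ (3 * N) * R t"
      if tI: "t \<in> I" for t
    proof -
      obtain k j i where t: "t = (k, j, i)" "k < N" "j < N" "i < N" using tI by (auto simp: I_def)
      have "3 * N = i + j + k + (3 * N - i - j - k)" using t by auto
      then have "H w ^ (3 * N) = H w ^ i * H w ^ j * H w ^ k * H w ^ (3 * N - i - j - k)" by (metis power_add)
      then show ?thesis unfolding M_def R_def t(1) prod.case HF(2-4)[OF w] by (simp add: power_mult_distrib mult_ac)
    qed
    have "H w ^ (3 * N) * (\<Sum>t\<in>I. R t) = (\<Sum>t\<in>I. c t * M t w)"
      unfolding sum_distrib_left by (rule sum.cong[OF refl]) (rule mt[symmetric])
    also have "\<dots> = 0" using c(2) by simp
    finally have "(\<Sum>t\<in>I. R t) = 0" using HF(1)[OF w] by simp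
    then show ?thesis
      unfolding P_def I_def R_def sum.cartesian_product' by (simp add: sum_distrib_right)
  qed
  then have "P p = 0" if "p \<in> Y" for p using vanish_Y[OF P _ that] by blast
  then have "\<forall>p\<in>C (Suc (Suc (Suc 0))). P p = 0" using CY[of "Suc (Suc (Suc 0))"] n by auto
  then have "\<forall>k<N. \<forall>j<N. \<forall>i<N. c (k, j, i) = 0" unfolding P_def by (rule L3)
  then show False using c(1) by (auto simp: I_def)
qed

lemma poly_slice_domain:
  assumes f: "f \<in> poly_funs (coords :: (complex^2 \<Rightarrow> complex) set)" and g: "g \<in> poly_funs coords"
    and 0: "\<And>t. f (p + t *s v) * g (p + t *s v) = 0"
  shows "(\<forall>t. f (p + t *s v) = 0) \<or> (\<forall>t. g (p + t *s v) = 0)"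
proof -
  obtain P where P: "\<forall>t. f (p + t *s v) = poly P t" using poly_funs_line[OF f] by blast
  obtain Q where Q: "\<forall>t. g (p + t *s v) = poly Q t" using poly_funs_line[OF g] by blast
  have "poly (P * Q) t = 0" for t using 0 P Q by (metis poly_mult)
  then have "P * Q = 0" using poly_all_0_iff_0 by blast
  then show ?thesis using P Q by auto
qed

lemma two_points_on_slice:
  assumes w0: "w0 \<in> dom"
  shows "\<exists>t. t \<noteq> 0 \<and> w0 + t *s axis 2 1 \<in> dom"
proof (rule ccontr)
  assume n: "\<not> ?thesis"
  obtain P where P: "\<forall>t. dpar (w0 + t *s axis 2 1) = poly P t" using poly_funs_line[OF dpar_poly] by blast
  have "poly ([:0, 1:] * P) t = 0" for t using n spec[OF P, of t] by (cases "t = 0") (auto simp: dom_def)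
  then have "[:0, 1:] * P = 0" using poly_all_0_iff_0 by blast
  then have "P = 0" by simp
  then show False using spec[OF P, of 0] w0 by (simp add: dom_def)
qed

lemma dom_moves: "\<exists>w\<in>dom. w $ 1 \<noteq> a"
proof (rule ccontr)
  assume "\<not> ?thesis"
  then have "(w $ 1 - a) * dpar w = 0" for w by (auto simp: dom_def)
  then have "(\<forall>w::complex^2. w $ 1 - a = 0) \<or> (\<forall>w. dpar w = 0)"
    by (intro poly_funs_domain dpar_poly poly_funs_intros coords_in)
  moreover obtain w0 where "dpar w0 \<noteq> 0" using dom_nonempty by (auto simp: dom_def)
  ultimately have "\<forall>w::complex^2. w $ 1 = a" by auto
  from spec[OF this, of "\<chi> i. a + 1"] show False by simp
qed

text \<open>The chain consists of a point, the closure of the image of a line with fixed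
  \<open>w $ 1\<close> in the parameter plane, and \<open>Y\<close>.\<close>

lemma chain_exists:
  shows "\<exists>C. (\<forall>i\<le>2. closedin (zar (subvariety cart_space Y)) (C i) \<and> irreducible_in (zar (subvariety cart_space Y)) (C i)) \<and>
      (\<forall>i<2. C i \<subset> C (Suc i))"
proof -
  let ?T = "zar (subvariety cart_space Y)"
  obtain w0 where w0: "w0 \<in> dom" using dom_nonempty by blast
  define L where "L = {w \<in> dom. w $ 1 = w0 $ 1}"
  define C0 where "C0 = {toY w0}"
  define C1 where "C1 = {y \<in> Y. \<forall>f\<in>{f \<in> poly_funs coords. \<forall>w\<in>L. f (toY w) = 0}. f y = 0}"
  have toY: "toY w \<in> Y" if "w \<in> dom" for w using toY_chart[OF that] chartY_sub by blast
  have LC1: "toY w \<in> C1" if "w \<in> L" for w using that toY by (auto simp: C1_def L_def)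
  have slice: "w0 + t *s axis 2 1 \<in> L" if "w0 + t *s axis 2 1 \<in> dom" for t
    using that by (simp add: L_def axis_def)
  have slice': "\<exists>t. w = w0 + t *s axis 2 1" if "w \<in> L" for w
    using that by (intro exI[of _ "w $ 2 - w0 $ 2"]) (simp add: L_def vec_eq_iff forall_2 axis_def)
  have cl0: "closedin ?T C0"
    unfolding quasi_affine_closedin[OF qa_Y]
  proof (intro exI conjI)
    show "range (\<lambda>i y. y $ i - toY w0 $ i) \<subseteq> poly_funs coords"
      by (auto intro!: poly_funs_diff poly_funs.const)
    show "C0 = {p \<in> Y. \<forall>f\<in>range (\<lambda>i y. y $ i - toY w0 $ i). f p = 0}"
      using toY[OF w0] by (auto simp: C0_def vec_eq_iff)
  qed
  have irr0: "irreducible_in ?T C0"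
    using quasi_affine_irreducible[OF qa_Y, of C0] toY[OF w0] by (simp add: C0_def)
  have cl1: "closedin ?T C1"
    unfolding quasi_affine_closedin[OF qa_Y] C1_def
    by (intro exI[of _ "{f \<in> poly_funs coords. \<forall>w\<in>L. f (toY w) = 0}"]) auto
  have C1Y: "C1 \<subseteq> Y" by (auto simp: C1_def)
  have w0L: "w0 \<in> L" using w0 by (simp add: L_def)
  have irr1: "irreducible_in ?T C1"
    unfolding quasi_affine_irreducible[OF qa_Y C1Y]
  proof (intro conjI ballI impI)
    show "C1 \<noteq> {}" using LC1[OF w0L] by blast
    fix f g :: "complex^4 \<Rightarrow> complex"
    assume f: "f \<in> poly_funs coords" and g: "g \<in> poly_funs coords" and 0: "\<forall>p\<in>C1. f p * g p = 0"
    obtain n F1 where F1: "F1 \<in> poly_funs coords" "\<forall>w. D (par w) \<noteq> 0 \<longrightarrow> F1 w = D (par w) ^ n * f (toY w)"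
      using pull_back[OF f] by blast
    obtain k G1 where G1: "G1 \<in> poly_funs coords" "\<forall>w. D (par w) \<noteq> 0 \<longrightarrow> G1 w = D (par w) ^ k * g (toY w)"
      using pull_back[OF g] by blast
    have z: "dpar w * F1 w * G1 w = 0" if w: "w = w0 + t *s axis 2 1" for w t
    proof (cases "w \<in> dom")
      case True
      then have "f (toY w) * g (toY w) = 0" using 0 LC1 slice w by blast
      then show ?thesis using True F1(2) G1(2) by (auto simp: dom_def dpar_def)
    qed (simp add: dom_def)
    have "(\<forall>t. dpar (w0 + t *s axis 2 1) * F1 (w0 + t *s axis 2 1) = 0) \<or> (\<forall>t. G1 (w0 + t *s axis 2 1) = 0)"
      by (rule poly_slice_domain[OF poly_funs.mult[OF dpar_poly F1(1)] G1(1)]) (rule z[OF refl])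
    then have "(\<forall>w\<in>L. dpar w * F1 w = 0) \<or> (\<forall>w\<in>L. G1 w = 0)" using slice' by metis
    moreover have "D (par w) \<noteq> 0" "dpar w \<noteq> 0" if "w \<in> L" for w using that by (auto simp: L_def dom_def dpar_def)
    ultimately have "(\<forall>w\<in>L. f (toY w) = 0) \<or> (\<forall>w\<in>L. g (toY w) = 0)"
      using F1(2) G1(2) by (metis mult_eq_0_iff power_not_zero)
    then show "(\<forall>p\<in>C1. f p = 0) \<or> (\<forall>p\<in>C1. g p = 0)" using f g by (auto simp: C1_def)
  qed
  have s0: "C0 \<subset> C1"
  proof -
    obtain t where t: "t \<noteq> 0" "w0 + t *s axis 2 1 \<in> dom" using two_points_on_slice[OF w0] by blast
    have "w0 + t *s axis 2 1 \<noteq> w0" using t(1) by (simp add: vec_eq_iff forall_2 axis_def)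
    then have "toY (w0 + t *s axis 2 1) \<noteq> toY w0" using fromY_toY[OF w0] fromY_toY[OF t(2)] by metis
    then show ?thesis using LC1[OF slice[OF t(2)]] LC1[OF w0L] by (auto simp: C0_def)
  qed
  have s1: "C1 \<subset> Y"
  proof -
    \<comment> \<open>On the parametrized points this is a nonzero multiple of
      \<open>w $ 1 - w0 $ 1\<close>, so it separates \<open>C1\<close> from
      \<open>Y\<close>.\<close>
    define f where "f = (\<lambda>y. emb y $ 1 - w0 $ 1 * emb y $ 4)"
    have f: "f \<in> poly_funs coords" unfolding f_def by (intro poly_funs_intros emb_poly)
    have v: "f (toY w) = (w $ 1 - w0 $ 1) * (parX w / D (par w))" if "w \<in> dom" for w
      using emb_toY[OF that] by (simp add: f_def algebra_simps diff_divide_distrib)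
    then have "\<forall>w\<in>L. f (toY w) = 0" by (auto simp: L_def)
    then have "f y = 0" if "y \<in> C1" for y using that f by (auto simp: C1_def)
    moreover obtain w where w: "w \<in> dom" "w $ 1 \<noteq> w0 $ 1" using dom_moves by blast
    moreover have "f (toY w) \<noteq> 0" using v[OF w(1)] w by (auto simp: dom_def dpar_def)
    ultimately show ?thesis using C1Y toY[OF w(1)] by blast
  qed
  have clY: "closedin ?T Y" using closedin_topspace[of ?T] unfolding quasi_affine_points[OF qa_Y, unfolded points_def] .
  define C where "C = (\<lambda>i::nat. if i = 0 then C0 else if i = 1 then C1 else Y)"
  show ?thesis
  proof (intro exI[of _ C] conjI allI impI)
    fix i :: nat
    show "closedin ?T (C i)" "irreducible_in ?T (C i)"
      using cl0 irr0 cl1 irr1 clY Y_irreducible by (auto simp: C_def)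
    show "C i \<subset> C (Suc i)" if "i < 2"
      using that s0 s1 by (cases "i = 0") (auto simp: C_def)
  qed
qed

lemma krull_dim_Y: "krull_dim (zar (subvariety cart_space Y)) = 2"
proof (rule antisym)
  show "krull_dim (zar (subvariety cart_space Y)) \<le> 2"
    unfolding krull_dim_def
  proof (rule Sup_least, elim CollectE exE conjE)
    fix k :: enat and n :: nat and C :: "nat \<Rightarrow> (complex^4) set"
    assume k: "k = enat n" and "\<forall>i\<le>n. closedin (zar (subvariety cart_space Y)) (C i) \<and> irreducible_in (zar (subvariety cart_space Y)) (C i)"
      "\<forall>i<n. C i \<subset> C (Suc i)"
    then have "n \<le> 2" using chain_length_le by blast
    then show "k \<le> 2" unfolding k by (metis enat_ord_simps(1) numeral_eq_enat)
  qed
  have "enat 2 \<le> krull_dim (zar (subvariety cart_space Y))"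
    unfolding krull_dim_def using chain_exists by (intro Sup_upper) blast
  then show "2 \<le> krull_dim (zar (subvariety cart_space Y))" by (simp add: numeral_eq_enat)
qed

lemma segre_Y: "affine_segre_surface Y"
proof -
  have "Y = {y. q1 (emb y) = 0} \<inter> {y. q2 (emb y) = 0}" by (auto simp: Y_def cone_def)
  then show ?thesis unfolding affine_segre_surface_def using Y_quadrics krull_dim_Y by blast
qed

text \<open>\<open>Y\<close> is irreducible and hence its own only component.\<close>

lemma local_dim_Y: assumes "p \<in> Y" shows "local_dim (zar (subvariety cart_space Y)) p = 2"
proof -
  let ?T = "zar (subvariety cart_space Y)"
  have top: "topspace ?T = Y" using quasi_affine_points[OF qa_Y] by (simp add: points_def)
  have comp: "irreducible_component ?T Z \<longleftrightarrow> Z = Y" for Z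
  proof
    assume "irreducible_component ?T Z"
    then have "irreducible_in ?T Z" "\<forall>Z'. irreducible_in ?T Z' \<longrightarrow> Z \<subseteq> Z' \<longrightarrow> Z' = Z"
      by (auto simp: irreducible_component_def)
    moreover from this(1) have "Z \<subseteq> Y" by (simp add: irreducible_in_def top)
    ultimately show "Z = Y" using Y_irreducible by metis
  next
    assume "Z = Y"
    moreover have "Z' = Y" if "irreducible_in ?T Z'" "Y \<subseteq> Z'" for Z'
      using that by (auto simp: irreducible_in_def top)
    ultimately show "irreducible_component ?T Z" using Y_irreducible by (simp add: irreducible_component_def)
  qed
  have "subtopology ?T Y = ?T" using subtopology_topspace[of ?T] top by simp
  then have "{krull_dim (subtopology ?T Z) | Z. irreducible_component ?T Z \<and> p \<in> Z} = {krull_dim ?T}"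
    using comp assms by auto
  then show ?thesis unfolding local_dim_def using krull_dim_Y by simp
qed

lemma smooth_Y: "smooth Y"
  unfolding smooth_def using dim_tangent_space_Y local_dim_Y by (simp add: numeral_eq_enat)

end

section \<open>Morphisms from and to a quotient\<close>

lemma points_quotient_subvariety:
  assumes X: "quasi_affine X L S" and Fs: "Fs \<subseteq> S"
  shows "points (subvariety (quotient X orb) (orb ` Fs)) = orb ` Fs"
proof -
  have PX: "points X = S" by (rule quasi_affine_points[OF X])
  have "{p \<in> S. orb p \<in> orb ` S} = S" by auto
  then have "quotient_open X orb (orb ` S)"
    unfolding quotient_open_def PX quasi_affineD(1)[OF X] using zopen_self[of L S] by simp
  then have "points (quotient X orb) = orb ` S"
    unfolding points_def topspace_def openin_quotient unfolding quotient_open_def PX by auto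
  then show ?thesis unfolding points_subvariety using Fs by auto
qed

text \<open>Regular functions on the image of \<open>Fs\<close> must extend locally to the quotient,
  so \<open>\<tau>\<close> is required to be locally rational on the open set
  \<open>d \<noteq> 0\<close> around \<open>Fs\<close>. By invariance its subsets
  \<open>f (\<tau> p) \<noteq> 0\<close> are saturated, and their images are open.\<close>

lemma morphism_from_quotient:
  assumes X: "quasi_affine X L S" and Z: "quasi_affine Z L' Y"
    and Fs: "Fs \<subseteq> S" "\<And>p. p \<in> Fs \<Longrightarrow> d p \<noteq> 0" "\<And>p. p \<in> Fs \<Longrightarrow> \<tau> p \<in> Y"
    and d: "d \<in> poly_funs L"
    and inv: "\<And>p p'. p \<in> S \<Longrightarrow> p' \<in> S \<Longrightarrow> orb p = orb p' \<Longrightarrow> (d p \<noteq> 0 \<longleftrightarrow> d p' \<noteq> 0) \<and> \<tau> p = \<tau> p'"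
    and \<tau>: "\<And>l. l \<in> L' \<Longrightarrow> locrat L {p \<in> S. d p \<noteq> 0} (\<lambda>p. l (\<tau> p))"
    and \<theta>: "\<And>p. p \<in> S \<Longrightarrow> \<theta> (orb p) = \<tau> p"
  shows "morphism (subvariety (quotient X orb) (orb ` Fs)) Z \<theta>"
proof -
  define U0 where "U0 = {p \<in> S. d p \<noteq> 0}"
  have U0: "zopen L S U0" unfolding U0_def by (rule zopen_basic[OF d])
  have PX: "points X = S" by (rule quasi_affine_points[OF X])
  have pts: "points (subvariety (quotient X orb) (orb ` Fs)) = orb ` Fs"
    by (rule points_quotient_subvariety[OF X Fs(1)])
  have good: "quotient_open X orb (orb ` {p \<in> U0. f (\<tau> p) \<noteq> 0})"
     "{p \<in> S. orb p \<in> orb ` {p \<in> U0. f (\<tau> p) \<noteq> 0}} = {p \<in> U0. f (\<tau> p) \<noteq> 0}"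
    if f: "f \<in> poly_funs L'" for f
  proof -
    show e: "{p \<in> S. orb p \<in> orb ` {p \<in> U0. f (\<tau> p) \<noteq> 0}} = {p \<in> U0. f (\<tau> p) \<noteq> 0}"
    proof (intro set_eqI iffI)
      fix p assume "p \<in> {p \<in> S. orb p \<in> orb ` {p \<in> U0. f (\<tau> p) \<noteq> 0}}"
      then obtain p' where "p \<in> S" "p' \<in> U0" "f (\<tau> p') \<noteq> 0" "orb p = orb p'" by auto
      then show "p \<in> {p \<in> U0. f (\<tau> p) \<noteq> 0}" using inv[of p p'] by (auto simp: U0_def)
    qed (auto simp: U0_def)
    have "locrat L U0 (\<lambda>p. f (\<tau> p))"
      using locrat_compose_poly[OF f] \<tau> unfolding U0_def by blast
    then have "zopen L S {p \<in> U0. f (\<tau> p) \<noteq> 0}" by (rule locrat_zopen_preimage[OF _ U0])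
    then show "quotient_open X orb (orb ` {p \<in> U0. f (\<tau> p) \<noteq> 0})"
      unfolding quotient_open_def PX e quasi_affineD(1)[OF X] by (auto simp: U0_def)
  qed
  have op: "openin (zar (quotient X orb)) O' \<longleftrightarrow> quotient_open X orb O'" for O' by (simp add: openin_quotient)
  show ?thesis unfolding morphism_def
  proof (intro conjI allI impI)
    show "continuous_map (zar (subvariety (quotient X orb) (orb ` Fs))) (zar Z) \<theta>"
      unfolding continuous_map_def
    proof (intro conjI allI impI funcsetI)
      show "\<theta> y \<in> topspace (zar Z)" if "y \<in> topspace (zar (subvariety (quotient X orb) (orb ` Fs)))" for y
        using that Fs \<theta> quasi_affine_points[OF Z] pts unfolding points_def by auto
      fix U assume "openin (zar Z) U"
      then obtain T where T: "T \<subseteq> poly_funs L'" "U = {y \<in> Y. \<exists>f\<in>T. f y \<noteq> 0}"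
        unfolding quasi_affineD(1)[OF Z] zopen_def by blast
      define W where "W = (\<Union>f\<in>T. orb ` {p \<in> U0. f (\<tau> p) \<noteq> 0})"
      have "openin (zar (quotient X orb)) W" unfolding W_def
        by (intro openin_Union ballI) (use good(1) T(1) op in auto)
      moreover have "{x \<in> orb ` Fs. \<theta> x \<in> U} = W \<inter> orb ` Fs"
      proof (intro set_eqI iffI)
        fix x assume "x \<in> {x \<in> orb ` Fs. \<theta> x \<in> U}"
        then obtain p where p: "p \<in> Fs" "x = orb p" "\<tau> p \<in> U" using \<theta> Fs(1) by auto
        then obtain f where f: "f \<in> T" "f (\<tau> p) \<noteq> 0" using T by auto
        have "p \<in> U0" using p Fs by (auto simp: U0_def)
        then show "x \<in> W \<inter> orb ` Fs" using p f by (auto simp: W_def)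
      next
        fix x assume "x \<in> W \<inter> orb ` Fs"
        then obtain f p p' where p: "p \<in> Fs" "x = orb p" "p' \<in> U0" "orb p = orb p'" "f \<in> T" "f (\<tau> p') \<noteq> 0"
          by (auto simp: W_def)
        then have "\<tau> p = \<tau> p'" using inv[of p p'] Fs(1) by (auto simp: U0_def)
        then have "f (\<tau> p) \<noteq> 0" using p(6) by simp
        moreover have "\<theta> x = \<tau> p" "\<tau> p \<in> Y" using p(1,2) Fs \<theta> by auto
        ultimately have "\<theta> x \<in> U" using T(2) p(5) by auto
        moreover have "x \<in> orb ` Fs" using p(1,2) by simp
        ultimately show "x \<in> {x \<in> orb ` Fs. \<theta> x \<in> U}" by simp
      qed
      ultimately show "openin (zar (subvariety (quotient X orb) (orb ` Fs)))
          {x \<in> topspace (zar (subvariety (quotient X orb) (orb ` Fs))). \<theta> x \<in> U}"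
        unfolding pts[unfolded points_def] by (auto simp: subvariety_def openin_subtopology)
    qed
    fix U h assume "openin (zar Z) U" "h \<in> regular Z U"
    then have U: "U \<subseteq> Y" "locrat L' U h" using quasi_affineD[OF Z] zopen_subset by blast+
    have "\<exists>W G. openin (zar (quotient X orb)) W \<and> x \<in> W \<and> G \<in> regular (quotient X orb) W \<and>
        (\<forall>y\<in>W \<inter> {x \<in> orb ` Fs. \<theta> x \<in> U}. (h \<circ> \<theta>) y = G y)"
      if "x \<in> {x \<in> orb ` Fs. \<theta> x \<in> U}" for x
    proof -
      from that obtain p where p: "p \<in> Fs" "x = orb p" "\<tau> p \<in> U" using \<theta> Fs(1) by auto
      obtain a b where ab: "a \<in> poly_funs L'" "b \<in> poly_funs L'" "b (\<tau> p) \<noteq> 0"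
        "\<And>y. y \<in> U \<Longrightarrow> b y \<noteq> 0 \<Longrightarrow> h y = a y / b y"
        by (rule locratE[OF U(2) p(3)]) blast
      define P where "P = {p \<in> U0. b (\<tau> p) \<noteq> 0}"
      define W where "W = orb ` P"
      have W: "quotient_open X orb W" "{p \<in> S. orb p \<in> W} = P"
        using good[OF ab(2)] by (simp_all add: W_def P_def)
      have PS: "P \<subseteq> S" by (auto simp: P_def U0_def)
      define G where "G = (\<lambda>x. a (\<theta> x) / b (\<theta> x))"
      have "locrat L P (\<lambda>p. a (\<tau> p) / b (\<tau> p))"
      proof (rule locrat_divide)
        have "locrat L U0 (\<lambda>p. f (\<tau> p))" if "f \<in> poly_funs L'" for f
          using locrat_compose_poly[OF that] \<tau> unfolding U0_def by blast
        then show "locrat L P (\<lambda>p. a (\<tau> p))" "locrat L P (\<lambda>p. b (\<tau> p))"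
          using ab(1,2) locrat_subset[of L U0 _ P] by (auto simp: P_def)
      qed (auto simp: P_def)
      then have "locrat L P (G \<circ> orb)" by (rule locrat_congI) (use PS \<theta> in \<open>auto simp: G_def\<close>)
      moreover have "zopen L S P" using W(1) unfolding quotient_open_def PX quasi_affineD(1)[OF X] W(2) by blast
      ultimately have "G \<in> regular (quotient X orb) W"
        unfolding quotient_def using quasi_affineD(2)[OF X] by (simp add: PX W(2))
      moreover have "x \<in> W" using p ab(3) Fs by (auto simp: W_def P_def U0_def)
      moreover have "(h \<circ> \<theta>) y = G y" if "y \<in> W \<inter> {x \<in> orb ` Fs. \<theta> x \<in> U}" for y
      proof -
        from that obtain p' where p': "p' \<in> P" "y = orb p'" "\<theta> y \<in> U" by (auto simp: W_def)
        then have "b (\<theta> y) \<noteq> 0" using \<theta> PS by (auto simp: P_def)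
        then show ?thesis using ab(4) p' by (simp add: G_def)
      qed
      ultimately show ?thesis using W(1) op by blast
    qed
    then show "h \<circ> \<theta> \<in> regular (subvariety (quotient X orb) (orb ` Fs))
        {p \<in> points (subvariety (quotient X orb) (orb ` Fs)). \<theta> p \<in> U}"
      unfolding pts by (simp add: subvariety_def)
  qed
qed

text \<open>An open set or a regular function on the quotient is pulled back first to
  \<open>S\<close> along \<open>orb\<close> and then to \<open>Y\<close> along a local section
  \<open>s\<close>.\<close>

lemma morphism_to_quotient:
  assumes X: "quasi_affine X L S" and Z: "quasi_affine Z L' Y"
    and im: "\<And>y. y \<in> Y \<Longrightarrow> \<psi> y \<in> orb ` Fs" and Fs: "Fs \<subseteq> S"
    and sect: "\<And>y. y \<in> Y \<Longrightarrow> \<exists>k\<in>poly_funs L'. \<exists>s. k y \<noteq> 0 \<and>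
        (\<forall>y'\<in>Y. k y' \<noteq> 0 \<longrightarrow> s y' \<in> S \<and> \<psi> y' = orb (s y')) \<and>
        (\<forall>l\<in>L. locrat L' {y'\<in>Y. k y' \<noteq> 0} (\<lambda>y. l (s y)))"
  shows "morphism Z (subvariety (quotient X orb) (orb ` Fs)) \<psi>"
proof -
  have PX: "points X = S" by (rule quasi_affine_points[OF X])
  have op: "zopen L' Y {y \<in> Y. \<psi> y \<in> W}" if W: "quotient_open X orb W" for W
  proof (rule zopenI)
    fix y assume y: "y \<in> {y \<in> Y. \<psi> y \<in> W}"
    then obtain k s where k: "k \<in> poly_funs L'" "k y \<noteq> 0" "\<forall>y'\<in>Y. k y' \<noteq> 0 \<longrightarrow> s y' \<in> S \<and> \<psi> y' = orb (s y')"
      "\<forall>l\<in>L. locrat L' {y'\<in>Y. k y' \<noteq> 0} (\<lambda>y. l (s y))" using sect[of y] by blast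
    have PW: "zopen L S {p \<in> S. orb p \<in> W}" using W unfolding quotient_open_def PX quasi_affineD(1)[OF X] by blast
    have "s y \<in> {p \<in> S. orb p \<in> W}" using k y by auto
    then obtain k2 where k2: "k2 \<in> poly_funs L" "k2 (s y) \<noteq> 0" "\<And>p. p \<in> S \<Longrightarrow> k2 p \<noteq> 0 \<Longrightarrow> p \<in> {p \<in> S. orb p \<in> W}"
      by (rule zopen_basisE[OF PW]) blast
    have "locrat L' {y'\<in>Y. k y' \<noteq> 0} (\<lambda>y. k2 (s y))" by (rule locrat_compose_poly[OF k2(1)]) (use k(4) in blast)
    from locrat_zopen_preimage[OF this zopen_basic[OF k(1)]]
    have zo: "zopen L' Y {p \<in> {y' \<in> Y. k y' \<noteq> 0}. k2 (s p) \<noteq> 0}" .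
    have "y \<in> {p \<in> {y' \<in> Y. k y' \<noteq> 0}. k2 (s p) \<noteq> 0}" using y k k2 by auto
    then obtain k3 where k3: "k3 \<in> poly_funs L'" "k3 y \<noteq> 0"
      "\<And>p. p \<in> Y \<Longrightarrow> k3 p \<noteq> 0 \<Longrightarrow> p \<in> {p \<in> {y' \<in> Y. k y' \<noteq> 0}. k2 (s p) \<noteq> 0}"
      by (rule zopen_basisE[OF zo]) blast
    have "y' \<in> {y \<in> Y. \<psi> y \<in> W}" if "y' \<in> Y" "k3 y' \<noteq> 0" for y'
    proof -
      have "k y' \<noteq> 0" "k2 (s y') \<noteq> 0" using k3(3)[OF that] by auto
      then have "s y' \<in> S" "\<psi> y' = orb (s y')" "k2 (s y') \<noteq> 0" using k(3) that by auto
      then show ?thesis using k2(3)[of "s y'"] that by auto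
    qed
    then show "\<exists>k\<in>poly_funs L'. k y \<noteq> 0 \<and> (\<forall>y'\<in>Y. k y' \<noteq> 0 \<longrightarrow> y' \<in> {y \<in> Y. \<psi> y \<in> W})"
      using k3 by blast
  qed auto
  have top: "\<psi> y \<in> topspace (zar (quotient X orb))" if "y \<in> Y" for y
  proof -
    have "{p \<in> S. orb p \<in> orb ` S} = S" by auto
    then have "quotient_open X orb (orb ` S)"
      unfolding quotient_open_def PX quasi_affineD(1)[OF X] using zopen_self[of L S] by simp
    then have "openin (zar (quotient X orb)) (orb ` S)" by (simp add: openin_quotient)
    then show ?thesis using im[OF that] Fs openin_subset by blast
  qed
  show ?thesis unfolding morphism_def
  proof (intro conjI allI impI)
    show "continuous_map (zar Z) (zar (subvariety (quotient X orb) (orb ` Fs))) \<psi>"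
      unfolding continuous_map_def
    proof (intro conjI allI impI funcsetI)
      show "\<psi> y \<in> topspace (zar (subvariety (quotient X orb) (orb ` Fs)))" if "y \<in> topspace (zar Z)" for y
        using that im top quasi_affine_points[OF Z] by (simp add: subvariety_def points_def)
      fix U assume "openin (zar (subvariety (quotient X orb) (orb ` Fs))) U"
      then obtain W where W: "quotient_open X orb W" "U = W \<inter> orb ` Fs"
        by (auto simp: subvariety_def openin_subtopology openin_quotient)
      have "{y \<in> Y. \<psi> y \<in> U} = {y \<in> Y. \<psi> y \<in> W}" using W im by auto
      then show "openin (zar Z) {y \<in> topspace (zar Z). \<psi> y \<in> U}"
        using op[OF W(1)] quasi_affine_points[OF Z] quasi_affineD(1)[OF Z] by (simp add: points_def)
    qed
    fix U h assume U: "openin (zar (subvariety (quotient X orb) (orb ` Fs))) U"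
      and h: "h \<in> regular (subvariety (quotient X orb) (orb ` Fs)) U"
    obtain WU where WU: "quotient_open X orb WU" "U = WU \<inter> orb ` Fs"
      using U by (auto simp: subvariety_def openin_subtopology openin_quotient)
    have UY: "{y \<in> Y. \<psi> y \<in> U} = {y \<in> Y. \<psi> y \<in> WU}" using WU im by auto
    have "locrat L' {y \<in> Y. \<psi> y \<in> U} (h \<circ> \<psi>)"
    proof (rule locrat_local)
      fix y assume y: "y \<in> {y \<in> Y. \<psi> y \<in> U}"
      then obtain W G where W: "quotient_open X orb W" "\<psi> y \<in> W" "G \<in> regular (quotient X orb) W" "\<forall>z\<in>W \<inter> U. h z = G z"
        using h by (auto simp: subvariety_def openin_quotient)
      have PW: "zopen L S {p \<in> S. orb p \<in> W}" using W(1) unfolding quotient_open_def PX quasi_affineD(1)[OF X] by blast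
      have G: "locrat L {p \<in> S. orb p \<in> W} (G \<circ> orb)"
        using W(3) quasi_affineD(2)[OF X PW] by (simp add: quotient_def PX)
      obtain k s where k: "k \<in> poly_funs L'" "k y \<noteq> 0" "\<forall>y'\<in>Y. k y' \<noteq> 0 \<longrightarrow> s y' \<in> S \<and> \<psi> y' = orb (s y')"
        "\<forall>l\<in>L. locrat L' {y'\<in>Y. k y' \<noteq> 0} (\<lambda>y. l (s y))" using sect[of y] y by blast
      obtain k2 where k2: "k2 \<in> poly_funs L'" "k2 y \<noteq> 0" "\<And>p. p \<in> Y \<Longrightarrow> k2 p \<noteq> 0 \<Longrightarrow> p \<in> {y \<in> Y. \<psi> y \<in> W}"
        by (rule zopen_basisE[OF op[OF W(1)], of y]) (use y W in auto)
      define N where "N = {y' \<in> {y \<in> Y. \<psi> y \<in> U}. k y' * k2 y' \<noteq> 0}"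
      have NY: "N \<subseteq> {y'\<in>Y. k y' \<noteq> 0}" by (auto simp: N_def)
      have NW: "\<psi> y' \<in> W \<inter> U" "\<psi> y' = orb (s y')" "s y' \<in> S" if "y' \<in> N" for y'
        using that k(3) k2(3)[of y'] by (auto simp: N_def)
      have "locrat L' N (\<lambda>y'. (G \<circ> orb) (s y'))"
        by (rule locrat_compose[OF G]) (use k(4) NW locrat_subset[OF _ NY] in auto)
      then have "locrat L' N (h \<circ> \<psi>)" by (rule locrat_congI) (use NW W(4) in auto)
      then show "\<exists>k\<in>poly_funs L'. k y \<noteq> 0 \<and> locrat L' {y \<in> {y \<in> Y. \<psi> y \<in> U}. k y \<noteq> 0} (h \<circ> \<psi>)"
        using k k2 unfolding N_def by (intro bexI[of _ "\<lambda>y. k y * k2 y"]) (auto intro: poly_funs.mult)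
    qed
    then show "h \<circ> \<psi> \<in> regular Z {p \<in> points Z. \<psi> p \<in> U}"
      using quasi_affineD(2)[OF Z op[OF WU(1)]] quasi_affine_points[OF Z] UY by simp
  qed
qed

section \<open>The space of monodromy data\<close>

lemma D2_diag_nz: assumes "\<Delta> \<in> D2" shows "\<Delta> $ i $ i \<noteq> 0"
proof -
  have "\<Delta> $ 1 $ 2 = 0" "\<Delta> $ 2 $ 1 = 0" using assms by (simp_all add: D2_def)
  moreover have "det \<Delta> \<noteq> 0" using assms by (simp add: D2_def invertible_det_nz)
  ultimately have "\<Delta> $ 1 $ 1 \<noteq> 0" "\<Delta> $ 2 $ 2 \<noteq> 0" by (auto simp: det_2)
  then show ?thesis using exhaust_2[of i] by auto
qed

lemma matrix_inv_D2:
  assumes "\<Delta> \<in> D2" shows "matrix_inv \<Delta> = (\<chi> i j. if i = j then 1 / \<Delta> $ i $ i else 0)"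
proof -
  define E :: "complex^2^2" where "E = (\<chi> i j. if i = j then 1 / \<Delta> $ i $ i else 0)"
  have "\<Delta> $ 1 $ 2 = 0" "\<Delta> $ 2 $ 1 = 0" using assms by (simp_all add: D2_def)
  then have DE: "\<Delta> ** E = mat 1"
    using D2_diag_nz[OF assms] by (simp add: vec_eq_iff forall_2 matrix_matrix_mult_def sum_2 E_def mat_def)
  have "matrix_inv \<Delta> = matrix_inv \<Delta> ** (\<Delta> ** E)" unfolding DE by simp
  also have "\<dots> = (matrix_inv \<Delta> ** \<Delta>) ** E" by (simp add: matrix_mul_assoc)
  also have "matrix_inv \<Delta> ** \<Delta> = mat 1"
  proof -
    have "\<exists>A'. \<Delta> ** A' = mat 1 \<and> A' ** \<Delta> = mat 1" using assms by (simp add: D2_def invertible_def)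
    from someI_ex[OF this] show ?thesis unfolding matrix_inv_def by blast
  qed
  finally show ?thesis unfolding E_def by simp
qed

text \<open>The torus action with the inverses of the entries of \<open>\<Delta>\<close> as second
  parameter, which makes it multiplicative in both.\<close>

definition scale :: "complex^2 \<Rightarrow> complex^2 \<Rightarrow> fun_matrix \<Rightarrow> fun_matrix" where
  "scale \<gamma> \<delta> M = (\<chi> i j. (\<lambda>z. \<gamma> $ i * \<delta> $ j * (M $ i $ j) z))"

lemma act_eq_scale:
  assumes "\<Gamma> \<in> D2" "\<Delta> \<in> D2"
  shows "act \<Gamma> \<Delta> M = scale (\<chi> i. \<Gamma> $ i $ i) (\<chi> j. 1 / \<Delta> $ j $ j) M"
proof -
  have "\<Gamma> $ 1 $ 2 = 0" "\<Gamma> $ 2 $ 1 = 0" using assms by (simp_all add: D2_def)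
  then show ?thesis
    unfolding act_def scale_def matrix_inv_D2[OF assms(2)]
    by (simp add: vec_eq_iff forall_2 matrix_matrix_mult_def sum_2 mat_at_def fun_eq_iff)
qed

lemma orbit_eq: "orbit M = {scale \<gamma> \<delta> M | \<gamma> \<delta>. \<forall>i. \<gamma> $ i \<noteq> 0 \<and> \<delta> $ i \<noteq> 0}"
proof (intro set_eqI iffI)
  fix N assume "N \<in> orbit M"
  then obtain \<Gamma> \<Delta> where "\<Gamma> \<in> D2" "\<Delta> \<in> D2" "N = act \<Gamma> \<Delta> M" unfolding orbit_def by blast
  then have "N = scale (\<chi> i. \<Gamma> $ i $ i) (\<chi> j. 1 / \<Delta> $ j $ j) M"
    "\<forall>i. (\<chi> i. \<Gamma> $ i $ i) $ i \<noteq> 0 \<and> (\<chi> j. 1 / \<Delta> $ j $ j) $ i \<noteq> 0"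
    using D2_diag_nz by (simp_all add: act_eq_scale)
  then show "N \<in> {scale \<gamma> \<delta> M | \<gamma> \<delta>. \<forall>i. \<gamma> $ i \<noteq> 0 \<and> \<delta> $ i \<noteq> 0}" by blast
next
  fix N assume "N \<in> {scale \<gamma> \<delta> M | \<gamma> \<delta>. \<forall>i. \<gamma> $ i \<noteq> 0 \<and> \<delta> $ i \<noteq> 0}"
  then obtain \<gamma> \<delta> where N: "N = scale \<gamma> \<delta> M" "\<forall>i. \<gamma> $ i \<noteq> 0 \<and> \<delta> $ i \<noteq> 0" by blast
  define \<Gamma> :: "complex^2^2" where "\<Gamma> = (\<chi> i j. if i = j then \<gamma> $ i else 0)"
  define \<Delta> :: "complex^2^2" where "\<Delta> = (\<chi> i j. if i = j then 1 / \<delta> $ i else 0)"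
  have "\<Gamma> \<in> D2" "\<Delta> \<in> D2"
    using N(2) by (auto simp: D2_def invertible_det_nz det_2 \<Gamma>_def \<Delta>_def)
  moreover have "act \<Gamma> \<Delta> M = N"
    unfolding act_eq_scale[OF calculation] N(1) by (simp add: scale_def \<Gamma>_def \<Delta>_def vec_eq_iff)
  ultimately show "N \<in> orbit M" unfolding orbit_def by blast
qed

lemma scale_scale: "scale \<gamma> \<delta> (scale \<gamma>' \<delta>' M) = scale (\<chi> i. \<gamma> $ i * \<gamma>' $ i) (\<chi> i. \<delta> $ i * \<delta>' $ i) M"
proof -
  have 1: "a * b * (a' * b' * m) = (a * a') * (b * b') * m" for a b a' b' m :: complex by algebra
  show ?thesis unfolding scale_def vec_lambda_beta by (simp only: 1)
qed

lemma orbitI: "(\<And>i. \<gamma> $ i \<noteq> 0) \<Longrightarrow> (\<And>i. \<delta> $ i \<noteq> 0) \<Longrightarrow> scale \<gamma> \<delta> M \<in> orbit M"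
  unfolding orbit_eq by blast

lemma scale_inverse:
  assumes "\<And>i. \<gamma> $ i \<noteq> 0" "\<And>i. \<delta> $ i \<noteq> 0"
  shows "scale \<gamma>' \<delta>' M = scale (\<chi> i. \<gamma>' $ i / \<gamma> $ i) (\<chi> i. \<delta>' $ i / \<delta> $ i) (scale \<gamma> \<delta> M)"
proof -
  have "(\<chi> i. (\<chi> i. \<gamma>' $ i / \<gamma> $ i) $ i * \<gamma> $ i) = \<gamma>'" "(\<chi> i. (\<chi> i. \<delta>' $ i / \<delta> $ i) $ i * \<delta> $ i) = \<delta>'"
    using assms by (simp_all add: vec_eq_iff)
  then show ?thesis unfolding scale_scale by (simp only:)
qed

lemma orbit_scale:
  assumes "\<forall>i. \<gamma> $ i \<noteq> 0 \<and> \<delta> $ i \<noteq> 0" shows "orbit (scale \<gamma> \<delta> M) = orbit M"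
proof (intro set_eqI iffI)
  fix N assume "N \<in> orbit (scale \<gamma> \<delta> M)"
  then obtain \<gamma>' \<delta>' where N: "N = scale \<gamma>' \<delta>' (scale \<gamma> \<delta> M)" "\<forall>i. \<gamma>' $ i \<noteq> 0 \<and> \<delta>' $ i \<noteq> 0" unfolding orbit_eq by blast
  show "N \<in> orbit M" unfolding N(1) scale_scale by (rule orbitI) (use assms N(2) in auto)
next
  fix N assume "N \<in> orbit M"
  then obtain \<gamma>' \<delta>' where N: "N = scale \<gamma>' \<delta>' M" "\<forall>i. \<gamma>' $ i \<noteq> 0 \<and> \<delta>' $ i \<noteq> 0" unfolding orbit_eq by blast
  note N(1)
  also have "scale \<gamma>' \<delta>' M = scale (\<chi> i. \<gamma>' $ i / \<gamma> $ i) (\<chi> i. \<delta>' $ i / \<delta> $ i) (scale \<gamma> \<delta> M)"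
    by (rule scale_inverse) (use assms in auto)
  also have "\<dots> \<in> orbit (scale \<gamma> \<delta> M)" by (rule orbitI) (use assms N(2) in auto)
  finally show "N \<in> orbit (scale \<gamma> \<delta> M)" .
qed

lemma scale_one: "scale (\<chi> i. 1) (\<chi> i. 1) M = M"
  by (simp add: scale_def vec_eq_iff)

lemma orbit_self: "M \<in> orbit M"
  unfolding orbit_eq using scale_one[of M] by (intro CollectI exI[of _ "\<chi> i. 1"]) auto

lemma orbit_cases:
  assumes "orbit M = orbit N"
  obtains \<gamma> \<delta> where "N = scale \<gamma> \<delta> M" "\<forall>i. \<gamma> $ i \<noteq> 0 \<and> \<delta> $ i \<noteq> 0"
proof -
  have "N \<in> orbit M" using orbit_self[of N] assms by simp
  then show ?thesis using that unfolding orbit_eq by blast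
qed

definition mcomb :: "complex \<Rightarrow> fun_matrix \<Rightarrow> complex \<Rightarrow> fun_matrix \<Rightarrow> fun_matrix" where
  "mcomb a M b N = (\<chi> i j. (\<lambda>z. a * (M $ i $ j) z + b * (N $ i $ j) z))"

lemma theta_space_lincomb:
  assumes "m \<in> theta_space q c" "n \<in> theta_space q c"
  shows "(\<lambda>z. a * m z + b * n z) \<in> theta_space q c"
  using assms by (auto simp: theta_space_def algebra_simps add_divide_distrib intro!: holomorphic_intros)

lemma mcomb_V: "M \<in> V q \<rho> \<sigma> \<Longrightarrow> N \<in> V q \<rho> \<sigma> \<Longrightarrow> mcomb a M b N \<in> V q \<rho> \<sigma>"
  by (auto simp: V_def mcomb_def intro: theta_space_lincomb)

lemma zero_theta_space: "(\<lambda>_. 0) \<in> theta_space q c"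
  by (simp add: theta_space_def)

definition zeroM :: fun_matrix where "zeroM = (\<chi> i j. (\<lambda>_. 0))"

text \<open>Linear combinations as lists: linearity of an element of \<open>V_dual\<close>, given
  for two summands, extends to any number by induction.\<close>

fun build :: "(complex \<times> fun_matrix) list \<Rightarrow> fun_matrix" where
  "build [] = zeroM"
| "build ((c, E) # xs) = mcomb c E 1 (build xs)"

lemma build_V: "\<forall>(c, E)\<in>set xs. E \<in> V q \<rho> \<sigma> \<Longrightarrow> build xs \<in> V q \<rho> \<sigma>"
  by (induction xs) (auto intro: mcomb_V, simp add: zeroM_def V_def zero_theta_space)

lemma V_dual_mcomb: "l \<in> V_dual q \<rho> \<sigma> \<Longrightarrow> M \<in> V q \<rho> \<sigma> \<Longrightarrow> N \<in> V q \<rho> \<sigma> \<Longrightarrow> l (mcomb a M b N) = a * l M + b * l N"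
  by (simp add: V_dual_def mcomb_def)

lemma V_dual_build:
  assumes l: "l \<in> V_dual q \<rho> \<sigma>" and "\<forall>(c, E)\<in>set xs. E \<in> V q \<rho> \<sigma>"
  shows "l (build xs) = (\<Sum>(c, E)\<leftarrow>xs. c * l E)"
  using assms(2)
proof (induction xs)
  case Nil
  have z: "zeroM \<in> V q \<rho> \<sigma>" by (simp add: zeroM_def V_def zero_theta_space)
  have "mcomb 0 zeroM 0 zeroM = zeroM" by (simp add: mcomb_def zeroM_def)
  then show ?case using V_dual_mcomb[OF l z z, of 0 0] by simp
next
  case (Cons a xs)
  obtain c E where a: "a = (c, E)" by (cases a)
  have b: "build xs \<in> V q \<rho> \<sigma>" by (rule build_V) (use Cons.prems in auto)
  have "E \<in> V q \<rho> \<sigma>" using Cons.prems a by simp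
  from V_dual_mcomb[OF l this b, of c 1] show ?case using Cons a by simp
qed

lemma eval_V_dual: "(\<lambda>M. (M $ i $ j) z) \<in> V_dual q \<rho> \<sigma>"
  by (simp add: V_dual_def)

lemma eval_poly: "(\<lambda>M. (M $ i $ j) z) \<in> poly_funs (V_dual q \<rho> \<sigma>)"
  by (rule poly_funs.gen[OF eval_V_dual])

text \<open>The factor \<open>t\<close> is read off at a nonzero entry and forces
  \<open>c / t\<close> on the other side. This makes each fiber of \<open>tau\<close> a single
  orbit.\<close>

lemma rank_one_unique:
  fixes a b a' b' :: "complex^2"
  assumes c: "c \<noteq> 0" and nz: "\<exists>i j. a $ i * b $ j \<noteq> 0" and e: "\<And>i j. a' $ i * b' $ j = c * (a $ i * b $ j)"
  shows "\<exists>t. t \<noteq> 0 \<and> (\<forall>i. a' $ i = t * a $ i) \<and> (\<forall>i. b' $ i = c / t * b $ i)"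
proof -
  obtain i j where ij: "a $ i * b $ j \<noteq> 0" using nz by blast
  then have ij': "a' $ i * b' $ j \<noteq> 0" using e c by simp
  define t where "t = a' $ i / a $ i"
  have t: "t \<noteq> 0" "a' $ i = t * a $ i" using ij ij' by (auto simp: t_def)
  have b': "b' $ l = c / t * b $ l" for l
  proof -
    have "t * a $ i * b' $ l = c * (a $ i * b $ l)" using e[of i l] t by simp
    then have "a $ i * (t * b' $ l) = a $ i * (c * b $ l)" by (simp add: mult_ac)
    then have "t * b' $ l = c * b $ l" using ij by simp
    then show ?thesis using t by (simp add: field_simps)
  qed
  have "a' $ k = t * a $ k" for k
  proof -
    have "a' $ k * (c / t * b $ j) = c * (a $ k * b $ j)" using e[of k j] b' by simp
    then have "(c * b $ j) * a' $ k = (c * b $ j) * (t * a $ k)" using t by (simp add: field_simps)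
    then show ?thesis using ij c by simp
  qed
  then show ?thesis using t b' by blast
qed

text \<open>Expanded in the bases, \<open>det M(x0)\<close> is linear in the eight tensor entries.
  The equations at the first three points express three entries of the second tensor by the five
  coordinates in \<open>tens\<close>; \<open>d\<close> collects the resulting coefficients.\<close>

locale theta_params = theta_bases q \<rho> \<sigma> x f g x0 for q \<rho> \<sigma> x f g x0 +
  fixes s1 s2 :: complex and d :: "complex^5"
  assumes s1_eq: "s1 * (f 1 2 (x $ 1) * f 2 1 (x $ 1)) = f 1 1 (x $ 1) * f 2 2 (x $ 1)"
    and s2_eq: "s2 * (g 1 2 (x $ 2) * g 2 1 (x $ 2)) = g 1 1 (x $ 2) * g 2 2 (x $ 2)"
    and d1: "d $ 1 = f 1 1 x0 * f 2 2 x0 - s1 * (f 1 2 x0 * f 2 1 x0) - (1 - s1) * (f 1 2 x0 * g 2 1 x0)"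
    and d2: "d $ 2 = g 1 1 x0 * g 2 2 x0 - s2 * (g 1 2 x0 * g 2 1 x0) - (1 - s2) * (f 1 2 x0 * g 2 1 x0)"
    and d3: "d $ 3 = f 1 1 x0 * g 2 2 x0 - f 1 2 x0 * g 2 1 x0"
    and d4: "d $ 4 = g 1 1 x0 * f 2 2 x0 - f 1 2 x0 * g 2 1 x0"
    and d5: "d $ 5 = f 1 2 x0 * g 2 1 x0 - g 1 2 x0 * f 2 1 x0"
begin

text \<open>The coefficients with respect to \<open>f i j\<close> and \<open>g i j\<close>, written
  through values at points where one of the two vanishes, so that they are visibly linear forms in
  \<open>M\<close>.\<close>

definition ca :: "fun_matrix \<Rightarrow> 2 \<Rightarrow> 2 \<Rightarrow> complex" where "ca M i j = (M $ i $ j) (x $ 1) / f i j (x $ 1)"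
definition cb :: "fun_matrix \<Rightarrow> 2 \<Rightarrow> 2 \<Rightarrow> complex" where "cb M i j = (M $ i $ j) (x $ 2) / g i j (x $ 2)"

definition ofc :: "(2 \<Rightarrow> 2 \<Rightarrow> complex) \<Rightarrow> (2 \<Rightarrow> 2 \<Rightarrow> complex) \<Rightarrow> fun_matrix" where
  "ofc a b = (\<chi> i j. (\<lambda>z. a i j * f i j z + b i j * g i j z))"

lemma ofc_V: "ofc a b \<in> V q \<rho> \<sigma>"
  by (simp add: V_def ofc_def theta_space_lincomb[OF f_in g_in])

lemma ca_ofc: "ca (ofc a b) i j = a i j" and cb_ofc: "cb (ofc a b) i j = b i j"
  using f1 f2 g1 g2 by (simp_all add: ca_def cb_def ofc_def)

lemma V_expand: assumes "M \<in> V q \<rho> \<sigma>" shows "M $ i $ j = (\<lambda>z. ca M i j * f i j z + cb M i j * g i j z)"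
proof -
  have "M $ i $ j \<in> theta_space q (\<rho> $ i / \<sigma> $ j)" using assms by (simp add: V_def)
  then obtain a b where ab: "M $ i $ j = (\<lambda>z. a * f i j z + b * g i j z)" using span by blast
  then have "ca M i j = a" "cb M i j = b" using f1 f2 g1 g2 by (simp_all add: ca_def cb_def)
  then show ?thesis using ab by simp
qed

lemma ofc_coords: "M \<in> V q \<rho> \<sigma> \<Longrightarrow> ofc (ca M) (cb M) = M"
  by (simp add: ofc_def vec_eq_iff V_expand)

text \<open>The entries of \<open>tens M\<close> are those of the tensor \<open>m\<^sub>1\<^sub>1 \<otimes> m\<^sub>2\<^sub>2\<close> together with one entry of
  \<open>m\<^sub>1\<^sub>2 \<otimes> m\<^sub>2\<^sub>1\<close>; on \<open>F\<close> the latter tensor is determined by them.\<close>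

definition tens :: "fun_matrix \<Rightarrow> complex^5" where
  "tens M = (\<chi> i. if i = 1 then ca M 1 1 * ca M 2 2 else if i = 2 then cb M 1 1 * cb M 2 2
     else if i = 3 then ca M 1 1 * cb M 2 2 else if i = 4 then cb M 1 1 * ca M 2 2 else cb M 1 2 * ca M 2 1)"

lemma tens_nth [simp]: "tens M $ 1 = ca M 1 1 * ca M 2 2" "tens M $ 2 = cb M 1 1 * cb M 2 2"
  "tens M $ 3 = ca M 1 1 * cb M 2 2" "tens M $ 4 = cb M 1 1 * ca M 2 2" "tens M $ 5 = cb M 1 2 * ca M 2 1"
  by (simp_all add: tens_def)

text \<open>This is \<open>lin (tens M)\<close>, spelled out before \<open>s1\<close>,
  \<open>s2\<close>, \<open>d\<close> are known to satisfy the assumptions of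
  \<open>segre\<close>.\<close>

definition clin :: "fun_matrix \<Rightarrow> complex" where
  "clin M = tens M $ 3 + tens M $ 4 + (1 - s1) * tens M $ 1 + (1 - s2) * tens M $ 2"

text \<open>All \<open>g i j\<close> vanish at \<open>x $ 1\<close>, so only one entry of each
  tensor survives in the determinant.\<close>

lemma det_x1: assumes "M \<in> V q \<rho> \<sigma>"
  shows "det (mat_at M (x $ 1)) = 0 \<longleftrightarrow> ca M 1 2 * ca M 2 1 = s1 * (ca M 1 1 * ca M 2 2)"
proof -
  define K where "K = f 1 2 (x $ 1) * f 2 1 (x $ 1)"
  have K: "K \<noteq> 0" using f1 by (simp add: K_def)
  have "det (mat_at M (x $ 1)) = ca M 1 1 * ca M 2 2 * (f 1 1 (x $ 1) * f 2 2 (x $ 1)) - ca M 1 2 * ca M 2 1 * K"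
    unfolding det_mat_at V_expand[OF assms] using g1 by (simp add: K_def)
  also have "\<dots> = (s1 * (ca M 1 1 * ca M 2 2) - ca M 1 2 * ca M 2 1) * K"
    unfolding s1_eq[symmetric] K_def[symmetric] by (simp add: algebra_simps)
  finally show ?thesis using K by auto
qed

lemma det_x2: assumes "M \<in> V q \<rho> \<sigma>"
  shows "det (mat_at M (x $ 2)) = 0 \<longleftrightarrow> cb M 1 2 * cb M 2 1 = s2 * (cb M 1 1 * cb M 2 2)"
proof -
  define K where "K = g 1 2 (x $ 2) * g 2 1 (x $ 2)"
  have K: "K \<noteq> 0" using g2 by (simp add: K_def)
  have "det (mat_at M (x $ 2)) = cb M 1 1 * cb M 2 2 * (g 1 1 (x $ 2) * g 2 2 (x $ 2)) - cb M 1 2 * cb M 2 1 * K"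
    unfolding det_mat_at V_expand[OF assms] using f2 by (simp add: K_def)
  also have "\<dots> = (s2 * (cb M 1 1 * cb M 2 2) - cb M 1 2 * cb M 2 1) * K"
    unfolding s2_eq[symmetric] K_def[symmetric] by (simp add: algebra_simps)
  finally show ?thesis using K by auto
qed

lemma det_x3: assumes "M \<in> V q \<rho> \<sigma>"
  shows "det (mat_at M (x $ 3)) =
    (ca M 1 1 + cb M 1 1) * (ca M 2 2 + cb M 2 2) - (ca M 1 2 + cb M 1 2) * (ca M 2 1 + cb M 2 1)"
  unfolding det_mat_at V_expand[OF assms] using f3 g3 by simp

lemma F_iff: "M \<in> F q \<rho> \<sigma> x \<longleftrightarrow> M \<in> V q \<rho> \<sigma> \<and> ca M 1 2 * ca M 2 1 = s1 * tens M $ 1 \<and>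
    cb M 1 2 * cb M 2 1 = s2 * tens M $ 2 \<and> ca M 1 2 * cb M 2 1 = clin M - tens M $ 5 \<and> det (mat_at M x0) \<noteq> 0"
proof -
  have "det (mat_at M (x $ 3)) = 0 \<longleftrightarrow> ca M 1 2 * cb M 2 1 = clin M - tens M $ 5"
    if "M \<in> V q \<rho> \<sigma>" "ca M 1 2 * ca M 2 1 = s1 * tens M $ 1" "cb M 1 2 * cb M 2 1 = s2 * tens M $ 2"
  proof -
    have "det (mat_at M (x $ 3)) = clin M - tens M $ 5 - ca M 1 2 * cb M 2 1"
      using that unfolding det_x3[OF that(1)] clin_def tens_nth by algebra
    then show ?thesis by auto
  qed
  then show ?thesis unfolding F_eq using det_x1[of M] det_x2[of M] by auto
qed

lemma det_x0:
  assumes M: "M \<in> V q \<rho> \<sigma>" "ca M 1 2 * ca M 2 1 = s1 * tens M $ 1" "cb M 1 2 * cb M 2 1 = s2 * tens M $ 2"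
    "ca M 1 2 * cb M 2 1 = clin M - tens M $ 5"
  shows "det (mat_at M x0) = (\<Sum>i\<in>UNIV. d $ i * tens M $ i)"
proof -
  have "det (mat_at M x0) = tens M $ 1 * (f 1 1 x0 * f 2 2 x0) + tens M $ 3 * (f 1 1 x0 * g 2 2 x0) +
      tens M $ 4 * (g 1 1 x0 * f 2 2 x0) + tens M $ 2 * (g 1 1 x0 * g 2 2 x0)
      - (ca M 1 2 * ca M 2 1 * (f 1 2 x0 * f 2 1 x0) + ca M 1 2 * cb M 2 1 * (f 1 2 x0 * g 2 1 x0)
         + tens M $ 5 * (g 1 2 x0 * f 2 1 x0) + cb M 1 2 * cb M 2 1 * (g 1 2 x0 * g 2 1 x0))"
    unfolding det_mat_at V_expand[OF M(1)] by (simp add: algebra_simps)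
  also have "\<dots> = (\<Sum>i\<in>UNIV. d $ i * tens M $ i)"
    unfolding M(2-4) sum_5 d1 d2 d3 d4 d5 clin_def by (simp add: algebra_simps)
  finally show ?thesis .
qed

text \<open>Otherwise \<open>det_x0\<close> would give determinant 0 at \<open>x0\<close> for a
  member of the nonempty set \<open>F\<close>.\<close>

lemma d_nonzero: "\<exists>i. d $ i \<noteq> 0"
proof (rule ccontr)
  assume "\<not> ?thesis"
  then have d: "d $ i = 0" for i by blast
  obtain M where "M \<in> F q \<rho> \<sigma> x" using F_nonempty by blast
  then have "det (mat_at M x0) \<noteq> 0" "det (mat_at M x0) = (\<Sum>i\<in>UNIV. d $ i * tens M $ i)"
    using F_iff[of M] det_x0[of M] by auto
  then show False by (simp add: d)
qed

end

locale monodromy = theta_params q \<rho> \<sigma> x f g x0 s1 s2 d + segre s1 s2 d m \<beta>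
  for q \<rho> \<sigma> x f g x0 s1 s2 d m \<beta>
begin

lemma clin_eq: "clin M = lin (tens M)"
  by (simp add: clin_def lin_def kk_def ll_def)

lemmas F_iff' = F_iff[unfolded clin_eq]
lemmas det_x0' = det_x0[unfolded clin_eq D_def[symmetric]]

lemma tens_cone: assumes "M \<in> F q \<rho> \<sigma> x" shows "tens M \<in> cone"
proof -
  have M: "ca M 1 2 * ca M 2 1 = s1 * tens M $ 1" "cb M 1 2 * cb M 2 1 = s2 * tens M $ 2"
    "ca M 1 2 * cb M 2 1 = lin (tens M) - tens M $ 5" using assms F_iff' by auto
  have "q1 (tens M) = 0" by (simp add: q1_def)
  moreover have "q2 (tens M) = (cb M 1 2 * cb M 2 1) * (ca M 1 2 * ca M 2 1) - ss * tens M $ 1 * tens M $ 2"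
    unfolding q2_def M(3)[symmetric] by simp
  then have "q2 (tens M) = 0" unfolding M(1,2) ss_def by simp
  ultimately show ?thesis by (simp add: cone_def)
qed

text \<open>The two tensors recovered from the five coordinates. Rows belong to the first factor and
  columns to the second; index 1 stands for the coefficient of \<open>f\<close>, index 2 for that of
  \<open>g\<close>.\<close>

definition tA :: "complex^5 \<Rightarrow> 2 \<Rightarrow> 2 \<Rightarrow> complex" where
  "tA e i j = (if i = 1 then if j = 1 then e $ 1 else e $ 3 else if j = 1 then e $ 4 else e $ 2)"
definition tB :: "complex^5 \<Rightarrow> 2 \<Rightarrow> 2 \<Rightarrow> complex" where
  "tB e i j = (if i = 1 then if j = 1 then s1 * e $ 1 else lin e - e $ 5 else if j = 1 then e $ 5 else s2 * e $ 2)"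

lemma t_nth [simp]: "tA e 1 1 = e $ 1" "tA e 1 2 = e $ 3" "tA e 2 1 = e $ 4" "tA e 2 2 = e $ 2"
  "tB e 1 1 = s1 * e $ 1" "tB e 1 2 = lin e - e $ 5" "tB e 2 1 = e $ 5" "tB e 2 2 = s2 * e $ 2"
  by (simp_all add: tA_def tB_def)

text \<open>Up to sign, \<open>q1\<close> and \<open>q2\<close> are the determinants of the two
  tensors.\<close>

lemma t_rank_one:
  assumes "e \<in> cone"
  shows "tA e a j * tA e i b = tA e a b * tA e i j" "tB e a j * tB e i b = tB e a b * tB e i j"
proof -
  have q: "e $ 3 * e $ 4 = e $ 1 * e $ 2" "e $ 5 * (lin e - e $ 5) = (s1 * e $ 1) * (s2 * e $ 2)"
    using assms by (simp_all add: cone_def q1_def q2_def ss_def)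
  show "tA e a j * tA e i b = tA e a b * tA e i j"
    using exhaust_2[of a] exhaust_2[of b] exhaust_2[of i] exhaust_2[of j] q(1) by (auto simp: mult.commute)
  show "tB e a j * tB e i b = tB e a b * tB e i j"
    using exhaust_2[of a] exhaust_2[of b] exhaust_2[of i] exhaust_2[of j] q(2) by (auto simp: mult.commute)
qed

text \<open>If the first tensor is 0, the second quadric leaves only \<open>x $ 5\<close>, with
  square 0. If the second is 0, coordinates 3 and 4 have sum 0 and product 0. Either way
  \<open>e = 0\<close>, so the tensors cannot vanish separately.\<close>

lemma t_nonzero:
  assumes e: "e \<in> cone" "e \<noteq> 0"
  shows "\<exists>i j. tA e i j \<noteq> 0" "\<exists>i j. tB e i j \<noteq> 0"
proof -
  have q: "e $ 3 * e $ 4 = e $ 1 * e $ 2" "e $ 5 * (lin e - e $ 5) = ss * e $ 1 * e $ 2"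
    using e by (simp_all add: cone_def q1_def q2_def)
  have e0: False if "e $ 1 = 0" "e $ 2 = 0" "e $ 3 = 0" "e $ 4 = 0" "e $ 5 = 0"
    using e(2) that by (simp add: vec_eq_iff forall_5)
  show "\<exists>i j. tA e i j \<noteq> 0"
  proof (rule ccontr)
    assume "\<not> ?thesis"
    then have "tA e 1 1 = 0" "tA e 1 2 = 0" "tA e 2 1 = 0" "tA e 2 2 = 0" by blast+
    then have "e $ 1 = 0" "e $ 3 = 0" "e $ 4 = 0" "e $ 2 = 0" by simp_all
    then show False using q(2) e0 by (simp add: lin_def)
  qed
  show "\<exists>i j. tB e i j \<noteq> 0"
  proof (rule ccontr)
    assume "\<not> ?thesis"
    then have "tB e 1 1 = 0" "tB e 1 2 = 0" "tB e 2 1 = 0" "tB e 2 2 = 0" by blast+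
    then have z: "e $ 1 = 0" "lin e = e $ 5" "e $ 5 = 0" "e $ 2 = 0" using s1 s2 by simp_all
    then have "e $ 3 + e $ 4 = 0" by (simp add: lin_def)
    moreover have "e $ 3 * e $ 4 = 0" using q(1) z by simp
    ultimately have "e $ 3 = 0" "e $ 4 = 0" by (auto simp: add_eq_0_iff)
    then show False using z e0 by simp
  qed
qed

definition va :: "fun_matrix \<Rightarrow> 2 \<Rightarrow> 2 \<Rightarrow> complex^2" where
  "va M i j = (\<chi> k. if k = 1 then ca M i j else cb M i j)"

lemma va_nth [simp]: "va M i j $ 1 = ca M i j" "va M i j $ 2 = cb M i j"
  by (simp_all add: va_def)

lemma F_tensors:
  assumes "M \<in> F q \<rho> \<sigma> x"
  shows "va M 1 1 $ k * va M 2 2 $ l = tA (tens M) k l" "va M 1 2 $ k * va M 2 1 $ l = tB (tens M) k l"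
proof -
  have M: "ca M 1 2 * ca M 2 1 = s1 * tens M $ 1" "cb M 1 2 * cb M 2 1 = s2 * tens M $ 2"
    "ca M 1 2 * cb M 2 1 = lin (tens M) - tens M $ 5" using assms F_iff' by auto
  show "va M 1 1 $ k * va M 2 2 $ l = tA (tens M) k l"
    using exhaust_2[of k] exhaust_2[of l] by (auto simp del: tens_nth) auto
  show "va M 1 2 $ k * va M 2 1 $ l = tB (tens M) k l"
    using exhaust_2[of k] exhaust_2[of l] M by auto
qed


text \<open>Transport to the model of affine space used by \<open>affine_variety\<close>, along a
  numbering of the four coordinates.\<close>

lemma affine_Y: "affine_variety (subvariety cart_space Y)"
proof -
  have "card {..<4::nat} = card (UNIV :: 4 set)" by simp
  then obtain \<iota> where \<iota>: "bij_betw \<iota> {..<4::nat} (UNIV :: 4 set)"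
    using finite_same_card_bij[of "{..<4::nat}" "UNIV :: 4 set"] by auto
  define \<kappa> where "\<kappa> = inv_into {..<4} \<iota>"
  have \<kappa>: "\<kappa> i < 4" "\<iota> (\<kappa> i) = i" for i
    using \<iota> unfolding \<kappa>_def bij_betw_def by (metis UNIV_I inv_into_into lessThan_iff, metis UNIV_I f_inv_into_f)
  have \<kappa>\<iota>: "\<kappa> (\<iota> n) = n" if "n < 4" for n
    using \<iota> that unfolding \<kappa>_def bij_betw_def by (simp add: inv_into_f_f)
  define \<phi> where "\<phi> = (\<lambda>(y::complex^4) n. if n < 4 then y $ \<iota> n else 0)"
  define \<psi> where "\<psi> = (\<lambda>v::nat \<Rightarrow> complex. (\<chi> i. v (\<kappa> i)) :: complex^4)"
  let ?L = "{\<lambda>v::nat \<Rightarrow> complex. v i | i. i < 4}"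
  let ?C = "{v::nat \<Rightarrow> complex. \<forall>i\<ge>4. v i = 0}"
  have \<phi>C: "\<phi> y \<in> ?C" and \<psi>\<phi>: "\<psi> (\<phi> y) = y" for y
    by (auto simp: \<phi>_def \<psi>_def vec_eq_iff \<kappa>)
  have \<phi>\<psi>: "\<phi> (\<psi> v) = v" if "v \<in> ?C" for v
    using that by (auto simp: \<phi>_def \<psi>_def \<kappa>\<iota> fun_eq_iff)
  have \<psi>poly: "(\<lambda>v. f (\<psi> v)) \<in> poly_funs ?L" if "f \<in> poly_funs coords" for f
    using that
  proof (rule poly_funs_compose)
    fix l :: "complex^4 \<Rightarrow> complex" assume "l \<in> coords"
    then obtain i where "l = (\<lambda>v. v $ i)" by (auto simp: coords_def)
    then show "(\<lambda>v. l (\<psi> v)) \<in> poly_funs ?L" using \<kappa>(1)[of i] by (auto simp: \<psi>_def intro!: poly_funs.gen)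
  qed
  have qa: "quasi_affine (affine_space 4) ?L ?C" unfolding affine_space_def by (rule quasi_affine_linear_space)
  define Z where "Z = \<phi> ` Y"
  have ZC: "Z \<subseteq> ?C" using \<phi>C by (auto simp: Z_def)
  have "Z = {v \<in> ?C. \<forall>f\<in>{\<lambda>v. q1 (emb (\<psi> v)), \<lambda>v. q2 (emb (\<psi> v))}. f v = 0}"
  proof (intro set_eqI iffI)
    fix v assume "v \<in> Z"
    then obtain y where "y \<in> Y" "v = \<phi> y" by (auto simp: Z_def)
    then show "v \<in> {v \<in> ?C. \<forall>f\<in>{\<lambda>v. q1 (emb (\<psi> v)), \<lambda>v. q2 (emb (\<psi> v))}. f v = 0}"
      using \<phi>C[of y] \<psi>\<phi>[of y] by (auto simp: Y_def cone_def)
  next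
    fix v assume v: "v \<in> {v \<in> ?C. \<forall>f\<in>{\<lambda>v. q1 (emb (\<psi> v)), \<lambda>v. q2 (emb (\<psi> v))}. f v = 0}"
    then have "\<psi> v \<in> Y" "v = \<phi> (\<psi> v)" using \<phi>\<psi>[of v] by (auto simp: Y_def cone_def)
    then show "v \<in> Z" unfolding Z_def by blast
  qed
  moreover have "{\<lambda>v. q1 (emb (\<psi> v)), \<lambda>v. q2 (emb (\<psi> v))} \<subseteq> poly_funs ?L"
    using \<psi>poly[OF poly_emb[OF poly_in(1)]] \<psi>poly[OF poly_emb[OF poly_in(2)]] by simp
  ultimately have "closedin (zar (affine_space 4)) Z" unfolding quasi_affine_closedin[OF qa] by blast
  moreover have "isomorphism (subvariety cart_space Y) (subvariety (affine_space 4) Z) \<phi>"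
  proof (rule quasi_affine_isomorphism[OF qa_Y quasi_affine_subvariety[OF qa ZC]])
    show "\<phi> p \<in> Z" if "p \<in> Y" for p using that by (simp add: Z_def)
    show "\<psi> v \<in> Y" if "v \<in> Z" for v using that \<psi>\<phi> by (auto simp: Z_def)
    show "\<psi> (\<phi> p) = p" for p by (rule \<psi>\<phi>)
    show "\<phi> (\<psi> v) = v" if "v \<in> Z" for v using \<phi>\<psi> that ZC by blast
    show "locrat coords Y (\<lambda>p. l (\<phi> p))" if "l \<in> ?L" for l
      using that by (auto simp: \<phi>_def intro!: locrat_poly)
    show "locrat ?L Z (\<lambda>p. l (\<psi> p))" if "l \<in> coords" for l
      by (rule locrat_poly[OF \<psi>poly[OF poly_funs.gen[OF that]]])
  qed
  ultimately show ?thesis unfolding affine_variety_def by blast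
qed

end

lemma affine_variety_isomorphism: "isomorphism X Y \<phi> \<Longrightarrow> affine_variety Y \<Longrightarrow> affine_variety X"
  unfolding affine_variety_def using isomorphism_compose by blast

context monodromy
begin

section \<open>The isomorphism between the quotient F and the affine surface\<close>

definition d0 :: "fun_matrix \<Rightarrow> complex" where "d0 M = det (mat_at M x0)"
definition tau :: "fun_matrix \<Rightarrow> complex^4" where "tau M = proj ((1 / d0 M) *s tens M)"

lemma d0_F: "M \<in> F q \<rho> \<sigma> x \<Longrightarrow> d0 M \<noteq> 0" "M \<in> F q \<rho> \<sigma> x \<Longrightarrow> D (tens M) = d0 M"
  using F_iff'[of M] det_x0'[of M] by (auto simp: d0_def)

lemma cone_scale: "e \<in> cone \<Longrightarrow> t *s e \<in> cone"
proof -
  have "q1 (t *s e) = t ^ 2 * q1 e" "q2 (t *s e) = t ^ 2 * q2 e"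
    by (simp_all add: q1_def q2_def lin_def power2_eq_square algebra_simps)
  then show "e \<in> cone \<Longrightarrow> t *s e \<in> cone" by (simp add: cone_def)
qed

lemma emb_tau: "M \<in> F q \<rho> \<sigma> x \<Longrightarrow> emb (tau M) = (1 / d0 M) *s tens M"
  unfolding tau_def using d0_F by (intro emb_proj) (simp add: D_scale)

lemma tau_Y: "M \<in> F q \<rho> \<sigma> x \<Longrightarrow> tau M \<in> Y"
  by (simp add: Y_def emb_tau cone_scale tens_cone)

lemma tens_nonzero: "M \<in> F q \<rho> \<sigma> x \<Longrightarrow> tens M \<noteq> 0"
  using d0_F[of M] by (auto simp: D_def)

lemma F_sub_V_star: "F q \<rho> \<sigma> x \<subseteq> V_star q \<rho> \<sigma>"
proof
  fix M assume M: "M \<in> F q \<rho> \<sigma> x"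
  have nz: "\<exists>k l. tA (tens M) k l \<noteq> 0" "\<exists>k l. tB (tens M) k l \<noteq> 0"
    using t_nonzero[OF tens_cone[OF M] tens_nonzero[OF M]] by auto
  have z: "va M i j $ k = 0" if "M $ i $ j = (\<lambda>_. 0)" for i j k
    using that exhaust_2[of k] by (auto simp: ca_def cb_def)
  have "M $ 1 $ 1 \<noteq> (\<lambda>_. 0)" "M $ 2 $ 2 \<noteq> (\<lambda>_. 0)"
    using nz(1) F_tensors(1)[OF M] z[of 1 1] z[of 2 2] by (metis mult_eq_0_iff)+
  moreover have "M $ 1 $ 2 \<noteq> (\<lambda>_. 0)" "M $ 2 $ 1 \<noteq> (\<lambda>_. 0)"
    using nz(2) F_tensors(2)[OF M] z[of 1 2] z[of 2 1] by (metis mult_eq_0_iff)+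
  moreover have "M \<in> V q \<rho> \<sigma>" using M by (simp add: F_def)
  ultimately show "M \<in> V_star q \<rho> \<sigma>" by (simp add: V_star_def forall_2)
qed

lemma scale_nth: "(scale \<gamma> \<delta> M $ i $ j) z = \<gamma> $ i * \<delta> $ j * (M $ i $ j) z"
  by (simp add: scale_def)

lemma ca_scale: "ca (scale \<gamma> \<delta> M) i j = \<gamma> $ i * \<delta> $ j * ca M i j"
  and cb_scale: "cb (scale \<gamma> \<delta> M) i j = \<gamma> $ i * \<delta> $ j * cb M i j"
  by (simp_all add: ca_def cb_def scale_nth)

lemma scale_V: assumes "M \<in> V q \<rho> \<sigma>" shows "scale \<gamma> \<delta> M \<in> V q \<rho> \<sigma>"
proof -
  have "(\<lambda>z. \<gamma> $ i * \<delta> $ j * (M $ i $ j) z) \<in> theta_space q (\<rho> $ i / \<sigma> $ j)" for i j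
    using theta_space_lincomb[of "M $ i $ j" q "\<rho> $ i / \<sigma> $ j" "M $ i $ j" "\<gamma> $ i * \<delta> $ j" 0] assms
    by (simp add: V_def)
  then show ?thesis by (simp add: V_def scale_def)
qed

text \<open>The character by which the torus acts on both tensors and on the determinant; their
  ratio \<open>tau\<close> is therefore invariant.\<close>

definition wt :: "complex^2 \<Rightarrow> complex^2 \<Rightarrow> complex" where "wt \<gamma> \<delta> = \<gamma> $ 1 * \<gamma> $ 2 * (\<delta> $ 1 * \<delta> $ 2)"

lemma tens_scale: "tens (scale \<gamma> \<delta> M) = wt \<gamma> \<delta> *s tens M"
  by (simp add: vec_eq_iff forall_5 ca_scale cb_scale wt_def mult_ac)

lemma d0_scale: "d0 (scale \<gamma> \<delta> M) = wt \<gamma> \<delta> * d0 M"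
  by (simp add: d0_def det_mat_at scale_nth wt_def algebra_simps)

lemma lin_scale: "lin (t *s e) = t * lin e"
  by (simp add: lin_def algebra_simps)

lemma tau_scale:
  assumes "wt \<gamma> \<delta> \<noteq> 0" shows "tau (scale \<gamma> \<delta> M) = tau M"
proof -
  have "(1 / (wt \<gamma> \<delta> * d0 M)) *s (wt \<gamma> \<delta> *s tens M) = (1 / d0 M) *s tens M"
    unfolding vector_smult_assoc using assms by simp
  then show ?thesis unfolding tau_def d0_scale tens_scale by (rule arg_cong)
qed

lemma wt_nz: "\<forall>i. \<gamma> $ i \<noteq> 0 \<and> \<delta> $ i \<noteq> 0 \<Longrightarrow> wt \<gamma> \<delta> \<noteq> 0"
  by (simp add: wt_def)

lemma orbit_invariant:
  assumes "orbit M = orbit N" shows "(d0 M \<noteq> 0 \<longleftrightarrow> d0 N \<noteq> 0) \<and> tau M = tau N"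
proof -
  obtain \<gamma> \<delta> where "N = scale \<gamma> \<delta> M" "\<forall>i. \<gamma> $ i \<noteq> 0 \<and> \<delta> $ i \<noteq> 0" by (rule orbit_cases[OF assms])
  then show ?thesis using wt_nz tau_scale d0_scale by auto
qed

lemma tau_fiber:
  assumes M: "M \<in> F q \<rho> \<sigma> x" and N: "N \<in> F q \<rho> \<sigma> x" and e: "tau M = tau N"
  shows "orbit M = orbit N"
proof -
  define c where "c = d0 N / d0 M"
  have d: "d0 M \<noteq> 0" "d0 N \<noteq> 0" using d0_F M N by auto
  then have c: "c \<noteq> 0" by (simp add: c_def)
  have "(1 / d0 N) *s tens N = (1 / d0 M) *s tens M" using e emb_tau M N by metis
  then have "d0 N *s ((1 / d0 N) *s tens N) = d0 N *s ((1 / d0 M) *s tens M)" by simp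
  then have tN: "tens N = c *s tens M" unfolding vector_smult_assoc using d by (simp add: c_def)
  have tA: "tA (tens N) k l = c * tA (tens M) k l" and tB: "tB (tens N) k l = c * tB (tens M) k l" for k l
    unfolding tN tA_def tB_def lin_scale by (simp_all add: algebra_simps)
  have nz: "\<exists>k l. tA (tens M) k l \<noteq> 0" "\<exists>k l. tB (tens M) k l \<noteq> 0"
    using t_nonzero[OF tens_cone[OF M] tens_nonzero[OF M]] by auto
  have "\<exists>t. t \<noteq> 0 \<and> (\<forall>i. va N 1 1 $ i = t * va M 1 1 $ i) \<and> (\<forall>i. va N 2 2 $ i = c / t * va M 2 2 $ i)"
    by (rule rank_one_unique[OF c]) (use nz(1) tA in \<open>simp_all only: F_tensors[OF M] F_tensors[OF N]\<close>)
  then obtain t where t: "t \<noteq> 0" "\<forall>i. va N 1 1 $ i = t * va M 1 1 $ i" "\<forall>i. va N 2 2 $ i = c / t * va M 2 2 $ i" by blast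
  have "\<exists>t. t \<noteq> 0 \<and> (\<forall>i. va N 1 2 $ i = t * va M 1 2 $ i) \<and> (\<forall>i. va N 2 1 $ i = c / t * va M 2 1 $ i)"
    by (rule rank_one_unique[OF c]) (use nz(2) tB in \<open>simp_all only: F_tensors[OF M] F_tensors[OF N]\<close>)
  then obtain t' where t': "t' \<noteq> 0" "\<forall>i. va N 1 2 $ i = t' * va M 1 2 $ i" "\<forall>i. va N 2 1 $ i = c / t' * va M 2 1 $ i" by blast
  \<comment> \<open>The four entries must be scaled by \<open>t\<close>, \<open>t'\<close>,
    \<open>c / t'\<close>, \<open>c / t\<close>. These are products of row and column factors
    because both tensors are scaled by the same \<open>c\<close>; the first row factor is set to
    1.\<close>
  define \<gamma> :: "complex^2" where "\<gamma> = (\<chi> i. if i = 1 then 1 else c / (t * t'))"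
  define \<delta> :: "complex^2" where "\<delta> = (\<chi> i. if i = 1 then t else t')"
  have gd: "\<gamma> $ 1 * \<delta> $ 1 = t" "\<gamma> $ 1 * \<delta> $ 2 = t'" "\<gamma> $ 2 * \<delta> $ 1 = c / t'" "\<gamma> $ 2 * \<delta> $ 2 = c / t"
    using t(1) t'(1) by (simp_all add: \<gamma>_def \<delta>_def)
  have "ca N i j = \<gamma> $ i * \<delta> $ j * ca M i j" "cb N i j = \<gamma> $ i * \<delta> $ j * cb M i j" for i j
    using t(2,3)[THEN spec, of 1] t(2,3)[THEN spec, of 2] t'(2,3)[THEN spec, of 1] t'(2,3)[THEN spec, of 2]
      exhaust_2[of i] exhaust_2[of j] gd by auto
  then have "ca N = ca (scale \<gamma> \<delta> M)" "cb N = cb (scale \<gamma> \<delta> M)"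
    by (auto simp: fun_eq_iff ca_scale cb_scale)
  moreover have "N \<in> V q \<rho> \<sigma>" "M \<in> V q \<rho> \<sigma>" using M N by (auto simp: F_def)
  ultimately have "N = scale \<gamma> \<delta> M" using ofc_coords[of N] ofc_coords[OF scale_V[of M]] by metis
  moreover have "\<forall>i. \<gamma> $ i \<noteq> 0 \<and> \<delta> $ i \<noteq> 0" using t(1) t'(1) c by (simp add: \<gamma>_def \<delta>_def)
  ultimately show ?thesis using orbit_scale by simp
qed

text \<open>A local section of \<open>tau\<close>: a rank one tensor \<open>t\<close> with \<open>t i j \<noteq> 0\<close> is the product of its
  \<open>j\<close>-th column and its normalized \<open>i\<close>-th row.\<close>

definition sect :: "2 \<Rightarrow> 2 \<Rightarrow> 2 \<Rightarrow> 2 \<Rightarrow> complex^5 \<Rightarrow> 2 \<Rightarrow> 2 \<Rightarrow> 2 \<Rightarrow> complex" where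
  "sect i j k l e r a b = (if a = 1 then if b = 1 then tA e r j else tB e r l
     else if b = 1 then tB e k r / tB e k l else tA e i r / tA e i j)"

definition sectM :: "2 \<Rightarrow> 2 \<Rightarrow> 2 \<Rightarrow> 2 \<Rightarrow> complex^5 \<Rightarrow> fun_matrix" where
  "sectM i j k l e = ofc (sect i j k l e 1) (sect i j k l e 2)"

lemma sectM_F:
  assumes e: "e \<in> cone" "D e \<noteq> 0" and nz: "tA e i j \<noteq> 0" "tB e k l \<noteq> 0"
  shows "sectM i j k l e \<in> F q \<rho> \<sigma> x" "tens (sectM i j k l e) = e"
proof -
  let ?M = "sectM i j k l e"
  have A: "tA e a j * (tA e i b / tA e i j) = tA e a b" for a b
    using t_rank_one(1)[OF e(1), of a j i b] nz by simp
  have B: "tB e a l * (tB e k b / tB e k l) = tB e a b" for a b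
    using t_rank_one(2)[OF e(1), of a l k b] nz by simp
  have c: "ca ?M a b = sect i j k l e 1 a b" "cb ?M a b = sect i j k l e 2 a b" for a b
    by (simp_all add: sectM_def ca_ofc cb_ofc)
  show t: "tens ?M = e"
    unfolding vec_eq_iff forall_5 tens_nth c sect_def using A[of 1 1] A[of 2 2] A[of 1 2] A[of 2 1] B[of 2 1] by simp
  have V: "?M \<in> V q \<rho> \<sigma>" unfolding sectM_def by (rule ofc_V)
  have 3: "ca ?M 1 2 * ca ?M 2 1 = s1 * tens ?M $ 1" "cb ?M 1 2 * cb ?M 2 1 = s2 * tens ?M $ 2"
    "ca ?M 1 2 * cb ?M 2 1 = lin (tens ?M) - tens ?M $ 5"
    unfolding t unfolding c sect_def using B[of 1 1] B[of 2 2] B[of 1 2] by simp_all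
  from det_x0'[OF V 3] have "det (mat_at ?M x0) \<noteq> 0" using e(2) t by simp
  then show "?M \<in> F q \<rho> \<sigma> x" using F_iff' V 3 by blast
qed

lemma section_exists:
  assumes "y \<in> Y"
  obtains i j k l where "tA (emb y) i j \<noteq> 0" "tB (emb y) k l \<noteq> 0"
proof -
  have "emb y \<in> cone" using assms by (simp add: Y_def)
  moreover have "emb y \<noteq> 0" using D_emb[of y] by (auto simp: D_def)
  ultimately show ?thesis using t_nonzero that by blast
qed

lemma tau_sectM:
  assumes "y \<in> Y" "tA (emb y) i j \<noteq> 0" "tB (emb y) k l \<noteq> 0"
  shows "sectM i j k l (emb y) \<in> F q \<rho> \<sigma> x" "tau (sectM i j k l (emb y)) = y"
proof -
  have e: "emb y \<in> cone" "D (emb y) \<noteq> 0" using assms(1) D_emb by (simp_all add: Y_def)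
  show F: "sectM i j k l (emb y) \<in> F q \<rho> \<sigma> x" by (rule sectM_F(1)[OF e assms(2,3)])
  have t: "tens (sectM i j k l (emb y)) = emb y" by (rule sectM_F(2)[OF e assms(2,3)])
  then have "d0 (sectM i j k l (emb y)) = 1" using d0_F(2)[OF F] D_emb by simp
  then show "tau (sectM i j k l (emb y)) = y" by (simp add: tau_def t proj_emb)
qed

definition Eab :: "bool \<Rightarrow> 2 \<Rightarrow> 2 \<Rightarrow> fun_matrix" where
  "Eab c i j = ofc (\<lambda>k l. if c \<and> k = i \<and> l = j then 1 else 0) (\<lambda>k l. if \<not> c \<and> k = i \<and> l = j then 1 else 0)"

text \<open>Expansion in the eight basis matrices: it reduces local rationality of a linear form
  along the section to that of the entries of \<open>sect\<close>.\<close>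

lemma V_dual_ofc:
  assumes l: "l \<in> V_dual q \<rho> \<sigma>"
  shows "l (ofc a b) = a 1 1 * l (Eab True 1 1) + (a 1 2 * l (Eab True 1 2) + (a 2 1 * l (Eab True 2 1) +
    (a 2 2 * l (Eab True 2 2) + (b 1 1 * l (Eab False 1 1) + (b 1 2 * l (Eab False 1 2) +
    (b 2 1 * l (Eab False 2 1) + b 2 2 * l (Eab False 2 2)))))))"
proof -
  define xs where "xs = [(a 1 1, Eab True 1 1), (a 1 2, Eab True 1 2), (a 2 1, Eab True 2 1), (a 2 2, Eab True 2 2),
    (b 1 1, Eab False 1 1), (b 1 2, Eab False 1 2), (b 2 1, Eab False 2 1), (b 2 2, Eab False 2 2)]"
  have "ofc a b = build xs"
    unfolding xs_def by (simp add: vec_eq_iff forall_2 ofc_def Eab_def mcomb_def zeroM_def)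
  moreover have "\<forall>(c, E)\<in>set xs. E \<in> V q \<rho> \<sigma>" unfolding xs_def Eab_def using ofc_V by auto
  ultimately show ?thesis using V_dual_build[OF l, of xs] by (simp add: xs_def)
qed

lemma t_poly: "(\<lambda>y. tA (emb y) i j) \<in> poly_funs coords" "(\<lambda>y. tB (emb y) i j) \<in> poly_funs coords"
  using exhaust_2[of i] exhaust_2[of j]
  by (auto intro!: poly_funs_intros emb_poly poly_emb poly_in)

lemma sect_locrat:
  assumes "\<And>y. y \<in> U \<Longrightarrow> tA (emb y) i j \<noteq> 0 \<and> tB (emb y) k l \<noteq> 0"
  shows "locrat coords U (\<lambda>y. sect i j k l (emb y) r a b)"
proof -
  have "locrat coords U (\<lambda>y. tB (emb y) k r / tB (emb y) k l)" "locrat coords U (\<lambda>y. tA (emb y) i r / tA (emb y) i j)"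
    by (rule locrat_divide_poly[OF t_poly(2) t_poly(2)], use assms in auto)
       (rule locrat_divide_poly[OF t_poly(1) t_poly(1)], use assms in auto)
  then show ?thesis by (cases "a = 1"; cases "b = 1") (simp_all add: sect_def locrat_poly t_poly)
qed

lemma theta_isomorphism: "\<exists>\<theta>. isomorphism (F_variety q \<rho> \<sigma> x) (subvariety cart_space Y) \<theta>"
proof -
  let ?S = "V_star q \<rho> \<sigma>" and ?L = "V_dual q \<rho> \<sigma>" and ?F = "F q \<rho> \<sigma> x"
  define X where "X = subvariety (V_space q \<rho> \<sigma>) ?S"
  have qaX: "quasi_affine X ?L ?S"
    unfolding X_def V_space_def by (rule quasi_affine_subvariety[OF quasi_affine_linear_space]) (auto simp: V_star_def)
  have FV: "F_variety q \<rho> \<sigma> x = subvariety (quotient X orbit) (orbit ` ?F)"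
    by (simp add: F_variety_def V_star_mod_H_def X_def)
  \<comment> \<open>Both maps choose representatives; \<open>orbit_invariant\<close> and
    \<open>tau_fiber\<close> make the choices irrelevant.\<close>
  define \<theta> where "\<theta> = (\<lambda>O'. tau (SOME M. orbit M = O'))"
  define \<psi> where "\<psi> = (\<lambda>y. orbit (SOME M. M \<in> ?F \<and> tau M = y))"
  have \<theta>: "\<theta> (orbit M) = tau M" for M
  proof -
    have "orbit (SOME N. orbit N = orbit M) = orbit M" by (rule someI_ex) blast
    then show ?thesis unfolding \<theta>_def using orbit_invariant by blast
  qed
  have \<psi>: "\<psi> y = orbit M" if "M \<in> ?F" "tau M = y" for y M
  proof -
    have "(SOME M. M \<in> ?F \<and> tau M = y) \<in> ?F \<and> tau (SOME M. M \<in> ?F \<and> tau M = y) = y"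
      by (rule someI_ex) (use that in blast)
    then show ?thesis unfolding \<psi>_def using tau_fiber that by blast
  qed
  have d0_poly: "d0 \<in> poly_funs ?L"
    unfolding d0_def[abs_def] det_mat_at by (intro poly_funs_intros eval_poly)
  have c_poly: "(\<lambda>M. ca M i j) \<in> poly_funs ?L" "(\<lambda>M. cb M i j) \<in> poly_funs ?L" for i j
    unfolding ca_def cb_def divide_inverse by (intro poly_funs_intros eval_poly)+
  have tens_poly: "(\<lambda>M. tens M $ i) \<in> poly_funs ?L" for i
  proof -
    have "\<forall>i. (\<lambda>M. tens M $ i) \<in> poly_funs ?L"
      unfolding forall_5 tens_nth by (intro conjI poly_funs_intros c_poly)
    then show ?thesis by blast
  qed
  have m1: "morphism (F_variety q \<rho> \<sigma> x) (subvariety cart_space Y) \<theta>"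
    unfolding FV
  proof (rule morphism_from_quotient[where d = d0 and \<tau> = tau, OF qaX qa_Y F_sub_V_star d0_F(1) tau_Y d0_poly])
    show "(d0 p \<noteq> 0 \<longleftrightarrow> d0 p' \<noteq> 0) \<and> tau p = tau p'" if "orbit p = orbit p'" for p p'
      by (rule orbit_invariant[OF that])
    fix l :: "complex^4 \<Rightarrow> complex" assume "l \<in> coords"
    then obtain i where l: "l = (\<lambda>v. v $ i)" by (auto simp: coords_def)
    show "locrat ?L {p \<in> ?S. d0 p \<noteq> 0} (\<lambda>p. l (tau p))"
      by (rule locrat_divide_poly[OF tens_poly[of "\<beta> i"] d0_poly]) (auto simp: l tau_def proj_def)
  qed (rule \<theta> | assumption)+
  have m2: "morphism (subvariety cart_space Y) (F_variety q \<rho> \<sigma> x) \<psi>"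
    unfolding FV
  proof (rule morphism_to_quotient[OF qaX qa_Y _ F_sub_V_star])
    fix y assume y: "y \<in> Y"
    obtain i j k l where nz: "tA (emb y) i j \<noteq> 0" "tB (emb y) k l \<noteq> 0" by (rule section_exists[OF y])
    show "\<psi> y \<in> orbit ` ?F" using \<psi>[OF tau_sectM[OF y nz]] tau_sectM(1)[OF y nz] by blast
    \<comment> \<open>The local section is defined where the chosen entry of each tensor is
      nonzero.\<close>
    define c where "c = (\<lambda>y. tA (emb y) i j * tB (emb y) k l)"
    have "c \<in> poly_funs coords" unfolding c_def by (intro poly_funs.mult t_poly)
    moreover have "c y \<noteq> 0" using nz by (simp add: c_def)
    moreover have "sectM i j k l (emb y') \<in> ?S \<and> \<psi> y' = orbit (sectM i j k l (emb y'))"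
      if "y' \<in> Y" "c y' \<noteq> 0" for y'
    proof -
      have n: "tA (emb y') i j \<noteq> 0" "tB (emb y') k l \<noteq> 0" using that by (auto simp: c_def)
      show ?thesis using \<psi>[OF tau_sectM[OF that(1) n]] tau_sectM(1)[OF that(1) n] F_sub_V_star by blast
    qed
    moreover have "locrat coords {y' \<in> Y. c y' \<noteq> 0} (\<lambda>y. h (sectM i j k l (emb y)))" if h: "h \<in> ?L" for h
    proof -
      have s: "locrat coords {y' \<in> Y. c y' \<noteq> 0} (\<lambda>y. sect i j k l (emb y) r a b)" for r a b
        by (rule sect_locrat) (auto simp: c_def)
      show ?thesis unfolding sectM_def V_dual_ofc[OF h]
        by (intro locrat_add locrat_mult s locrat_poly poly_funs.const)
    qed
    ultimately show "\<exists>c\<in>poly_funs coords. \<exists>s. c y \<noteq> 0 \<and> (\<forall>y'\<in>Y. c y' \<noteq> 0 \<longrightarrow> s y' \<in> ?S \<and> \<psi> y' = orbit (s y')) \<and>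
        (\<forall>h\<in>?L. locrat coords {y' \<in> Y. c y' \<noteq> 0} (\<lambda>y. h (s y)))"
      by (intro bexI[of _ c] exI[of _ "\<lambda>y. sectM i j k l (emb y)"]) auto
  qed
  have pts: "points (F_variety q \<rho> \<sigma> x) = orbit ` ?F"
    unfolding FV by (rule points_quotient_subvariety[OF qaX F_sub_V_star])
  have "\<psi> (\<theta> p) = p" if "p \<in> points (F_variety q \<rho> \<sigma> x)" for p
    using that \<theta> \<psi> unfolding pts by auto
  moreover have "\<theta> (\<psi> y) = y" if "y \<in> points (subvariety cart_space Y)" for y
  proof -
    have y: "y \<in> Y" using that quasi_affine_points[OF qa_Y] by simp
    obtain i j k l where nz: "tA (emb y) i j \<noteq> 0" "tB (emb y) k l \<noteq> 0" by (rule section_exists[OF y])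
    show ?thesis using \<psi>[OF tau_sectM[OF y nz]] \<theta> tau_sectM(2)[OF y nz] by simp
  qed
  ultimately show ?thesis unfolding isomorphism_def using m1 m2 by blast
qed

lemma F_variety_properties:
  "(\<exists>Y \<theta>. affine_segre_surface Y \<and> isomorphism (F_variety q \<rho> \<sigma> x) (subvariety cart_space Y) \<theta> \<and> smooth Y) \<and>
   rational_surface (F_variety q \<rho> \<sigma> x) \<and> affine_variety (F_variety q \<rho> \<sigma> x)"
proof -
  obtain \<theta> where \<theta>: "isomorphism (F_variety q \<rho> \<sigma> x) (subvariety cart_space Y) \<theta>" using theta_isomorphism by blast
  then show ?thesis
    using segre_Y smooth_Y birational_isomorphism[OF \<theta> Y_rational] affine_variety_isomorphism[OF \<theta> affine_Y]
    unfolding rational_surface_def by blast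
qed

end

theorem proposition5p7:
  fixes q :: complex and \<rho> \<sigma> :: "complex^2" and x :: "complex^4"
  assumes "q \<noteq> 0" and "norm q < 1"
    and "\<forall>i. \<rho> $ i \<noteq> 0" and "\<forall>j. \<sigma> $ j \<noteq> 0" and "\<forall>k. x $ k \<noteq> 0"
    and "FR \<rho> \<sigma> x" and "NR q \<rho> \<sigma> x" and "NS q \<rho> \<sigma> x"
  shows "(\<exists>Y \<theta>. affine_segre_surface Y \<and>
                 isomorphism (F_variety q \<rho> \<sigma> x) (subvariety cart_space Y) \<theta> \<and>
                 smooth Y) \<and>
         rational_surface (F_variety q \<rho> \<sigma> x) \<and>
         affine_variety (F_variety q \<rho> \<sigma> x)"
proof -
  interpret nome q by unfold_locales (fact assms)+
  obtain f g x0 where "theta_bases q \<rho> \<sigma> x f g x0" using theta_bases_exist[OF assms(3-8)] by blast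
  then interpret theta_bases q \<rho> \<sigma> x f g x0 .
  define s1 where "s1 = f 1 1 (x $ 1) * f 2 2 (x $ 1) / (f 1 2 (x $ 1) * f 2 1 (x $ 1))"
  define s2 where "s2 = g 1 1 (x $ 2) * g 2 2 (x $ 2) / (g 1 2 (x $ 2) * g 2 1 (x $ 2))"
  define d :: "complex^5" where "d = (\<chi> i.
     if i = 1 then f 1 1 x0 * f 2 2 x0 - s1 * (f 1 2 x0 * f 2 1 x0) - (1 - s1) * (f 1 2 x0 * g 2 1 x0)
     else if i = 2 then g 1 1 x0 * g 2 2 x0 - s2 * (g 1 2 x0 * g 2 1 x0) - (1 - s2) * (f 1 2 x0 * g 2 1 x0)
     else if i = 3 then f 1 1 x0 * g 2 2 x0 - f 1 2 x0 * g 2 1 x0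
     else if i = 4 then g 1 1 x0 * f 2 2 x0 - f 1 2 x0 * g 2 1 x0
     else f 1 2 x0 * g 2 1 x0 - g 1 2 x0 * f 2 1 x0)"
  interpret theta_params q \<rho> \<sigma> x f g x0 s1 s2 d
    by unfold_locales (use f1 g2 in \<open>simp_all add: s1_def s2_def d_def\<close>)
  obtain m where m: "d $ m \<noteq> 0" using d_nonzero by blast
  have "card (UNIV :: 4 set) = card (UNIV - {m})" by simp
  then obtain \<beta> where \<beta>: "bij_betw \<beta> (UNIV :: 4 set) (UNIV - {m})"
    using finite_same_card_bij[of "UNIV :: 4 set" "UNIV - {m}"] by auto
  interpret segre s1 s2 d m \<beta>
  proof unfold_locales
    show "s1 \<noteq> 0" "s2 \<noteq> 0" using f1 g2 by (simp_all add: s1_def s2_def)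
    show "s1 \<noteq> 1" using ne1 f1 by (simp add: s1_def)
    show "s2 \<noteq> 1" using ne2 g2 by (simp add: s2_def)
    show "s1 \<noteq> s2" using ne12 f1 g2 by (simp add: s1_def s2_def frac_eq_eq mult_ac)
  qed (fact m \<beta>)+
  interpret monodromy q \<rho> \<sigma> x f g x0 s1 s2 d m \<beta> ..
  show ?thesis by (rule F_variety_properties)
qed

end
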